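(* Let $V$ be an object in an abelian braided category, $B=B_+(V)$, $\Lambda=\Lambda(V)$, and let $(\Omega^{0,\bullet}=B\underline\otimes\Lambda,\bar\partial)$ and $(\Omega^{\bullet,0}=\Lambda\underline\otimes B,\partial)$ be the DGAs described in the context. Then $$\Omega^{p,q}=\Lambda^p\,\underline\otimes\, B\,\underline\otimes\,\Lambda^q,$$ $$\partial:\Omega^{p,q}\to\Omega^{p+1,q},\quad \partial=(-1)^p\big((\wedge\otimes\mathrm{id})(\mathrm{id}\otimes\varpi\otimes\mathrm{id})(\mathrm{id}\otimes\Delta)\big)\otimes\mathrm{id},$$ $$\bar\partial:\Omega^{p,q}\to\Omega^{p,q+1},\quad \bar\partial=(-1)^p\,\mathrm{id}\otimes\big((\mathrm{id}\otimes\wedge)(\mathrm{id}\otimes\varpi\otimes\mathrm{id})(\Delta\otimes\mathrm{id})\big)$$ make $\Omega^{\bullet,\bullet}$ into a double complex.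
   Context: The category is a ($k$-linear) abelian braided monoidal category with braiding $\Psi_{X,Y}:X\otimes Y\to Y\otimes X$, in which the tensor algebra and the quotients below make sense; the main example is right comodules over a coquasitriangular Hopf algebra, so element notation is used. The braided tensor product $B\underline\otimes C$ of algebras in the category has product $(b\otimes c)(b'\otimes c')=b\,\Psi_{C,B}(c\otimes b')\,c'$. When graded-commutative (super) factors are involved there is an additional sign $(-1)^{|c||b'|}$; here $\Lambda$ has its natural degree and $B$ has degree $0$, so in $\Lambda\underline\otimes B\underline\otimes\Lambda$ a sign $(-1)^{qp'}$ arises when the right factor $\Lambda^q$ crosses the left factor $\Lambda^{p'}$ of the next element. The braided factorial is $[n,\Psi]!=\sum_{\sigma\in S_n}\Psi_\sigma:V^{\otimes n}\to V^{\otimes n}$, where $\Psi_\sigma$ is obtained from a reduced expression of $\sigma$ by replacing the simple transposition $(i,i+1)$ by $\Psi_{V,V}$ in positions $i,i+1$. Define $B_+(V)=TV/\oplus_n\ker[n,\Psi]!$, with $TV$ the tensor algebra. It is a braided Hopf algebra with $\Delta:B\to B\underline\otimes B$ the algebra map with $\Delta v=v\otimes1+1\otimes v$ for $v\in V$. $\varpi:B\to V$ is projection to degree 1. $\Lambda(V)=TV/\langle\mathrm{Im}(\mathrm{id}+\Psi_{V,V})\rangle$ (two-sided ideal), with product $\wedge$ and $\Lambda^1=V$. $\Omega^{0,\bullet}=B\underline\otimes\Lambda$ is a DGA with $\bar\partial=(\mathrm{id}\otimes\wedge)(\mathrm{id}\otimes\varpi\otimes\mathrm{id})(\Delta\otimes\mathrm{id})$,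 and $\Omega^{\bullet,0}=\Lambda\underline\otimes B$ is a DGA with $\partial=(-1)^p(\wedge\otimes\mathrm{id})(\mathrm{id}\otimes\varpi\otimes\mathrm{id})(\mathrm{id}\otimes\Delta)$ on $\Lambda^p\underline\otimes B$. Double complex means: $\Omega=\oplus_{p,q}\Omega^{p,q}$ is a bigraded algebra, $\partial,\bar\partial$ are graded derivations (with respect to total degree) of bidegrees $(1,0),(0,1)$, and $\partial^2=\bar\partial^2=\partial\bar\partial+\bar\partial\partial=0$. *)

theory Defs
  imports "HOL-Algebra.Group" "HOL-Algebra.FiniteProduct" "HOL-Combinatorics.Permutations"
begin

section \<open>Abelian braided monoidal categories\<close>

text \<open>
  The monoidal structure is not assumed to be strict. Composition, addition and the tensor
  product are total HOL functions; their values matter only on arrows with matching (co)domains.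
\<close>

record ('o, 'a) braided_cat =
  Ob :: "'o set"
  Arr :: "'a set"
  Dom :: "'a \<Rightarrow> 'o"
  Cod :: "'a \<Rightarrow> 'o"
  Ide :: "'o \<Rightarrow> 'a"
  Cmp :: "'a \<Rightarrow> 'a \<Rightarrow> 'a" (infixr "\<cdot>\<index>" 70)
  Add :: "'a \<Rightarrow> 'a \<Rightarrow> 'a" (infixl "\<boxplus>\<index>" 65)
  Zro :: "'o \<Rightarrow> 'o \<Rightarrow> 'a"
  TenO :: "'o \<Rightarrow> 'o \<Rightarrow> 'o" (infixl "\<boxdot>\<index>" 80)
  TenA :: "'a \<Rightarrow> 'a \<Rightarrow> 'a" (infixl "\<boxtimes>\<index>" 75)
  Uni :: "'o"
  Asc :: "'o \<Rightarrow> 'o \<Rightarrow> 'o \<Rightarrow> 'a"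
  Lun :: "'o \<Rightarrow> 'a"
  Run :: "'o \<Rightarrow> 'a"
  Brd :: "'o \<Rightarrow> 'o \<Rightarrow> 'a"

definition Hom :: "('o, 'a, 'z) braided_cat_scheme \<Rightarrow> 'o \<Rightarrow> 'o \<Rightarrow> 'a set" where
  "Hom C X Y = {f \<in> Arr C. Dom C f = X \<and> Cod C f = Y}"

definition hom_group :: "('o, 'a, 'z) braided_cat_scheme \<Rightarrow> 'o \<Rightarrow> 'o \<Rightarrow> 'a monoid" where
  "hom_group C X Y = \<lparr>carrier = Hom C X Y, monoid.mult = Add C, one = Zro C X Y\<rparr>"

text \<open>The arrow \<open>(-1)^n f\<close>.\<close>

definition signed :: "('o, 'a, 'z) braided_cat_scheme \<Rightarrow> nat \<Rightarrow> 'a \<Rightarrow> 'a" where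
  "signed C n f = (if even n then f else inv\<^bsub>hom_group C (Dom C f) (Cod C f)\<^esub> f)"

definition inverse_arrows :: "('o, 'a, 'z) braided_cat_scheme \<Rightarrow> 'a \<Rightarrow> 'a \<Rightarrow> bool" where
  "inverse_arrows C f g \<longleftrightarrow> f \<in> Arr C \<and> g \<in> Hom C (Cod C f) (Dom C f) \<and>
     Cmp C g f = Ide C (Dom C f) \<and> Cmp C f g = Ide C (Cod C f)"

definition iso_arrow :: "('o, 'a, 'z) braided_cat_scheme \<Rightarrow> 'a \<Rightarrow> bool" where
  "iso_arrow C f \<longleftrightarrow> (\<exists>g. inverse_arrows C f g)"

definition Inv :: "('o, 'a, 'z) braided_cat_scheme \<Rightarrow> 'a \<Rightarrow> 'a" where
  "Inv C f = (THE g. inverse_arrows C f g)"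

locale category =
  fixes C :: "('o, 'a, 'z) braided_cat_scheme" (structure)
  assumes Dom_Ob: "f \<in> Arr C \<Longrightarrow> Dom C f \<in> Ob C"
    and Cod_Ob: "f \<in> Arr C \<Longrightarrow> Cod C f \<in> Ob C"
    and Ide_Hom: "X \<in> Ob C \<Longrightarrow> Ide C X \<in> Hom C X X"
    and Cmp_Hom: "\<lbrakk>f \<in> Hom C X Y; g \<in> Hom C Y Z\<rbrakk> \<Longrightarrow> g \<cdot> f \<in> Hom C X Z"
    and Cmp_Ide: "f \<in> Hom C X Y \<Longrightarrow> f \<cdot> Ide C X = f"
    and Ide_Cmp: "f \<in> Hom C X Y \<Longrightarrow> Ide C Y \<cdot> f = f"
    and Cmp_assoc: "\<lbrakk>f \<in> Hom C W X; g \<in> Hom C X Y; h \<in> Hom C Y Z\<rbrakk>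
      \<Longrightarrow> (h \<cdot> g) \<cdot> f = h \<cdot> (g \<cdot> f)"

locale preadditive_category = category +
  assumes hom_comm_group: "\<lbrakk>X \<in> Ob C; Y \<in> Ob C\<rbrakk> \<Longrightarrow> comm_group (hom_group C X Y)"
    and Cmp_Add: "\<lbrakk>f \<in> Hom C X Y; f' \<in> Hom C X Y; g \<in> Hom C Y Z\<rbrakk>
      \<Longrightarrow> g \<cdot> (f \<boxplus> f') = g \<cdot> f \<boxplus> g \<cdot> f'"
    and Add_Cmp: "\<lbrakk>f \<in> Hom C X Y; g \<in> Hom C Y Z; g' \<in> Hom C Y Z\<rbrakk>
      \<Longrightarrow> (g \<boxplus> g') \<cdot> f = g \<cdot> f \<boxplus> g' \<cdot> f"

definition zero_object :: "('o, 'a, 'z) braided_cat_scheme \<Rightarrow> 'o \<Rightarrow> bool" where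
  "zero_object C Z \<longleftrightarrow> Z \<in> Ob C \<and>
     (\<forall>X\<in>Ob C. (\<exists>!f. f \<in> Hom C X Z) \<and> (\<exists>!f. f \<in> Hom C Z X))"

definition is_biproduct ::
  "('o, 'a, 'z) braided_cat_scheme \<Rightarrow> 'o \<Rightarrow> 'o \<Rightarrow> 'o \<Rightarrow> 'a \<Rightarrow> 'a \<Rightarrow> 'a \<Rightarrow> 'a \<Rightarrow> bool" where
  "is_biproduct C X Y P i j p r \<longleftrightarrow>
     i \<in> Hom C X P \<and> j \<in> Hom C Y P \<and> p \<in> Hom C P X \<and> r \<in> Hom C P Y \<and>
     Cmp C p i = Ide C X \<and> Cmp C r j = Ide C Y \<and>
     Cmp C p j = Zro C Y X \<and> Cmp C r i = Zro C X Y \<and>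
     Add C (Cmp C i p) (Cmp C j r) = Ide C P"

definition mono_arrow :: "('o, 'a, 'z) braided_cat_scheme \<Rightarrow> 'a \<Rightarrow> bool" where
  "mono_arrow C f \<longleftrightarrow> f \<in> Arr C \<and>
     (\<forall>W g h. g \<in> Hom C W (Dom C f) \<and> h \<in> Hom C W (Dom C f) \<and> Cmp C f g = Cmp C f h \<longrightarrow> g = h)"

definition epi_arrow :: "('o, 'a, 'z) braided_cat_scheme \<Rightarrow> 'a \<Rightarrow> bool" where
  "epi_arrow C f \<longleftrightarrow> f \<in> Arr C \<and>
     (\<forall>W g h. g \<in> Hom C (Cod C f) W \<and> h \<in> Hom C (Cod C f) W \<and> Cmp C g f = Cmp C h f \<longrightarrow> g = h)"

definition is_kernel :: "('o, 'a, 'z) braided_cat_scheme \<Rightarrow> 'a \<Rightarrow> 'a \<Rightarrow> bool" where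
  "is_kernel C f k \<longleftrightarrow> f \<in> Arr C \<and> k \<in> Arr C \<and> Cod C k = Dom C f \<and>
     Cmp C f k = Zro C (Dom C k) (Cod C f) \<and>
     (\<forall>W g. g \<in> Hom C W (Dom C f) \<and> Cmp C f g = Zro C W (Cod C f) \<longrightarrow>
        (\<exists>!h. h \<in> Hom C W (Dom C k) \<and> Cmp C k h = g))"

text \<open>
  \<open>q : X \<rightarrow> Q\<close> is the quotient of \<open>X\<close> by the sum of the images of the arrows in \<open>S\<close>,
  that is, a cokernel of the induced arrow \<open>\<Oplus>\<^bsub>s\<in>S\<^esub> Dom s \<rightarrow> X\<close> whenever that direct sum exists.
\<close>

definition is_quotient ::
  "('o, 'a, 'z) braided_cat_scheme \<Rightarrow> 'o \<Rightarrow> 'a set \<Rightarrow> 'o \<Rightarrow> 'a \<Rightarrow> bool" where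
  "is_quotient C X S Q q \<longleftrightarrow> q \<in> Hom C X Q \<and>
     (\<forall>s\<in>S. s \<in> Hom C (Dom C s) X \<and> Cmp C q s = Zro C (Dom C s) Q) \<and>
     (\<forall>W f. f \<in> Hom C X W \<and> (\<forall>s\<in>S. Cmp C f s = Zro C (Dom C s) W) \<longrightarrow>
        (\<exists>!g. g \<in> Hom C Q W \<and> Cmp C g q = f))"

definition is_cokernel :: "('o, 'a, 'z) braided_cat_scheme \<Rightarrow> 'a \<Rightarrow> 'a \<Rightarrow> bool" where
  "is_cokernel C f q \<longleftrightarrow> is_quotient C (Cod C f) {f} (Cod C q) q"

definition is_coproduct ::
  "('o, 'a, 'z) braided_cat_scheme \<Rightarrow> (nat \<Rightarrow> 'o) \<Rightarrow> 'o \<Rightarrow> (nat \<Rightarrow> 'a) \<Rightarrow> bool" where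
  "is_coproduct C X S i \<longleftrightarrow> S \<in> Ob C \<and> (\<forall>n. i n \<in> Hom C (X n) S) \<and>
     (\<forall>Y\<in>Ob C. \<forall>f. (\<forall>n. f n \<in> Hom C (X n) Y) \<longrightarrow>
        (\<exists>!g. g \<in> Hom C S Y \<and> (\<forall>n. Cmp C g (i n) = f n)))"

locale abelian_category = preadditive_category +
  assumes ex_zero_object: "\<exists>Z. zero_object C Z"
    and ex_biproduct: "\<lbrakk>X \<in> Ob C; Y \<in> Ob C\<rbrakk> \<Longrightarrow> \<exists>P i j p r. is_biproduct C X Y P i j p r"
    and ex_kernel: "f \<in> Arr C \<Longrightarrow> \<exists>k. is_kernel C f k"
    and ex_cokernel: "f \<in> Arr C \<Longrightarrow> \<exists>q. is_cokernel C f q"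
    and mono_is_kernel: "mono_arrow C k \<Longrightarrow> \<exists>f. is_kernel C f k"
    and epi_is_cokernel: "epi_arrow C q \<Longrightarrow> \<exists>f. is_cokernel C f q"

locale monoidal_category = category +
  assumes Uni_Ob: "Uni C \<in> Ob C"
    and TenO_Ob: "\<lbrakk>X \<in> Ob C; Y \<in> Ob C\<rbrakk> \<Longrightarrow> X \<boxdot> Y \<in> Ob C"
    and TenA_Hom: "\<lbrakk>f \<in> Hom C X Y; g \<in> Hom C X' Y'\<rbrakk> \<Longrightarrow> f \<boxtimes> g \<in> Hom C (X \<boxdot> X') (Y \<boxdot> Y')"
    and TenA_Ide: "\<lbrakk>X \<in> Ob C; Y \<in> Ob C\<rbrakk> \<Longrightarrow> Ide C X \<boxtimes> Ide C Y = Ide C (X \<boxdot> Y)"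
    and TenA_Cmp: "\<lbrakk>f \<in> Hom C X Y; g \<in> Hom C Y Z; f' \<in> Hom C X' Y'; g' \<in> Hom C Y' Z'\<rbrakk>
      \<Longrightarrow> (g \<cdot> f) \<boxtimes> (g' \<cdot> f') = (g \<boxtimes> g') \<cdot> (f \<boxtimes> f')"
    and Asc_Hom: "\<lbrakk>X \<in> Ob C; Y \<in> Ob C; Z \<in> Ob C\<rbrakk>
      \<Longrightarrow> Asc C X Y Z \<in> Hom C ((X \<boxdot> Y) \<boxdot> Z) (X \<boxdot> (Y \<boxdot> Z))"
    and Asc_iso: "\<lbrakk>X \<in> Ob C; Y \<in> Ob C; Z \<in> Ob C\<rbrakk> \<Longrightarrow> iso_arrow C (Asc C X Y Z)"
    and Asc_natural: "\<lbrakk>f \<in> Hom C X X'; g \<in> Hom C Y Y'; h \<in> Hom C Z Z'\<rbrakk>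
      \<Longrightarrow> Asc C X' Y' Z' \<cdot> ((f \<boxtimes> g) \<boxtimes> h) = (f \<boxtimes> (g \<boxtimes> h)) \<cdot> Asc C X Y Z"
    and Lun_Hom: "X \<in> Ob C \<Longrightarrow> Lun C X \<in> Hom C (Uni C \<boxdot> X) X"
    and Lun_iso: "X \<in> Ob C \<Longrightarrow> iso_arrow C (Lun C X)"
    and Lun_natural: "f \<in> Hom C X Y \<Longrightarrow> Lun C Y \<cdot> (Ide C (Uni C) \<boxtimes> f) = f \<cdot> Lun C X"
    and Run_Hom: "X \<in> Ob C \<Longrightarrow> Run C X \<in> Hom C (X \<boxdot> Uni C) X"
    and Run_iso: "X \<in> Ob C \<Longrightarrow> iso_arrow C (Run C X)"
    and Run_natural: "f \<in> Hom C X Y \<Longrightarrow> Run C Y \<cdot> (f \<boxtimes> Ide C (Uni C)) = f \<cdot> Run C X"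
    and pentagon: "\<lbrakk>W \<in> Ob C; X \<in> Ob C; Y \<in> Ob C; Z \<in> Ob C\<rbrakk>
      \<Longrightarrow> (Ide C W \<boxtimes> Asc C X Y Z) \<cdot> Asc C W (X \<boxdot> Y) Z \<cdot> (Asc C W X Y \<boxtimes> Ide C Z)
          = Asc C W X (Y \<boxdot> Z) \<cdot> Asc C (W \<boxdot> X) Y Z"
    and triangle: "\<lbrakk>X \<in> Ob C; Y \<in> Ob C\<rbrakk>
      \<Longrightarrow> (Ide C X \<boxtimes> Lun C Y) \<cdot> Asc C X (Uni C) Y = Run C X \<boxtimes> Ide C Y"

locale braided_monoidal_category = monoidal_category +
  assumes Brd_Hom: "\<lbrakk>X \<in> Ob C; Y \<in> Ob C\<rbrakk> \<Longrightarrow> Brd C X Y \<in> Hom C (X \<boxdot> Y) (Y \<boxdot> X)"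
    and Brd_iso: "\<lbrakk>X \<in> Ob C; Y \<in> Ob C\<rbrakk> \<Longrightarrow> iso_arrow C (Brd C X Y)"
    and Brd_natural: "\<lbrakk>f \<in> Hom C X X'; g \<in> Hom C Y Y'\<rbrakk>
      \<Longrightarrow> Brd C X' Y' \<cdot> (f \<boxtimes> g) = (g \<boxtimes> f) \<cdot> Brd C X Y"
    and hexagon1: "\<lbrakk>X \<in> Ob C; Y \<in> Ob C; Z \<in> Ob C\<rbrakk>
      \<Longrightarrow> Asc C Y Z X \<cdot> Brd C X (Y \<boxdot> Z) \<cdot> Asc C X Y Z
          = (Ide C Y \<boxtimes> Brd C X Z) \<cdot> Asc C Y X Z \<cdot> (Brd C X Y \<boxtimes> Ide C Z)"
    and hexagon2: "\<lbrakk>X \<in> Ob C; Y \<in> Ob C; Z \<in> Ob C\<rbrakk>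
      \<Longrightarrow> Inv C (Asc C Z X Y) \<cdot> Brd C (X \<boxdot> Y) Z \<cdot> Inv C (Asc C X Y Z)
          = (Brd C X Z \<boxtimes> Ide C Y) \<cdot> Inv C (Asc C X Z Y) \<cdot> (Ide C X \<boxtimes> Brd C Y Z)"

text \<open>
  The tensor product is biadditive and preserves cokernels and countable coproducts in each
  argument. This is what makes \<open>TV\<close> and its quotients by ideals into algebras.
\<close>

locale abelian_braided_category = abelian_category + braided_monoidal_category +
  assumes TenA_Add_left: "\<lbrakk>f \<in> Hom C X Y; f' \<in> Hom C X Y; g \<in> Hom C X' Y'\<rbrakk>
      \<Longrightarrow> (f \<boxplus> f') \<boxtimes> g = f \<boxtimes> g \<boxplus> f' \<boxtimes> g"
    and TenA_Add_right: "\<lbrakk>f \<in> Hom C X Y; g \<in> Hom C X' Y'; g' \<in> Hom C X' Y'\<rbrakk>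
      \<Longrightarrow> f \<boxtimes> (g \<boxplus> g') = f \<boxtimes> g \<boxplus> f \<boxtimes> g'"
    and TenA_cokernel_left: "\<lbrakk>is_cokernel C f q; X \<in> Ob C\<rbrakk>
      \<Longrightarrow> is_cokernel C (f \<boxtimes> Ide C X) (q \<boxtimes> Ide C X)"
    and TenA_cokernel_right: "\<lbrakk>is_cokernel C f q; X \<in> Ob C\<rbrakk>
      \<Longrightarrow> is_cokernel C (Ide C X \<boxtimes> f) (Ide C X \<boxtimes> q)"
    and TenA_coproduct_left: "\<lbrakk>is_coproduct C F S i; X \<in> Ob C\<rbrakk>
      \<Longrightarrow> is_coproduct C (\<lambda>n. F n \<boxdot> X) (S \<boxdot> X) (\<lambda>n. i n \<boxtimes> Ide C X)"
    and TenA_coproduct_right: "\<lbrakk>is_coproduct C F S i; X \<in> Ob C\<rbrakk>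
      \<Longrightarrow> is_coproduct C (\<lambda>n. X \<boxdot> F n) (X \<boxdot> S) (\<lambda>n. Ide C X \<boxtimes> i n)"


section \<open>Tensor powers and braided factorials\<close>

primrec tpow :: "('o, 'a, 'z) braided_cat_scheme \<Rightarrow> 'o \<Rightarrow> nat \<Rightarrow> 'o" where
  "tpow C V 0 = Uni C"
| "tpow C V (Suc n) = TenO C (tpow C V n) V"

text \<open>The canonical isomorphism from \<open>tpow m \<otimes> tpow n\<close> to \<open>tpow (m + n)\<close>.\<close>

primrec tpow_mult :: "('o, 'a, 'z) braided_cat_scheme \<Rightarrow> 'o \<Rightarrow> nat \<Rightarrow> nat \<Rightarrow> 'a" where
  "tpow_mult C V m 0 = Run C (tpow C V m)"
| "tpow_mult C V m (Suc n) =
     Cmp C (TenA C (tpow_mult C V m n) (Ide C V)) (Inv C (Asc C (tpow C V m) (tpow C V n) V))"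

text \<open>
  \<open>braid_gen C V n i\<close> is the braiding of the tensor factors \<open>i\<close> and \<open>i + 1\<close> of \<open>tpow C V n\<close>,
  the factors being numbered from \<open>0\<close> to \<open>n - 1\<close>.
\<close>

fun braid_gen :: "('o, 'a, 'z) braided_cat_scheme \<Rightarrow> 'o \<Rightarrow> nat \<Rightarrow> nat \<Rightarrow> 'a" where
  "braid_gen C V (Suc (Suc n)) i =
     (if i = n
      then Cmp C (Inv C (Asc C (tpow C V n) V V))
             (Cmp C (TenA C (Ide C (tpow C V n)) (Brd C V V)) (Asc C (tpow C V n) V V))
      else TenA C (braid_gen C V (Suc n) i) (Ide C V))"
| "braid_gen C V n i = Ide C (tpow C V n)"

primrec braid_word :: "('o, 'a, 'z) braided_cat_scheme \<Rightarrow> 'o \<Rightarrow> nat \<Rightarrow> nat list \<Rightarrow> 'a" where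
  "braid_word C V n [] = Ide C (tpow C V n)"
| "braid_word C V n (i # w) = Cmp C (braid_gen C V n i) (braid_word C V n w)"

primrec word_perm :: "nat list \<Rightarrow> nat \<Rightarrow> nat" where
  "word_perm [] = id"
| "word_perm (i # w) = Transposition.transpose i (Suc i) \<circ> word_perm w"

definition reduced_word :: "nat \<Rightarrow> (nat \<Rightarrow> nat) \<Rightarrow> nat list \<Rightarrow> bool" where
  "reduced_word n \<sigma> w \<longleftrightarrow> set w \<subseteq> {i. Suc i < n} \<and> word_perm w = \<sigma> \<and>
     (\<forall>w'. set w' \<subseteq> {i. Suc i < n} \<and> word_perm w' = \<sigma> \<longrightarrow> length w \<le> length w')"

definition braid_perm :: "('o, 'a, 'z) braided_cat_scheme \<Rightarrow> 'o \<Rightarrow> nat \<Rightarrow> (nat \<Rightarrow> nat) \<Rightarrow> 'a" where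
  "braid_perm C V n \<sigma> = braid_word C V n (SOME w. reduced_word n \<sigma> w)"

text \<open>\<open>finprod\<close> in the additive group of endomorphisms is the sum over the symmetric group.\<close>

definition braided_fact :: "('o, 'a, 'z) braided_cat_scheme \<Rightarrow> 'o \<Rightarrow> nat \<Rightarrow> 'a" where
  "braided_fact C V n =
     finprod (hom_group C (tpow C V n) (tpow C V n)) (braid_perm C V n) {\<sigma>. \<sigma> permutes {..<n}}"


section \<open>Braided tensor products of algebras\<close>

text \<open>\<open>X Y X' Y' \<rightarrow> X X' Y Y'\<close>, braiding \<open>Y\<close> past \<open>X'\<close>.\<close>

definition middle_braid ::
  "('o, 'a, 'z) braided_cat_scheme \<Rightarrow> 'o \<Rightarrow> 'o \<Rightarrow> 'o \<Rightarrow> 'o \<Rightarrow> 'a" where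
  "middle_braid C X Y X' Y' =
     Cmp C (Inv C (Asc C X X' (TenO C Y Y')))
      (Cmp C (TenA C (Ide C X)
               (Cmp C (Asc C X' Y Y')
                 (Cmp C (TenA C (Brd C Y X') (Ide C Y')) (Inv C (Asc C Y X' Y')))))
        (Asc C X Y (TenO C X' Y')))"

text \<open>
  The product \<open>(b \<otimes> c)(b' \<otimes> c') = b \<Psi>(c \<otimes> b') c'\<close>, for products \<open>f\<close> on \<open>X \<otimes> X'\<close> and
  \<open>g\<close> on \<open>Y \<otimes> Y'\<close> (possibly components of products of graded algebras).
\<close>

definition braided_mult ::
  "('o, 'a, 'z) braided_cat_scheme \<Rightarrow> 'o \<Rightarrow> 'o \<Rightarrow> 'o \<Rightarrow> 'o \<Rightarrow> 'a \<Rightarrow> 'a \<Rightarrow> 'a" where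
  "braided_mult C X Y X' Y' f g = Cmp C (TenA C f g) (middle_braid C X Y X' Y')"


section \<open>The algebras \<open>TV\<close>, \<open>B\<^sub>+(V)\<close> and \<open>\<Lambda>(V)\<close>\<close>

definition tensor_algebra ::
  "('o, 'a, 'z) braided_cat_scheme \<Rightarrow> 'o \<Rightarrow> 'o \<Rightarrow> (nat \<Rightarrow> 'a) \<Rightarrow> 'a \<Rightarrow> bool" where
  "tensor_algebra C V T i mT \<longleftrightarrow>
     is_coproduct C (tpow C V) T i \<and> mT \<in> Hom C (TenO C T T) T \<and>
     (\<forall>m n. Cmp C mT (TenA C (i m) (i n)) = Cmp C (i (m + n)) (tpow_mult C V m n))"

text \<open>
  The algebra \<open>B\<close> with product \<open>mB\<close> is the quotient of \<open>TV\<close>, along the algebra map \<open>\<pi>\<close>, by the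
  sum of the kernels of the braided factorials.
\<close>

definition B_plus ::
  "('o, 'a, 'z) braided_cat_scheme \<Rightarrow> 'o \<Rightarrow> 'o \<Rightarrow> (nat \<Rightarrow> 'a) \<Rightarrow> 'a \<Rightarrow> 'o \<Rightarrow> 'a \<Rightarrow> 'a \<Rightarrow> bool" where
  "B_plus C V T i mT B \<pi> mB \<longleftrightarrow>
     is_quotient C T {Cmp C (i n) k | n k. is_kernel C (braided_fact C V n) k} B \<pi> \<and>
     mB \<in> Hom C (TenO C B B) B \<and>
     Cmp C mB (TenA C \<pi> \<pi>) = Cmp C \<pi> mT"

definition B_unit :: "('o, 'a, 'z) braided_cat_scheme \<Rightarrow> (nat \<Rightarrow> 'a) \<Rightarrow> 'a \<Rightarrow> 'a" where
  "B_unit C i \<pi> = Cmp C \<pi> (i 0)"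

text \<open>The inclusion \<open>V \<rightarrow> B\<close>; recall that \<open>tpow C V 1\<close> is \<open>I \<otimes> V\<close>.\<close>

definition B_incl :: "('o, 'a, 'z) braided_cat_scheme \<Rightarrow> 'o \<Rightarrow> (nat \<Rightarrow> 'a) \<Rightarrow> 'a \<Rightarrow> 'a" where
  "B_incl C V i \<pi> = Cmp C \<pi> (Cmp C (i 1) (Inv C (Lun C V)))"

text \<open>
  \<open>\<Delta>\<close> is the algebra map from \<open>B\<close> to the braided tensor product of \<open>B\<close> with itself such that
  \<open>\<Delta> v = v \<otimes> 1 + 1 \<otimes> v\<close> on \<open>V\<close>.
\<close>

definition B_coproduct ::
  "('o, 'a, 'z) braided_cat_scheme \<Rightarrow> 'o \<Rightarrow> (nat \<Rightarrow> 'a) \<Rightarrow> 'o \<Rightarrow> 'a \<Rightarrow> 'a \<Rightarrow> 'a \<Rightarrow> bool" where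
  "B_coproduct C V i B \<pi> mB \<Delta> \<longleftrightarrow>
     \<Delta> \<in> Hom C B (TenO C B B) \<and>
     Cmp C \<Delta> mB = Cmp C (braided_mult C B B B B mB mB) (TenA C \<Delta> \<Delta>) \<and>
     Cmp C \<Delta> (B_unit C i \<pi>) =
       Cmp C (TenA C (B_unit C i \<pi>) (B_unit C i \<pi>)) (Inv C (Lun C (Uni C))) \<and>
     Cmp C \<Delta> (B_incl C V i \<pi>) =
       Add C (Cmp C (TenA C (B_incl C V i \<pi>) (B_unit C i \<pi>)) (Inv C (Run C V)))
             (Cmp C (TenA C (B_unit C i \<pi>) (B_incl C V i \<pi>)) (Inv C (Lun C V)))"

definition B_proj1 ::
  "('o, 'a, 'z) braided_cat_scheme \<Rightarrow> 'o \<Rightarrow> (nat \<Rightarrow> 'a) \<Rightarrow> 'o \<Rightarrow> 'a \<Rightarrow> 'a \<Rightarrow> bool" where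
  "B_proj1 C V i B \<pi> \<omega> \<longleftrightarrow> \<omega> \<in> Hom C B V \<and>
     (\<forall>n. Cmp C \<omega> (Cmp C \<pi> (i n)) = (if n = 1 then Lun C V else Zro C (tpow C V n) V))"

text \<open>
  \<open>id + \<Psi>\<close> as an arrow \<open>V \<otimes> V \<rightarrow> tpow C V 2\<close>, and the degree \<open>n\<close> part of the two-sided ideal
  of \<open>TV\<close> generated by its image, given by arrows into \<open>tpow C V n\<close> whose images span it.
\<close>

definition wedge_rel :: "('o, 'a, 'z) braided_cat_scheme \<Rightarrow> 'o \<Rightarrow> 'a" where
  "wedge_rel C V =
     Cmp C (TenA C (Inv C (Lun C V)) (Ide C V)) (Add C (Ide C (TenO C V V)) (Brd C V V))"

definition wedge_ideal :: "('o, 'a, 'z) braided_cat_scheme \<Rightarrow> 'o \<Rightarrow> nat \<Rightarrow> 'a set" where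
  "wedge_ideal C V n =
     {Cmp C (tpow_mult C V (a + 2) b)
        (TenA C (Cmp C (tpow_mult C V a 2) (TenA C (Ide C (tpow C V a)) (wedge_rel C V)))
                (Ide C (tpow C V b))) | a b. a + 2 + b = n}"

text \<open>
  \<open>\<Lambda>(V)\<close> as a graded algebra: \<open>q n : tpow C V n \<rightarrow> L n\<close> are the quotient arrows, and
  \<open>w m n : L m \<otimes> L n \<rightarrow> L (m + n)\<close> is the induced product.
\<close>

definition exterior_algebra ::
  "('o, 'a, 'z) braided_cat_scheme \<Rightarrow> 'o \<Rightarrow> (nat \<Rightarrow> 'o) \<Rightarrow> (nat \<Rightarrow> 'a) \<Rightarrow> (nat \<Rightarrow> nat \<Rightarrow> 'a) \<Rightarrow> bool"
where
  "exterior_algebra C V L q w \<longleftrightarrow>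
     (\<forall>n. is_quotient C (tpow C V n) (wedge_ideal C V n) (L n) (q n)) \<and>
     (\<forall>m n. w m n \<in> Hom C (TenO C (L m) (L n)) (L (m + n)) \<and>
        Cmp C (w m n) (TenA C (q m) (q n)) = Cmp C (q (m + n)) (tpow_mult C V m n))"

text \<open>The identification of \<open>V\<close> with \<open>L 1\<close>.\<close>

definition L_incl :: "('o, 'a, 'z) braided_cat_scheme \<Rightarrow> 'o \<Rightarrow> (nat \<Rightarrow> 'a) \<Rightarrow> 'a" where
  "L_incl C V q = Cmp C (q 1) (Inv C (Lun C V))"


section \<open>Double complexes\<close>

text \<open>
  A bigraded algebra is given by its components \<open>Om p q\<close>, the components
  \<open>M p q p' q' : Om p q \<otimes> Om p' q' \<rightarrow> Om (p + p') (q + q')\<close> of its product, and its unit \<open>e\<close>.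
\<close>

definition bigraded_algebra ::
  "('o, 'a, 'z) braided_cat_scheme \<Rightarrow> (nat \<Rightarrow> nat \<Rightarrow> 'o) \<Rightarrow>
   (nat \<Rightarrow> nat \<Rightarrow> nat \<Rightarrow> nat \<Rightarrow> 'a) \<Rightarrow> 'a \<Rightarrow> bool" where
  "bigraded_algebra C Om M e \<longleftrightarrow>
     (\<forall>p q. Om p q \<in> Ob C) \<and>
     (\<forall>p q p' q'. M p q p' q' \<in> Hom C (TenO C (Om p q) (Om p' q')) (Om (p + p') (q + q'))) \<and>
     e \<in> Hom C (Uni C) (Om 0 0) \<and>
     (\<forall>p q p' q' p'' q''.
        Cmp C (M (p + p') (q + q') p'' q'') (TenA C (M p q p' q') (Ide C (Om p'' q''))) =
        Cmp C (M p q (p' + p'') (q' + q''))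
          (Cmp C (TenA C (Ide C (Om p q)) (M p' q' p'' q''))
            (Asc C (Om p q) (Om p' q') (Om p'' q'')))) \<and>
     (\<forall>p q. Cmp C (M 0 0 p q) (TenA C e (Ide C (Om p q))) = Lun C (Om p q)) \<and>
     (\<forall>p q. Cmp C (M p q 0 0) (TenA C (Ide C (Om p q)) e) = Run C (Om p q))"

text \<open>
  \<open>D p q : Om p q \<rightarrow> Om (p + a) (q + b)\<close> is a graded derivation of bidegree \<open>(a, b)\<close>:
  \<open>D (x y) = (D x) y + (-1)^(p + q) x (D y)\<close> for \<open>x\<close> of bidegree \<open>(p, q)\<close>.
\<close>

definition graded_derivation ::
  "('o, 'a, 'z) braided_cat_scheme \<Rightarrow> (nat \<Rightarrow> nat \<Rightarrow> 'o) \<Rightarrow>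
   (nat \<Rightarrow> nat \<Rightarrow> nat \<Rightarrow> nat \<Rightarrow> 'a) \<Rightarrow> nat \<Rightarrow> nat \<Rightarrow> (nat \<Rightarrow> nat \<Rightarrow> 'a) \<Rightarrow> bool" where
  "graded_derivation C Om M a b D \<longleftrightarrow>
     (\<forall>p q. D p q \<in> Hom C (Om p q) (Om (p + a) (q + b))) \<and>
     (\<forall>p q p' q'.
        Cmp C (D (p + p') (q + q')) (M p q p' q') =
        Add C (Cmp C (M (p + a) (q + b) p' q') (TenA C (D p q) (Ide C (Om p' q'))))
          (signed C (p + q)
            (Cmp C (M p q (p' + a) (q' + b)) (TenA C (Ide C (Om p q)) (D p' q')))))"

definition double_complex ::
  "('o, 'a, 'z) braided_cat_scheme \<Rightarrow> (nat \<Rightarrow> nat \<Rightarrow> 'o) \<Rightarrow>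
   (nat \<Rightarrow> nat \<Rightarrow> nat \<Rightarrow> nat \<Rightarrow> 'a) \<Rightarrow> 'a \<Rightarrow> (nat \<Rightarrow> nat \<Rightarrow> 'a) \<Rightarrow> (nat \<Rightarrow> nat \<Rightarrow> 'a) \<Rightarrow> bool" where
  "double_complex C Om M e D Db \<longleftrightarrow>
     bigraded_algebra C Om M e \<and>
     graded_derivation C Om M 1 0 D \<and>
     graded_derivation C Om M 0 1 Db \<and>
     (\<forall>p q. Cmp C (D (p + 1) q) (D p q) = Zro C (Om p q) (Om (p + 2) q)) \<and>
     (\<forall>p q. Cmp C (Db p (q + 1)) (Db p q) = Zro C (Om p q) (Om p (q + 2))) \<and>
     (\<forall>p q. Add C (Cmp C (D p (q + 1)) (Db p q)) (Cmp C (Db (p + 1) q) (D p q)) =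
        Zro C (Om p q) (Om (p + 1) (q + 1)))"


section \<open>The double complex \<open>\<Lambda> \<otimes> B \<otimes> \<Lambda>\<close>\<close>

definition Omega :: "('o, 'a, 'z) braided_cat_scheme \<Rightarrow> 'o \<Rightarrow> (nat \<Rightarrow> 'o) \<Rightarrow> nat \<Rightarrow> nat \<Rightarrow> 'o" where
  "Omega C B L p q = TenO C (TenO C (L p) B) (L q)"

definition Omega_mult ::
  "('o, 'a, 'z) braided_cat_scheme \<Rightarrow> 'o \<Rightarrow> 'a \<Rightarrow> (nat \<Rightarrow> 'o) \<Rightarrow> (nat \<Rightarrow> nat \<Rightarrow> 'a) \<Rightarrow>
   nat \<Rightarrow> nat \<Rightarrow> nat \<Rightarrow> nat \<Rightarrow> 'a" where
  "Omega_mult C B mB L w p q p' q' =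
     signed C (q * p')
       (braided_mult C (TenO C (L p) B) (L q) (TenO C (L p') B) (L q')
         (braided_mult C (L p) B (L p') B (w p p') mB) (w q q'))"

definition Omega_unit ::
  "('o, 'a, 'z) braided_cat_scheme \<Rightarrow> (nat \<Rightarrow> 'a) \<Rightarrow> 'a \<Rightarrow> (nat \<Rightarrow> 'a) \<Rightarrow> 'a" where
  "Omega_unit C i \<pi> q =
     Cmp C (TenA C (Cmp C (TenA C (q 0) (B_unit C i \<pi>)) (Inv C (Lun C (Uni C)))) (q 0))
       (Inv C (Lun C (Uni C)))"

text \<open>
  \<open>del_left\<close> is the differential of \<open>\<Lambda> \<otimes> B\<close> in degree \<open>p\<close>; \<open>delbar_right\<close> is the one of
  \<open>B \<otimes> \<Lambda>\<close> in degree \<open>q\<close>. The arrow \<open>j : V \<rightarrow> L 1\<close> is always \<open>L_incl\<close>.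
\<close>

definition del_left ::
  "('o, 'a, 'z) braided_cat_scheme \<Rightarrow> 'o \<Rightarrow> 'a \<Rightarrow> 'a \<Rightarrow> (nat \<Rightarrow> 'o) \<Rightarrow> (nat \<Rightarrow> nat \<Rightarrow> 'a) \<Rightarrow> 'a \<Rightarrow>
   nat \<Rightarrow> 'a" where
  "del_left C B \<Delta> \<omega> L w j p =
     signed C p
       (Cmp C (TenA C (w p 1) (Ide C B))
         (Cmp C (Inv C (Asc C (L p) (L 1) B))
           (Cmp C (TenA C (Ide C (L p)) (TenA C (Cmp C j \<omega>) (Ide C B)))
             (TenA C (Ide C (L p)) \<Delta>))))"

definition delbar_right ::
  "('o, 'a, 'z) braided_cat_scheme \<Rightarrow> 'o \<Rightarrow> 'a \<Rightarrow> 'a \<Rightarrow> (nat \<Rightarrow> 'o) \<Rightarrow> (nat \<Rightarrow> nat \<Rightarrow> 'a) \<Rightarrow> 'a \<Rightarrow>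
   nat \<Rightarrow> 'a" where
  "delbar_right C B \<Delta> \<omega> L w j q =
     Cmp C (TenA C (Ide C B) (w 1 q))
       (Cmp C (Asc C B (L 1) (L q))
         (Cmp C (TenA C (TenA C (Ide C B) (Cmp C j \<omega>)) (Ide C (L q)))
           (TenA C \<Delta> (Ide C (L q)))))"

definition Omega_del ::
  "('o, 'a, 'z) braided_cat_scheme \<Rightarrow> 'o \<Rightarrow> 'a \<Rightarrow> 'a \<Rightarrow> (nat \<Rightarrow> 'o) \<Rightarrow> (nat \<Rightarrow> nat \<Rightarrow> 'a) \<Rightarrow> 'a \<Rightarrow>
   nat \<Rightarrow> nat \<Rightarrow> 'a" where
  "Omega_del C B \<Delta> \<omega> L w j p q = TenA C (del_left C B \<Delta> \<omega> L w j p) (Ide C (L q))"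

definition Omega_delbar ::
  "('o, 'a, 'z) braided_cat_scheme \<Rightarrow> 'o \<Rightarrow> 'a \<Rightarrow> 'a \<Rightarrow> (nat \<Rightarrow> 'o) \<Rightarrow> (nat \<Rightarrow> nat \<Rightarrow> 'a) \<Rightarrow> 'a \<Rightarrow>
   nat \<Rightarrow> nat \<Rightarrow> 'a" where
  "Omega_delbar C B \<Delta> \<omega> L w j p q =
     signed C p
       (Cmp C (Inv C (Asc C (L p) B (L (q + 1))))
         (Cmp C (TenA C (Ide C (L p)) (delbar_right C B \<Delta> \<omega> L w j q))
           (Asc C (L p) B (L q))))"

end

theory Submission
  imports Defs
begin

text \<open>
  Conjugating all arrows by the canonical coherence isomorphisms makes the tensor product strictly
  associative and unital, and there the computation is the one with elements. Since the arrows
  \<open>V^n \<rightarrow> B\<close> are jointly epic and stay so after tensoring, algebra maps out of \<open>B\<close> are determined on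
  \<open>V\<close>; hence \<open>\<Delta>\<close> is coassociative, the degree zero projection \<open>\<epsilon>\<close> is a counit,
  \<open>\<varpi>(b c) = \<varpi>(b) \<epsilon>(c) + \<epsilon>(b) \<varpi>(c)\<close>, and \<open>\<and> (\<varpi> \<otimes> \<varpi>) \<Delta> = 0\<close>. Together with
  \<open>v \<and> \<eta> = (-1)^n \<and>\<Psi>(v \<otimes> \<eta>)\<close> for \<open>v\<close> in \<open>V\<close> and \<open>\<eta>\<close> in \<open>\<Lambda>^n\<close>, this gives \<open>\<partial>^2 = 0\<close> and the Leibniz rule on
  \<open>\<Lambda> \<otimes> B\<close>; the case of \<open>B \<otimes> \<Lambda>\<close> is its mirror image. The product of \<open>\<Lambda> \<otimes> B \<otimes> \<Lambda>\<close> can be bracketed both as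
  \<open>(\<Lambda> \<otimes> B) \<otimes> \<Lambda>\<close> and as \<open>\<Lambda> \<otimes> (B \<otimes> \<Lambda>)\<close>, so both differentials extend to it by naturality of the braiding,
  and they anticommute by coassociativity.
\<close>

section \<open>Typing and coherence in a monoidal category\<close>

text \<open>The sign (-1)^p of \<open>\<partial>\<close> has a simple origin. The new letter enters
  at the right end of \<open>\<Lambda>^p\<close>, so the unsigned operator satisfies a Leibniz rule
  whose sign sits on the first term; the factor (-1)^p moves it to the second. On
  \<open>B \<otimes> \<Lambda>\<close> the letter enters at the left end, and the (-1)^p of the
  other differential is the price of crossing the left factor \<open>\<Lambda>^p\<close>. Signs are
  therefore split off and reduced to a comparison of parities.

  Two points concern the quotients. The tensor product is assumed to preserve cokernels of single
  arrows, while \<open>B\<close> and \<open>\<Lambda>\<close> are quotients by families of arrows;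
  the bridge is that a quotient arrow is epic and that an epic arrow of an abelian category is the
  cokernel of one arrow. The counit descends from \<open>TV\<close> to \<open>B\<close> because
  \<open>[0, \<Psi>]!\<close> is the identity, so that nothing is divided out in degree zero.

  The map \<open>(\<varpi> \<otimes> \<varpi>) \<Delta>\<close> is not an algebra map, so comparing
  values on \<open>V\<close> does not apply to it. Its composite with the wedge product is computed
  on products with a last letter instead, through the derivation property of
  \<open>(\<varpi> \<otimes> id) \<Delta>\<close>.\<close>

context category
begin

lemma HomI: "f \<in> Arr C \<Longrightarrow> f \<in> Hom C (Dom C f) (Cod C f)"
  by (simp add: Hom_def)

lemma Arr_Cmp [simp]: "\<lbrakk>f \<in> Arr C; g \<in> Arr C; Cod C f = Dom C g\<rbrakk> \<Longrightarrow> g \<cdot> f \<in> Arr C"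
  and Dom_Cmp [simp]: "\<lbrakk>f \<in> Arr C; g \<in> Arr C; Cod C f = Dom C g\<rbrakk> \<Longrightarrow> Dom C (g \<cdot> f) = Dom C f"
  and Cod_Cmp [simp]: "\<lbrakk>f \<in> Arr C; g \<in> Arr C; Cod C f = Dom C g\<rbrakk> \<Longrightarrow> Cod C (g \<cdot> f) = Cod C g"
  using Cmp_Hom[of f "Dom C f" "Cod C f" g "Cod C g"] by (auto simp: Hom_def)

lemma Arr_Ide [simp]: "X \<in> Ob C \<Longrightarrow> Ide C X \<in> Arr C"
  and Dom_Ide [simp]: "X \<in> Ob C \<Longrightarrow> Dom C (Ide C X) = X"
  and Cod_Ide [simp]: "X \<in> Ob C \<Longrightarrow> Cod C (Ide C X) = X"
  using Ide_Hom[of X] by (auto simp: Hom_def)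

declare Dom_Ob [simp] Cod_Ob [simp]

lemma Cmp_Ide' [simp]: "\<lbrakk>f \<in> Arr C; Dom C f = X\<rbrakk> \<Longrightarrow> f \<cdot> Ide C X = f"
  using Cmp_Ide[of f X "Cod C f"] by (auto simp: Hom_def)

lemma Ide_Cmp' [simp]: "\<lbrakk>f \<in> Arr C; Cod C f = X\<rbrakk> \<Longrightarrow> Ide C X \<cdot> f = f"
  using Ide_Cmp[of f "Dom C f" X] by (auto simp: Hom_def)

lemma Cmp_assoc': "\<lbrakk>f \<in> Arr C; g \<in> Arr C; h \<in> Arr C; Cod C f = Dom C g; Cod C g = Dom C h\<rbrakk>
    \<Longrightarrow> (h \<cdot> g) \<cdot> f = h \<cdot> g \<cdot> f"
  using Cmp_assoc[of f "Dom C f" "Cod C f" g "Cod C g" h "Cod C h"] by (auto simp: Hom_def)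

lemma inverse_arrows_unique:
  assumes "inverse_arrows C f g" "inverse_arrows C f h" shows "g = h"
proof -
  have t: "f \<in> Arr C" "g \<in> Arr C" "h \<in> Arr C" "Dom C g = Cod C f" "Cod C g = Dom C f"
    "Dom C h = Cod C f" "Cod C h = Dom C f"
    using assms by (auto simp: inverse_arrows_def Hom_def)
  have "g = g \<cdot> f \<cdot> h" using assms t by (simp add: inverse_arrows_def)
  also have "\<dots> = (g \<cdot> f) \<cdot> h" using t by (simp add: Cmp_assoc')
  also have "\<dots> = h" using assms t by (simp add: inverse_arrows_def)
  finally show ?thesis .
qed

lemma inverse_arrows_Inv: "iso_arrow C f \<Longrightarrow> inverse_arrows C f (Inv C f)"
  unfolding iso_arrow_def Inv_def
  by (metis (mono_tags, lifting) inverse_arrows_unique theI)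

lemma Arr_Inv [simp]: "iso_arrow C f \<Longrightarrow> Inv C f \<in> Arr C"
  and Dom_Inv [simp]: "iso_arrow C f \<Longrightarrow> Dom C (Inv C f) = Cod C f"
  and Cod_Inv [simp]: "iso_arrow C f \<Longrightarrow> Cod C (Inv C f) = Dom C f"
  and Inv_Cmp [simp]: "iso_arrow C f \<Longrightarrow> Inv C f \<cdot> f = Ide C (Dom C f)"
  and Cmp_Inv [simp]: "iso_arrow C f \<Longrightarrow> f \<cdot> Inv C f = Ide C (Cod C f)"
  and iso_arrow_Arr: "iso_arrow C f \<Longrightarrow> f \<in> Arr C"
  using inverse_arrows_Inv[of f] by (auto simp: inverse_arrows_def Hom_def)

lemma iso_cancel_right:
  assumes "iso_arrow C f" "g \<in> Arr C" "h \<in> Arr C" "Dom C g = Cod C f" "Dom C h = Cod C f"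
    "g \<cdot> f = h \<cdot> f"
  shows "g = h"
proof -
  note iso_arrow_Arr[OF assms(1), simp]
  have "g = (g \<cdot> f) \<cdot> Inv C f" using assms(1-5) by (simp add: Cmp_assoc')
  also have "\<dots> = h" using assms by (simp add: Cmp_assoc')
  finally show ?thesis .
qed

lemma iso_cancel_left:
  assumes "iso_arrow C f" "g \<in> Arr C" "h \<in> Arr C" "Cod C g = Dom C f" "Cod C h = Dom C f"
    "f \<cdot> g = f \<cdot> h"
  shows "g = h"
proof -
  note iso_arrow_Arr[OF assms(1), simp]
  have "g = Inv C f \<cdot> f \<cdot> g" using assms(1-5) by (simp flip: Cmp_assoc')
  also have "\<dots> = Inv C f \<cdot> f \<cdot> h" using assms by simp
  also have "\<dots> = h" using assms(1-5) by (simp flip: Cmp_assoc')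
  finally show ?thesis .
qed

lemma iso_arrow_Cmp [simp]:
  assumes "iso_arrow C f" "iso_arrow C g" "Cod C f = Dom C g" shows "iso_arrow C (g \<cdot> f)"
proof -
  note [simp] = iso_arrow_Arr[OF assms(1)] iso_arrow_Arr[OF assms(2)]
  have "Inv C g \<cdot> g \<cdot> f = f" "f \<cdot> Inv C f \<cdot> Inv C g = Inv C g"
    using assms by (simp_all flip: Cmp_assoc')
  then have "inverse_arrows C (g \<cdot> f) (Inv C f \<cdot> Inv C g)"
    using assms by (simp add: inverse_arrows_def Hom_def Cmp_assoc')
  then show ?thesis by (auto simp: iso_arrow_def)
qed

lemma inverse_arrows_Ide: "X \<in> Ob C \<Longrightarrow> inverse_arrows C (Ide C X) (Ide C X)"
  by (simp add: inverse_arrows_def Hom_def)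

lemma iso_arrow_Ide [simp]: "X \<in> Ob C \<Longrightarrow> iso_arrow C (Ide C X)"
  using inverse_arrows_Ide by (auto simp: iso_arrow_def)

lemma iso_arrow_Inv [simp]: "iso_arrow C f \<Longrightarrow> iso_arrow C (Inv C f)"
  unfolding iso_arrow_def[of C "Inv C f"] using inverse_arrows_Inv[of f] iso_arrow_Arr[of f]
  by (intro exI[of _ f]) (auto simp: inverse_arrows_def Hom_def)

end

section \<open>Tensor products of isomorphisms and Kelly's unit identities\<close>

context monoidal_category
begin

declare Uni_Ob [simp] TenO_Ob [simp]

lemma Arr_TenA [simp]: "\<lbrakk>f \<in> Arr C; g \<in> Arr C\<rbrakk> \<Longrightarrow> f \<boxtimes> g \<in> Arr C"
  and Dom_TenA [simp]: "\<lbrakk>f \<in> Arr C; g \<in> Arr C\<rbrakk> \<Longrightarrow> Dom C (f \<boxtimes> g) = Dom C f \<boxdot> Dom C g"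
  and Cod_TenA [simp]: "\<lbrakk>f \<in> Arr C; g \<in> Arr C\<rbrakk> \<Longrightarrow> Cod C (f \<boxtimes> g) = Cod C f \<boxdot> Cod C g"
  using TenA_Hom[OF HomI HomI, of f g] by (auto simp: Hom_def)

lemma interchange:
  "\<lbrakk>f \<in> Arr C; g \<in> Arr C; f' \<in> Arr C; g' \<in> Arr C; Cod C f = Dom C g; Cod C f' = Dom C g'\<rbrakk>
    \<Longrightarrow> (g \<boxtimes> g') \<cdot> (f \<boxtimes> f') = (g \<cdot> f) \<boxtimes> (g' \<cdot> f')"
  using TenA_Cmp[of f "Dom C f" "Cod C f" g "Cod C g" f' "Dom C f'" "Cod C f'" g' "Cod C g'"]
  by (auto simp: Hom_def)

lemma interchange_Cmp:
  "\<lbrakk>f \<in> Arr C; g \<in> Arr C; f' \<in> Arr C; g' \<in> Arr C; k \<in> Arr C; Cod C f = Dom C g; Cod C f' = Dom C g';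
    Cod C k = Dom C f \<boxdot> Dom C f'\<rbrakk>
    \<Longrightarrow> (g \<boxtimes> g') \<cdot> (f \<boxtimes> f') \<cdot> k = ((g \<cdot> f) \<boxtimes> (g' \<cdot> f')) \<cdot> k"
  by (simp add: interchange flip: Cmp_assoc')

declare TenA_Ide [simp]

lemma Arr_Asc [simp]: "\<lbrakk>X \<in> Ob C; Y \<in> Ob C; Z \<in> Ob C\<rbrakk> \<Longrightarrow> Asc C X Y Z \<in> Arr C"
  and Dom_Asc [simp]: "\<lbrakk>X \<in> Ob C; Y \<in> Ob C; Z \<in> Ob C\<rbrakk> \<Longrightarrow> Dom C (Asc C X Y Z) = X \<boxdot> Y \<boxdot> Z"
  and Cod_Asc [simp]: "\<lbrakk>X \<in> Ob C; Y \<in> Ob C; Z \<in> Ob C\<rbrakk> \<Longrightarrow> Cod C (Asc C X Y Z) = X \<boxdot> (Y \<boxdot> Z)"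
  using Asc_Hom[of X Y Z] by (auto simp: Hom_def)

lemma Arr_Lun [simp]: "X \<in> Ob C \<Longrightarrow> Lun C X \<in> Arr C"
  and Dom_Lun [simp]: "X \<in> Ob C \<Longrightarrow> Dom C (Lun C X) = Uni C \<boxdot> X"
  and Cod_Lun [simp]: "X \<in> Ob C \<Longrightarrow> Cod C (Lun C X) = X"
  using Lun_Hom[of X] by (auto simp: Hom_def)

lemma Arr_Run [simp]: "X \<in> Ob C \<Longrightarrow> Run C X \<in> Arr C"
  and Dom_Run [simp]: "X \<in> Ob C \<Longrightarrow> Dom C (Run C X) = X \<boxdot> Uni C"
  and Cod_Run [simp]: "X \<in> Ob C \<Longrightarrow> Cod C (Run C X) = X"
  using Run_Hom[of X] by (auto simp: Hom_def)

declare Asc_iso [simp] Lun_iso [simp] Run_iso [simp]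

lemma iso_arrow_TenA [simp]:
  assumes "iso_arrow C f" "iso_arrow C g" shows "iso_arrow C (f \<boxtimes> g)"
proof -
  note [simp] = iso_arrow_Arr[OF assms(1)] iso_arrow_Arr[OF assms(2)]
  have "inverse_arrows C (f \<boxtimes> g) (Inv C f \<boxtimes> Inv C g)"
    using assms by (simp add: inverse_arrows_def Hom_def interchange)
  then show ?thesis by (auto simp: iso_arrow_def)
qed

lemma Asc_nat:
  "\<lbrakk>f \<in> Arr C; g \<in> Arr C; h \<in> Arr C; Cod C f = X; Cod C g = Y; Cod C h = Z\<rbrakk>
    \<Longrightarrow> Asc C X Y Z \<cdot> ((f \<boxtimes> g) \<boxtimes> h)
      = (f \<boxtimes> (g \<boxtimes> h)) \<cdot> Asc C (Dom C f) (Dom C g) (Dom C h)"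
  using Asc_natural[OF HomI HomI HomI, of f g h] by simp

lemma Lun_nat: "\<lbrakk>f \<in> Arr C; Cod C f = X\<rbrakk> \<Longrightarrow> Lun C X \<cdot> (Ide C (Uni C) \<boxtimes> f) = f \<cdot> Lun C (Dom C f)"
  using Lun_natural[OF HomI, of f] by simp

lemma Run_nat: "\<lbrakk>f \<in> Arr C; Cod C f = X\<rbrakk> \<Longrightarrow> Run C X \<cdot> (f \<boxtimes> Ide C (Uni C)) = f \<cdot> Run C (Dom C f)"
  using Run_natural[OF HomI, of f] by simp

text \<open>Naturality of the invertible \<open>Lun\<close> makes tensoring with the unit faithful.
  An identity that pentagon and triangle yield only after tensoring with \<open>Uni C\<close> is
  brought down in this way.\<close>

lemma Uni_TenA_inject:
  assumes "f \<in> Arr C" "g \<in> Arr C" "Dom C f = Dom C g" "Cod C f = Cod C g"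
    "Ide C (Uni C) \<boxtimes> f = Ide C (Uni C) \<boxtimes> g"
  shows "f = g"
proof (rule iso_cancel_right[of "Lun C (Dom C f)"])
  show "f \<cdot> Lun C (Dom C f) = g \<cdot> Lun C (Dom C f)"
    using Lun_nat[of f "Cod C f"] Lun_nat[of g "Cod C f"] assms by simp
qed (use assms in auto)

lemma TenA_Uni_inject:
  assumes "f \<in> Arr C" "g \<in> Arr C" "Dom C f = Dom C g" "Cod C f = Cod C g"
    "f \<boxtimes> Ide C (Uni C) = g \<boxtimes> Ide C (Uni C)"
  shows "f = g"
proof (rule iso_cancel_right[of "Run C (Dom C f)"])
  show "f \<cdot> Run C (Dom C f) = g \<cdot> Run C (Dom C f)"
    using Run_nat[of f "Cod C f"] Run_nat[of g "Cod C f"] assms by simp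
qed (use assms in auto)

text \<open>Kelly's argument: the triangle axiom treats only a unit in the middle. The pentagon with
  two units in front, reduced by two triangles, gives the identity tensored with
  \<open>Uni C\<close>, and that tensoring is faithful.\<close>

lemma Lun_TenO:
  assumes [simp]: "X \<in> Ob C" "Y \<in> Ob C"
  shows "Lun C (X \<boxdot> Y) \<cdot> Asc C (Uni C) X Y = Lun C X \<boxtimes> Ide C Y"
proof (rule Uni_TenA_inject)
  let ?I = "Uni C" and ?i = "Ide C (Uni C)" and ?y = "Ide C Y"
  let ?p = "Asc C ?I (?I \<boxdot> X) Y \<cdot> (Asc C ?I ?I X \<boxtimes> ?y)"
  show "?i \<boxtimes> (Lun C (X \<boxdot> Y) \<cdot> Asc C ?I X Y) = ?i \<boxtimes> (Lun C X \<boxtimes> ?y)"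
  \<comment> \<open>Composing with the isomorphism \<open>?p\<close> completes one side of the
    pentagon.\<close>
  proof (rule iso_cancel_right[of ?p])
    have "(?i \<boxtimes> (Lun C (X \<boxdot> Y) \<cdot> Asc C ?I X Y)) \<cdot> ?p
        = (?i \<boxtimes> Lun C (X \<boxdot> Y)) \<cdot> (?i \<boxtimes> Asc C ?I X Y) \<cdot> ?p"
      by (simp add: interchange flip: Cmp_assoc')
    also have "\<dots> = ((?i \<boxtimes> Lun C (X \<boxdot> Y)) \<cdot> Asc C ?I ?I (X \<boxdot> Y)) \<cdot> Asc C (?I \<boxdot> ?I) X Y"
      by (subst pentagon) (simp_all add: Cmp_assoc')
    also have "\<dots> = Asc C ?I X Y \<cdot> ((Run C ?I \<boxtimes> Ide C X) \<boxtimes> ?y)"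
      by (simp add: triangle Asc_nat)
    also have "\<dots> = Asc C ?I X Y \<cdot> (((?i \<boxtimes> Lun C X) \<boxtimes> ?y) \<cdot> (Asc C ?I ?I X \<boxtimes> ?y))"
      by (simp add: triangle interchange)
    also have "\<dots> = (?i \<boxtimes> (Lun C X \<boxtimes> ?y)) \<cdot> ?p"
      by (simp add: Asc_nat flip: Cmp_assoc')
    finally show "(?i \<boxtimes> (Lun C (X \<boxdot> Y) \<cdot> Asc C ?I X Y)) \<cdot> ?p = (?i \<boxtimes> (Lun C X \<boxtimes> ?y)) \<cdot> ?p" .
  qed simp_all
qed simp_all

text \<open>The same argument from the right, with the pentagon for \<open>X\<close>,
  \<open>Y\<close> and two final units.\<close>

lemma Run_TenO:
  assumes [simp]: "X \<in> Ob C" "Y \<in> Ob C"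
  shows "(Ide C X \<boxtimes> Run C Y) \<cdot> Asc C X Y (Uni C) = Run C (X \<boxdot> Y)"
proof (rule TenA_Uni_inject)
  let ?I = "Uni C" and ?i = "Ide C (Uni C)" and ?x = "Ide C X" and ?y = "Ide C Y"
  show "((?x \<boxtimes> Run C Y) \<cdot> Asc C X Y ?I) \<boxtimes> ?i = Run C (X \<boxdot> Y) \<boxtimes> ?i"
  proof (rule iso_cancel_left[of "Asc C X Y ?I"])
    have "Asc C X Y ?I \<cdot> (((?x \<boxtimes> Run C Y) \<cdot> Asc C X Y ?I) \<boxtimes> ?i)
        = (Asc C X Y ?I \<cdot> ((?x \<boxtimes> Run C Y) \<boxtimes> ?i)) \<cdot> (Asc C X Y ?I \<boxtimes> ?i)"
      by (simp add: Cmp_assoc' interchange)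
    also have "\<dots> = (?x \<boxtimes> (Run C Y \<boxtimes> ?i)) \<cdot> Asc C X (Y \<boxdot> ?I) ?I \<cdot> (Asc C X Y ?I \<boxtimes> ?i)"
      by (simp add: Asc_nat Cmp_assoc')
    also have "\<dots> = (?x \<boxtimes> (?y \<boxtimes> Lun C ?I)) \<cdot> (?x \<boxtimes> Asc C Y ?I ?I) \<cdot> Asc C X (Y \<boxdot> ?I) ?I \<cdot> (Asc C X Y ?I \<boxtimes> ?i)"
      by (simp add: triangle interchange flip: Cmp_assoc')
    also have "\<dots> = ((?x \<boxtimes> (?y \<boxtimes> Lun C ?I)) \<cdot> Asc C X Y (?I \<boxdot> ?I)) \<cdot> Asc C (X \<boxdot> Y) ?I ?I"
      by (subst pentagon) (simp_all add: Cmp_assoc')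
    also have "\<dots> = (Asc C X Y ?I \<cdot> ((?x \<boxtimes> ?y) \<boxtimes> Lun C ?I)) \<cdot> Asc C (X \<boxdot> Y) ?I ?I"
      by (subst Asc_nat) simp_all
    also have "\<dots> = Asc C X Y ?I \<cdot> (Run C (X \<boxdot> Y) \<boxtimes> ?i)"
      by (simp add: Cmp_assoc' triangle)
    finally show "Asc C X Y ?I \<cdot> (((?x \<boxtimes> Run C Y) \<cdot> Asc C X Y ?I) \<boxtimes> ?i)
      = Asc C X Y ?I \<cdot> (Run C (X \<boxdot> Y) \<boxtimes> ?i)" .
  qed simp_all
qed simp_all

text \<open>Naturality of \<open>Lun\<close> at the arrow \<open>Lun C (Uni C)\<close> itself gives
  \<open>Lun C (I \<boxdot> I) = id \<boxtimes> Lun C I\<close>. After that the triangle and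
  \<open>Lun_TenO\<close> have the same left side.\<close>

lemma Lun_Uni: "Lun C (Uni C) = Run C (Uni C)"
proof (rule TenA_Uni_inject)
  let ?I = "Uni C" and ?i = "Ide C (Uni C)"
  have "Lun C (?I \<boxdot> ?I) = ?i \<boxtimes> Lun C ?I"
    by (rule iso_cancel_left[of "Lun C ?I"]) (simp_all add: Lun_nat)
  then show "Lun C ?I \<boxtimes> ?i = Run C ?I \<boxtimes> ?i"
    using triangle[of ?I ?I] Lun_TenO[of ?I ?I] by simp
qed simp_all

end

section \<open>Additive structure of the hom sets\<close>

context preadditive_category
begin

definition Neg :: "'b \<Rightarrow> 'b" where
  "Neg f = inv\<^bsub>hom_group C (Dom C f) (Cod C f)\<^esub> f"

lemma carrier_hom_group: "f \<in> carrier (hom_group C X Y) \<longleftrightarrow> f \<in> Arr C \<and> Dom C f = X \<and> Cod C f = Y"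
  by (simp add: hom_group_def Hom_def)

lemma Arr_Add [simp]: "\<lbrakk>f \<in> Arr C; g \<in> Arr C; Dom C f = Dom C g; Cod C f = Cod C g\<rbrakk> \<Longrightarrow> f \<boxplus> g \<in> Arr C"
  and Dom_Add [simp]: "\<lbrakk>f \<in> Arr C; g \<in> Arr C; Dom C f = Dom C g; Cod C f = Cod C g\<rbrakk> \<Longrightarrow> Dom C (f \<boxplus> g) = Dom C g"
  and Cod_Add [simp]: "\<lbrakk>f \<in> Arr C; g \<in> Arr C; Dom C f = Dom C g; Cod C f = Cod C g\<rbrakk> \<Longrightarrow> Cod C (f \<boxplus> g) = Cod C g"
  and Add_commute: "\<lbrakk>f \<in> Arr C; g \<in> Arr C; Dom C f = Dom C g; Cod C f = Cod C g\<rbrakk> \<Longrightarrow> f \<boxplus> g = g \<boxplus> f"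
proof -
  assume a: "f \<in> Arr C" "g \<in> Arr C" "Dom C f = Dom C g" "Cod C f = Cod C g"
  interpret G: comm_group "hom_group C (Dom C g) (Cod C g)" using a by (simp add: hom_comm_group)
  have "f \<in> carrier (hom_group C (Dom C g) (Cod C g))" "g \<in> carrier (hom_group C (Dom C g) (Cod C g))"
    using a by (auto simp: carrier_hom_group)
  from G.m_closed[OF this] G.m_comm[OF this]
  show "f \<boxplus> g \<in> Arr C" "Dom C (f \<boxplus> g) = Dom C g" "Cod C (f \<boxplus> g) = Cod C g" "f \<boxplus> g = g \<boxplus> f"
    by (auto simp: carrier_hom_group) (auto simp: hom_group_def)
qed

lemma Add_assoc:
  assumes "f \<in> Arr C" "g \<in> Arr C" "h \<in> Arr C" "Dom C f = Dom C g" "Cod C f = Cod C g"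
    "Dom C g = Dom C h" "Cod C g = Cod C h"
  shows "(f \<boxplus> g) \<boxplus> h = f \<boxplus> (g \<boxplus> h)"
proof -
  interpret G: comm_group "hom_group C (Dom C g) (Cod C g)" using assms by (simp add: hom_comm_group)
  show ?thesis using G.m_assoc[of f g h] assms by (simp add: carrier_hom_group) (simp add: hom_group_def)
qed

lemma Arr_Zro [simp]: "\<lbrakk>X \<in> Ob C; Y \<in> Ob C\<rbrakk> \<Longrightarrow> Zro C X Y \<in> Arr C"
  and Dom_Zro [simp]: "\<lbrakk>X \<in> Ob C; Y \<in> Ob C\<rbrakk> \<Longrightarrow> Dom C (Zro C X Y) = X"
  and Cod_Zro [simp]: "\<lbrakk>X \<in> Ob C; Y \<in> Ob C\<rbrakk> \<Longrightarrow> Cod C (Zro C X Y) = Y"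
proof -
  assume "X \<in> Ob C" "Y \<in> Ob C"
  then interpret G: comm_group "hom_group C X Y" by (rule hom_comm_group)
  show "Zro C X Y \<in> Arr C" "Dom C (Zro C X Y) = X" "Cod C (Zro C X Y) = Y"
    using G.one_closed unfolding carrier_hom_group by (auto simp: hom_group_def)
qed

lemma Add_Zro [simp]: "\<lbrakk>f \<in> Arr C; Dom C f = X; Cod C f = Y\<rbrakk> \<Longrightarrow> f \<boxplus> Zro C X Y = f"
proof -
  assume a: "f \<in> Arr C" "Dom C f = X" "Cod C f = Y"
  then interpret G: comm_group "hom_group C X Y" by (auto intro!: hom_comm_group)
  show ?thesis using G.r_one[of f] a unfolding carrier_hom_group by (simp add: hom_group_def)
qed

lemma Zro_Add [simp]: "\<lbrakk>f \<in> Arr C; Dom C f = X; Cod C f = Y\<rbrakk> \<Longrightarrow> Zro C X Y \<boxplus> f = f"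
  using Add_commute[of f "Zro C X Y"] by auto

lemma Arr_Neg [simp]: "f \<in> Arr C \<Longrightarrow> Neg f \<in> Arr C"
  and Dom_Neg [simp]: "f \<in> Arr C \<Longrightarrow> Dom C (Neg f) = Dom C f"
  and Cod_Neg [simp]: "f \<in> Arr C \<Longrightarrow> Cod C (Neg f) = Cod C f"
  and Add_Neg [simp]: "f \<in> Arr C \<Longrightarrow> f \<boxplus> Neg f = Zro C (Dom C f) (Cod C f)"
proof -
  assume a: "f \<in> Arr C"
  then interpret G: comm_group "hom_group C (Dom C f) (Cod C f)" by (auto intro!: hom_comm_group)
  have c: "f \<in> carrier (hom_group C (Dom C f) (Cod C f))" using a by (simp add: carrier_hom_group)
  from G.inv_closed[OF c]
  show "Neg f \<in> Arr C" "Dom C (Neg f) = Dom C f" "Cod C (Neg f) = Cod C f"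
    by (auto simp: carrier_hom_group Neg_def)
  show "f \<boxplus> Neg f = Zro C (Dom C f) (Cod C f)"
    using G.r_inv[OF c] by (simp add: Neg_def) (simp add: hom_group_def)
qed

text \<open>Shows that composites and tensor products with zero vanish: by additivity they equal
  their own double.\<close>

lemma Add_idem_Zro:
  assumes "f \<in> Arr C" "f \<boxplus> f = f" shows "f = Zro C (Dom C f) (Cod C f)"
proof -
  have "f = f \<boxplus> (f \<boxplus> Neg f)" using assms by simp
  also have "\<dots> = (f \<boxplus> f) \<boxplus> Neg f" using assms(1) by (simp add: Add_assoc)
  finally show ?thesis using assms by simp
qed

lemma Cmp_Add':
  "\<lbrakk>f \<in> Arr C; f' \<in> Arr C; g \<in> Arr C; Dom C f = Dom C f'; Cod C f = Cod C f'; Cod C f' = Dom C g\<rbrakk>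
    \<Longrightarrow> g \<cdot> (f \<boxplus> f') = g \<cdot> f \<boxplus> g \<cdot> f'"
  using Cmp_Add[of f "Dom C f" "Cod C f" f' g "Cod C g"] by (auto simp: Hom_def)

lemma Add_Cmp':
  "\<lbrakk>f \<in> Arr C; g \<in> Arr C; g' \<in> Arr C; Dom C g = Dom C g'; Cod C g = Cod C g'; Cod C f = Dom C g'\<rbrakk>
    \<Longrightarrow> (g \<boxplus> g') \<cdot> f = g \<cdot> f \<boxplus> g' \<cdot> f"
  using Add_Cmp[of f "Dom C f" "Cod C f" g "Cod C g" g'] by (auto simp: Hom_def)

lemma Cmp_Zro [simp]: "\<lbrakk>g \<in> Arr C; X \<in> Ob C; Dom C g = Y\<rbrakk> \<Longrightarrow> g \<cdot> Zro C X Y = Zro C X (Cod C g)"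
  using Add_idem_Zro[of "g \<cdot> Zro C X Y"] Cmp_Add'[of "Zro C X Y" "Zro C X Y" g] by auto

lemma Zro_Cmp [simp]: "\<lbrakk>f \<in> Arr C; Z \<in> Ob C; Cod C f = Y\<rbrakk> \<Longrightarrow> Zro C Y Z \<cdot> f = Zro C (Dom C f) Z"
  using Add_idem_Zro[of "Zro C Y Z \<cdot> f"] Add_Cmp'[of f "Zro C Y Z" "Zro C Y Z"] by auto

lemma Neg_unique:
  assumes "f \<in> Arr C" "g \<in> Arr C" "Dom C f = Dom C g" "Cod C f = Cod C g" "f \<boxplus> g = Zro C (Dom C f) (Cod C f)"
  shows "g = Neg f"
proof -
  have "g = g \<boxplus> (f \<boxplus> Neg f)" using assms by simp
  also have "\<dots> = (g \<boxplus> f) \<boxplus> Neg f" by (rule Add_assoc[symmetric]) (use assms in simp_all)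
  also have "\<dots> = (f \<boxplus> g) \<boxplus> Neg f" using assms(1-4) by (simp add: Add_commute)
  also have "\<dots> = Neg f" using assms by simp
  finally show ?thesis .
qed

lemma Cmp_Neg: "\<lbrakk>f \<in> Arr C; g \<in> Arr C; Cod C f = Dom C g\<rbrakk> \<Longrightarrow> g \<cdot> Neg f = Neg (g \<cdot> f)"
  by (rule Neg_unique) (simp_all flip: Cmp_Add')

lemma signed_eq: "signed C n f = (if even n then f else Neg f)"
  by (simp add: signed_def Neg_def)

end

context abelian_braided_category
begin

lemma TenA_Add_left': "\<lbrakk>f \<in> Arr C; f' \<in> Arr C; g \<in> Arr C; Dom C f = Dom C f'; Cod C f = Cod C f'\<rbrakk>
    \<Longrightarrow> (f \<boxplus> f') \<boxtimes> g = f \<boxtimes> g \<boxplus> f' \<boxtimes> g"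
  using TenA_Add_left[of f "Dom C f" "Cod C f" f' g "Dom C g" "Cod C g"] by (auto simp: Hom_def)

lemma TenA_Add_right': "\<lbrakk>f \<in> Arr C; g \<in> Arr C; g' \<in> Arr C; Dom C g = Dom C g'; Cod C g = Cod C g'\<rbrakk>
    \<Longrightarrow> f \<boxtimes> (g \<boxplus> g') = f \<boxtimes> g \<boxplus> f \<boxtimes> g'"
  using TenA_Add_right[of f "Dom C f" "Cod C f" g "Dom C g" "Cod C g" g'] by (auto simp: Hom_def)

lemma TenA_Zro [simp]: "\<lbrakk>f \<in> Arr C; X \<in> Ob C; Y \<in> Ob C\<rbrakk>
    \<Longrightarrow> f \<boxtimes> Zro C X Y = Zro C (Dom C f \<boxdot> X) (Cod C f \<boxdot> Y)"
  using Add_idem_Zro[of "f \<boxtimes> Zro C X Y"] TenA_Add_right'[of f "Zro C X Y" "Zro C X Y"] by auto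

lemma Zro_TenA [simp]: "\<lbrakk>f \<in> Arr C; X \<in> Ob C; Y \<in> Ob C\<rbrakk>
    \<Longrightarrow> Zro C X Y \<boxtimes> f = Zro C (X \<boxdot> Dom C f) (Y \<boxdot> Cod C f)"
  using Add_idem_Zro[of "Zro C X Y \<boxtimes> f"] TenA_Add_left'[of "Zro C X Y" "Zro C X Y" f] by auto

lemma Arr_Brd [simp]: "\<lbrakk>X \<in> Ob C; Y \<in> Ob C\<rbrakk> \<Longrightarrow> Brd C X Y \<in> Arr C"
  and Dom_Brd [simp]: "\<lbrakk>X \<in> Ob C; Y \<in> Ob C\<rbrakk> \<Longrightarrow> Dom C (Brd C X Y) = X \<boxdot> Y"
  and Cod_Brd [simp]: "\<lbrakk>X \<in> Ob C; Y \<in> Ob C\<rbrakk> \<Longrightarrow> Cod C (Brd C X Y) = Y \<boxdot> X"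
  using Brd_Hom[of X Y] by (auto simp: Hom_def)

declare Brd_iso [simp]

lemma Brd_nat: "\<lbrakk>f \<in> Arr C; g \<in> Arr C; Cod C f = X; Cod C g = Y\<rbrakk>
    \<Longrightarrow> Brd C X Y \<cdot> (f \<boxtimes> g) = (g \<boxtimes> f) \<cdot> Brd C (Dom C f) (Dom C g)"
  using Brd_natural[OF HomI HomI, of f g] by simp

end

section \<open>Strictification\<close>

text \<open>
  A strict arrow between words \<open>xs\<close> and \<open>ys\<close> is an arrow between the right-nested tensor products
  \<open>nest xs\<close> and \<open>nest ys\<close>. Ill-typed triples and composites count as zero arrows, and letters that
  are not objects as the unit object, so that most laws hold without typing conditions.
\<close>

datatype ('o, 'a) sarr = SArr (sdom: "'o list") (sval: 'a) (scod: "'o list")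

text \<open>Bracketed words; \<open>Lf X\<close> stands for the object \<open>X\<close> and \<open>Li xs\<close> for \<open>nest xs\<close>, whereas \<open>nest [X] = X \<otimes> I\<close>.\<close>

datatype 'o tree = Ut | Lf 'o | Li "'o list" | Tn "'o tree" "'o tree"

primrec flat :: "'o tree \<Rightarrow> 'o list" where
  "flat Ut = []"
| "flat (Lf X) = [X]"
| "flat (Li xs) = xs"
| "flat (Tn s t) = flat s @ flat t"

context abelian_braided_category
begin

definition ob :: "'a \<Rightarrow> 'a" where "ob X = (if X \<in> Ob C then X else Uni C)"

lemma ob_Ob [simp]: "ob X \<in> Ob C" by (simp add: ob_def)

lemma ob_id [simp]: "X \<in> Ob C \<Longrightarrow> ob X = X" by (simp add: ob_def)

primrec nest :: "'a list \<Rightarrow> 'a" where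
  "nest [] = Uni C"
| "nest (X # xs) = ob X \<boxdot> nest xs"

lemma nest_Ob [simp]: "nest xs \<in> Ob C" by (induction xs) auto

text \<open>The isomorphism from a tensor product of two nested words to the nested concatenation;
  it makes \<open>nest\<close> strong monoidal.\<close>

primrec mu :: "'a list \<Rightarrow> 'a list \<Rightarrow> 'b" where
  "mu [] ys = Lun C (nest ys)"
| "mu (X # xs) ys = (Ide C (ob X) \<boxtimes> mu xs ys) \<cdot> Asc C (ob X) (nest xs) (nest ys)"

lemma mu_typing: "mu xs ys \<in> Arr C \<and> Dom C (mu xs ys) = nest xs \<boxdot> nest ys
    \<and> Cod C (mu xs ys) = nest (xs @ ys) \<and> iso_arrow C (mu xs ys)"
  by (induction xs) auto

lemma Arr_mu [simp]: "mu xs ys \<in> Arr C"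
  and Dom_mu [simp]: "Dom C (mu xs ys) = nest xs \<boxdot> nest ys"
  and Cod_mu [simp]: "Cod C (mu xs ys) = nest (xs @ ys)"
  and iso_mu [simp]: "iso_arrow C (mu xs ys)"
  using mu_typing by auto

text \<open>Coherence for words: \<open>Lun_TenO\<close> settles the empty word, and each further
  letter costs one pentagon.\<close>

lemma mu_assoc:
  "mu (xs @ ys) zs \<cdot> (mu xs ys \<boxtimes> Ide C (nest zs))
    = mu xs (ys @ zs) \<cdot> (Ide C (nest xs) \<boxtimes> mu ys zs) \<cdot> Asc C (nest xs) (nest ys) (nest zs)"
proof (induction xs)
  case Nil
  have "mu ys zs \<cdot> (Lun C (nest ys) \<boxtimes> Ide C (nest zs))
      = (mu ys zs \<cdot> Lun C (nest ys \<boxdot> nest zs)) \<cdot> Asc C (Uni C) (nest ys) (nest zs)"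
    by (simp add: Cmp_assoc' Lun_TenO)
  also have "\<dots> = (Lun C (nest (ys @ zs)) \<cdot> (Ide C (Uni C) \<boxtimes> mu ys zs)) \<cdot> Asc C (Uni C) (nest ys) (nest zs)"
    by (simp add: Lun_nat)
  finally show ?case by (simp add: Cmp_assoc')
next
  case (Cons X xs)
  let ?x = "Ide C (ob X)" and ?z = "Ide C (nest zs)" and ?X = "ob X" and ?A = "Asc C"
  have "mu ((X # xs) @ ys) zs \<cdot> (mu (X # xs) ys \<boxtimes> ?z)
      = (?x \<boxtimes> mu (xs @ ys) zs) \<cdot> (?A ?X (nest (xs @ ys)) (nest zs) \<cdot> ((?x \<boxtimes> mu xs ys) \<boxtimes> ?z))
          \<cdot> (?A ?X (nest xs) (nest ys) \<boxtimes> ?z)"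
    by (simp add: Cmp_assoc' interchange)
  also have "\<dots> = (?x \<boxtimes> (mu (xs @ ys) zs \<cdot> (mu xs ys \<boxtimes> ?z)))
      \<cdot> ?A ?X (nest xs \<boxdot> nest ys) (nest zs) \<cdot> (?A ?X (nest xs) (nest ys) \<boxtimes> ?z)"
    by (simp add: Asc_nat Cmp_assoc' interchange_Cmp)
  also have "\<dots> = (?x \<boxtimes> (mu xs (ys @ zs) \<cdot> (Ide C (nest xs) \<boxtimes> mu ys zs)))
      \<cdot> (?x \<boxtimes> ?A (nest xs) (nest ys) (nest zs))
      \<cdot> ?A ?X (nest xs \<boxdot> nest ys) (nest zs) \<cdot> (?A ?X (nest xs) (nest ys) \<boxtimes> ?z)"
    unfolding Cons.IH by (simp add: interchange_Cmp Cmp_assoc')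
  also have "\<dots> = (?x \<boxtimes> mu xs (ys @ zs)) \<cdot> ((?x \<boxtimes> (Ide C (nest xs) \<boxtimes> mu ys zs))
      \<cdot> ?A ?X (nest xs) (nest ys \<boxdot> nest zs)) \<cdot> ?A (?X \<boxdot> nest xs) (nest ys) (nest zs)"
    by (subst pentagon) (simp_all add: interchange_Cmp Cmp_assoc')
  also have "(?x \<boxtimes> (Ide C (nest xs) \<boxtimes> mu ys zs)) \<cdot> ?A ?X (nest xs) (nest ys \<boxdot> nest zs)
      = ?A ?X (nest xs) (nest (ys @ zs)) \<cdot> ((?x \<boxtimes> Ide C (nest xs)) \<boxtimes> mu ys zs)"
    by (subst Asc_nat) simp_all
  finally show ?case by (simp add: Cmp_assoc')
qed

lemma mu_Nil: "mu xs [] = Run C (nest xs)"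
  by (induction xs) (simp_all add: Lun_Uni Run_TenO)

definition valid :: "('a, 'b) sarr \<Rightarrow> bool" where
  "valid f \<longleftrightarrow> sval f \<in> Hom C (nest (sdom f)) (nest (scod f))"

definition val :: "('a, 'b) sarr \<Rightarrow> 'b" where
  "val f = (if valid f then sval f else Zro C (nest (sdom f)) (nest (scod f)))"

lemma Arr_val [simp]: "val f \<in> Arr C"
  and Dom_val [simp]: "Dom C (val f) = nest (sdom f)"
  and Cod_val [simp]: "Cod C (val f) = nest (scod f)"
  by (auto simp: val_def valid_def Hom_def)

lemma val_SArr [simp]: "\<lbrakk>f \<in> Arr C; Dom C f = nest xs; Cod C f = nest ys\<rbrakk> \<Longrightarrow> val (SArr xs f ys) = f"
  and valid_SArr [simp]: "\<lbrakk>f \<in> Arr C; Dom C f = nest xs; Cod C f = nest ys\<rbrakk> \<Longrightarrow> valid (SArr xs f ys)"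
  by (auto simp: val_def valid_def Hom_def)

lemma valid_eqI: "\<lbrakk>valid f; valid g; sdom f = sdom g; scod f = scod g; val f = val g\<rbrakk> \<Longrightarrow> f = g"
  by (auto simp: val_def intro: sarr.expand)

definition szero :: "'a list \<Rightarrow> 'a list \<Rightarrow> ('a, 'b) sarr" where
  "szero xs ys = SArr xs (Zro C (nest xs) (nest ys)) ys"

definition sid :: "'a list \<Rightarrow> ('a, 'b) sarr" where
  "sid xs = SArr xs (Ide C (nest xs)) xs"

definition scomp :: "('a, 'b) sarr \<Rightarrow> ('a, 'b) sarr \<Rightarrow> ('a, 'b) sarr" where
  "scomp g f = (if scod f = sdom g then SArr (sdom f) (val g \<cdot> val f) (scod g) else szero (sdom f) (scod g))"

definition sten :: "('a, 'b) sarr \<Rightarrow> ('a, 'b) sarr \<Rightarrow> ('a, 'b) sarr" where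
  "sten f g = SArr (sdom f @ sdom g)
     (mu (scod f) (scod g) \<cdot> (val f \<boxtimes> val g) \<cdot> Inv C (mu (sdom f) (sdom g))) (scod f @ scod g)"

definition sadd :: "('a, 'b) sarr \<Rightarrow> ('a, 'b) sarr \<Rightarrow> ('a, 'b) sarr" where
  "sadd f g = (if sdom f = sdom g \<and> scod f = scod g then SArr (sdom f) (val f \<boxplus> val g) (scod f)
     else szero (sdom f) (scod f))"

definition sneg :: "('a, 'b) sarr \<Rightarrow> ('a, 'b) sarr" where
  "sneg f = SArr (sdom f) (Neg (val f)) (scod f)"

definition sbrd :: "'a list \<Rightarrow> 'a list \<Rightarrow> ('a, 'b) sarr" where
  "sbrd xs ys = SArr (xs @ ys) (mu ys xs \<cdot> Brd C (nest xs) (nest ys) \<cdot> Inv C (mu xs ys)) (ys @ xs)"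

lemma sdom_simps [simp]: "sdom (szero xs ys) = xs" "sdom (sid xs) = xs" "sdom (scomp g f) = sdom f"
    "sdom (sten f g) = sdom f @ sdom g" "sdom (sadd f g) = sdom f" "sdom (sneg f) = sdom f" "sdom (sbrd xs ys) = xs @ ys"
  and scod_simps [simp]: "scod (szero xs ys) = ys" "scod (sid xs) = xs" "scod (scomp g f) = scod g"
    "scod (sten f g) = scod f @ scod g" "scod (sadd f g) = scod f" "scod (sneg f) = scod f" "scod (sbrd xs ys) = ys @ xs"
  and valid_simps [simp]: "valid (szero xs ys)" "valid (sid xs)" "valid (scomp g f)"
    "valid (sten f g)" "valid (sadd f g)" "valid (sneg f)" "valid (sbrd xs ys)"
  by (simp_all add: szero_def sid_def scomp_def sten_def sadd_def sneg_def sbrd_def)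

lemma val_simps [simp]: "val (szero xs ys) = Zro C (nest xs) (nest ys)" "val (sid xs) = Ide C (nest xs)"
    "scod f = sdom g \<Longrightarrow> val (scomp g f) = val g \<cdot> val f"
    "scod f \<noteq> sdom g \<Longrightarrow> val (scomp g f) = Zro C (nest (sdom f)) (nest (scod g))"
    "val (sten f g) = mu (scod f) (scod g) \<cdot> (val f \<boxtimes> val g) \<cdot> Inv C (mu (sdom f) (sdom g))"
    "sdom f = sdom g \<Longrightarrow> scod f = scod g \<Longrightarrow> val (sadd f g) = val f \<boxplus> val g"
    "val (sneg f) = Neg (val f)"
    "val (sbrd xs ys) = mu ys xs \<cdot> Brd C (nest xs) (nest ys) \<cdot> Inv C (mu xs ys)"
  by (simp_all add: szero_def sid_def scomp_def sten_def sadd_def sneg_def sbrd_def)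

primrec tobj :: "'a tree \<Rightarrow> 'a" where
  "tobj Ut = Uni C"
| "tobj (Lf X) = ob X"
| "tobj (Li xs) = nest xs"
| "tobj (Tn s t) = tobj s \<boxdot> tobj t"

lemma tobj_Ob [simp]: "tobj t \<in> Ob C" by (induction t) auto

text \<open>A leaf needs the inverse right unitor because \<open>nest [X]\<close> ends in the unit
  object.\<close>

primrec can :: "'a tree \<Rightarrow> 'b" where
  "can Ut = Ide C (Uni C)"
| "can (Lf X) = Inv C (Run C (ob X))"
| "can (Li xs) = Ide C (nest xs)"
| "can (Tn s t) = mu (flat s) (flat t) \<cdot> (can s \<boxtimes> can t)"

lemma can_typing: "can t \<in> Arr C \<and> Dom C (can t) = tobj t \<and> Cod C (can t) = nest (flat t) \<and> iso_arrow C (can t)"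
  by (induction t) auto

lemma Arr_can [simp]: "can t \<in> Arr C"
  and Dom_can [simp]: "Dom C (can t) = tobj t"
  and Cod_can [simp]: "Cod C (can t) = nest (flat t)"
  and iso_can [simp]: "iso_arrow C (can t)"
  using can_typing by auto

text \<open>\<open>stricts s t f \<phi>\<close>: the strict arrow \<open>\<phi>\<close> is \<open>f\<close> conjugated by the canonical isomorphisms.\<close>

definition stricts :: "'a tree \<Rightarrow> 'a tree \<Rightarrow> 'b \<Rightarrow> ('a, 'b) sarr \<Rightarrow> bool" where
  "stricts s t f \<phi> \<longleftrightarrow> f \<in> Arr C \<and> Dom C f = tobj s \<and> Cod C f = tobj t \<and> valid \<phi> \<and>
     sdom \<phi> = flat s \<and> scod \<phi> = flat t \<and> val \<phi> \<cdot> can s = can t \<cdot> f"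

text \<open>Equations between strict arrows return to the given category through this lemma;
  equations assumed there pass to strict arrows through \<open>stricts_fun\<close>. Both rest on the
  invertibility of \<open>can\<close>.\<close>

lemma stricts_inj: "\<lbrakk>stricts s t f \<phi>; stricts s t g \<phi>\<rbrakk> \<Longrightarrow> f = g"
  unfolding stricts_def by (rule iso_cancel_left[of "can t"]) auto

lemma stricts_fun: "\<lbrakk>stricts s t f \<phi>; stricts s t f \<psi>\<rbrakk> \<Longrightarrow> \<phi> = \<psi>"
  unfolding stricts_def by (rule valid_eqI) (auto intro: iso_cancel_right[of "can s"])

definition strict :: "'a tree \<Rightarrow> 'a tree \<Rightarrow> 'b \<Rightarrow> ('a, 'b) sarr" where
  "strict s t f = SArr (flat s) (can t \<cdot> f \<cdot> Inv C (can s)) (flat t)"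

lemma stricts_strict: "\<lbrakk>f \<in> Arr C; Dom C f = tobj s; Cod C f = tobj t\<rbrakk> \<Longrightarrow> stricts s t f (strict s t f)"
  by (simp add: stricts_def strict_def Cmp_assoc')

lemma stricts_val: "valid \<phi> \<Longrightarrow> stricts (Li (sdom \<phi>)) (Li (scod \<phi>)) (val \<phi>) \<phi>"
  by (simp add: stricts_def)

lemma stricts_Cmp: "\<lbrakk>stricts s t f \<phi>; stricts t u g \<psi>\<rbrakk> \<Longrightarrow> stricts s u (g \<cdot> f) (scomp \<psi> \<phi>)"
  unfolding stricts_def
  by (auto simp: Cmp_assoc') (metis Arr_can Arr_val Cmp_assoc' Cod_can Cod_val Dom_can Dom_val)

lemma stricts_Ide: "tobj t = X \<Longrightarrow> stricts t t (Ide C X) (sid (flat t))"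
  by (auto simp: stricts_def)

lemma stricts_TenA:
  assumes "stricts s t f \<phi>" "stricts s' t' f' \<phi>'"
  shows "stricts (Tn s s') (Tn t t') (f \<boxtimes> f') (sten \<phi> \<phi>')"
proof -
  have [simp]: "Inv C (mu (flat s) (flat s')) \<cdot> mu (flat s) (flat s') \<cdot> (can s \<boxtimes> can s') = can s \<boxtimes> can s'"
    by (simp flip: Cmp_assoc')
  show ?thesis using assms by (simp add: stricts_def Cmp_assoc' interchange)
qed

text \<open>The purpose of \<open>mu_assoc\<close>: associators become identities. The lemmas on
  \<open>Lun\<close> and \<open>Run\<close> below do the same for the unitors.\<close>

lemma stricts_Asc:
  assumes [simp]: "tobj r = X" "tobj s = Y" "tobj t = Z"
  shows "stricts (Tn (Tn r s) t) (Tn r (Tn s t)) (Asc C X Y Z) (sid (flat r @ flat s @ flat t))"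
proof -
  have [simp]: "X \<in> Ob C" "Y \<in> Ob C" "Z \<in> Ob C" using tobj_Ob assms by metis+
  let ?r = "can r" and ?s = "can s" and ?t = "can t"
  have "mu (flat r @ flat s) (flat t) \<cdot> ((mu (flat r) (flat s) \<cdot> (?r \<boxtimes> ?s)) \<boxtimes> ?t)
      = mu (flat r @ flat s) (flat t) \<cdot> (mu (flat r) (flat s) \<boxtimes> Ide C (nest (flat t))) \<cdot> ((?r \<boxtimes> ?s) \<boxtimes> ?t)"
    by (simp add: interchange)
  also have "\<dots> = (mu (flat r @ flat s) (flat t) \<cdot> (mu (flat r) (flat s) \<boxtimes> Ide C (nest (flat t)))) \<cdot> ((?r \<boxtimes> ?s) \<boxtimes> ?t)"
    by (simp add: Cmp_assoc')
  also have "\<dots> = mu (flat r) (flat s @ flat t) \<cdot> ((?r \<boxtimes> (mu (flat s) (flat t) \<cdot> (?s \<boxtimes> ?t))) \<cdot> Asc C X Y Z)"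
    unfolding mu_assoc by (simp add: Cmp_assoc' Asc_nat interchange_Cmp)
  finally show ?thesis by (simp add: stricts_def Cmp_assoc')
qed

lemma stricts_Lun: "tobj t = X \<Longrightarrow> stricts (Tn Ut t) t (Lun C X) (sid (flat t))"
  by (auto simp: stricts_def Lun_nat)

lemma stricts_Run: "tobj t = X \<Longrightarrow> stricts (Tn t Ut) t (Run C X) (sid (flat t))"
  by (auto simp: stricts_def Run_nat mu_Nil)

lemma stricts_Inv:
  assumes "stricts s t f (sid xs)" "iso_arrow C f"
  shows "stricts t s (Inv C f) (sid xs)"
proof -
  have a: "flat s = xs" "flat t = xs" "Dom C f = tobj s" "Cod C f = tobj t" "can s = can t \<cdot> f" "f \<in> Arr C"
    using assms by (auto simp: stricts_def)
  then have "can s \<cdot> Inv C f = can t" using assms(2) by (simp add: Cmp_assoc')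
  then show ?thesis using a assms(2) by (auto simp: stricts_def)
qed

lemma stricts_Brd:
  assumes [simp]: "tobj s = X" "tobj t = Y"
  shows "stricts (Tn s t) (Tn t s) (Brd C X Y) (sbrd (flat s) (flat t))"
proof -
  have [simp]: "X \<in> Ob C" "Y \<in> Ob C" using tobj_Ob assms by metis+
  have "Inv C (mu (flat s) (flat t)) \<cdot> mu (flat s) (flat t) \<cdot> (can s \<boxtimes> can t) = can s \<boxtimes> can t"
    by (simp flip: Cmp_assoc')
  then show ?thesis by (simp add: stricts_def Cmp_assoc' Brd_nat)
qed

lemma stricts_Add: "\<lbrakk>stricts s t f \<phi>; stricts s t g \<psi>\<rbrakk> \<Longrightarrow> stricts s t (f \<boxplus> g) (sadd \<phi> \<psi>)"
  by (auto simp: stricts_def Add_Cmp' Cmp_Add')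

lemma stricts_Zro: "\<lbrakk>tobj s = X; tobj t = Y\<rbrakk> \<Longrightarrow> stricts s t (Zro C X Y) (szero (flat s) (flat t))"
  by (auto simp: stricts_def)

lemma Neg_Cmp: "\<lbrakk>f \<in> Arr C; g \<in> Arr C; Cod C f = Dom C g\<rbrakk> \<Longrightarrow> Neg g \<cdot> f = Neg (g \<cdot> f)"
  by (rule Neg_unique) (simp_all flip: Add_Cmp')

lemma stricts_Neg: "stricts s t f \<phi> \<Longrightarrow> stricts s t (Neg f) (sneg \<phi>)"
  by (auto simp: stricts_def Neg_Cmp Cmp_Neg)

end

section \<open>Strict braided categories\<close>

text \<open>Stated as an interface because it has two kinds of instances, the strict arrows and the
  mirror image. With words as objects, associativity and unit laws of the tensor product are literal
  equations.\<close>

locale strict_braided =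
  fixes dom :: "'s \<Rightarrow> 'o list" and cod :: "'s \<Rightarrow> 'o list" and arr :: "'s \<Rightarrow> bool"
    and ide :: "'o list \<Rightarrow> 's"
    and comp :: "'s \<Rightarrow> 's \<Rightarrow> 's" (infixr "\<bullet>" 70)
    and ten :: "'s \<Rightarrow> 's \<Rightarrow> 's" (infixr "\<odot>" 75)
    and zero :: "'o list \<Rightarrow> 'o list \<Rightarrow> 's"
    and add :: "'s \<Rightarrow> 's \<Rightarrow> 's" (infixl "\<oplus>" 65)
    and neg :: "'s \<Rightarrow> 's"
    and brd :: "'o list \<Rightarrow> 'o list \<Rightarrow> 's"
  assumes dom_simps [simp]: "\<And>g f. dom (g \<bullet> f) = dom f" "\<And>f g. dom (f \<odot> g) = dom f @ dom g"
      "\<And>f g. dom (f \<oplus> g) = dom f" "\<And>f. dom (neg f) = dom f" "\<And>xs. dom (ide xs) = xs"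
      "\<And>xs ys. dom (zero xs ys) = xs" "\<And>xs ys. dom (brd xs ys) = xs @ ys"
    and cod_simps [simp]: "\<And>g f. cod (g \<bullet> f) = cod g" "\<And>f g. cod (f \<odot> g) = cod f @ cod g"
      "\<And>f g. cod (f \<oplus> g) = cod f" "\<And>f. cod (neg f) = cod f" "\<And>xs. cod (ide xs) = xs"
      "\<And>xs ys. cod (zero xs ys) = ys" "\<And>xs ys. cod (brd xs ys) = ys @ xs"
    and arr_simps [simp]: "\<And>g f. arr (g \<bullet> f)" "\<And>f g. arr (f \<odot> g)"
      "\<And>f g. arr (f \<oplus> g)" "\<And>f. arr (neg f)" "\<And>xs. arr (ide xs)"
      "\<And>xs ys. arr (zero xs ys)" "\<And>xs ys. arr (brd xs ys)"
    and comp_assoc: "\<And>f g h. (h \<bullet> g) \<bullet> f = h \<bullet> g \<bullet> f"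
    and comp_ide [simp]: "\<And>f xs. arr f \<Longrightarrow> dom f = xs \<Longrightarrow> f \<bullet> ide xs = f"
    and ide_comp [simp]: "\<And>f xs. arr f \<Longrightarrow> cod f = xs \<Longrightarrow> ide xs \<bullet> f = f"
    and ten_assoc: "\<And>f g h. (f \<odot> g) \<odot> h = f \<odot> g \<odot> h"
    and ten_ide: "\<And>xs ys. ide xs \<odot> ide ys = ide (xs @ ys)"
    and ten_unit [simp]: "\<And>f. arr f \<Longrightarrow> f \<odot> ide [] = f" "\<And>f. arr f \<Longrightarrow> ide [] \<odot> f = f"
    and ten_comp: "\<And>f f' g g'. cod f = dom g \<Longrightarrow> cod f' = dom g'
      \<Longrightarrow> (g \<odot> g') \<bullet> (f \<odot> f') = (g \<bullet> f) \<odot> (g' \<bullet> f')"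
    and brd_nat: "\<And>f g. brd (cod f) (cod g) \<bullet> (f \<odot> g) = (g \<odot> f) \<bullet> brd (dom f) (dom g)"
    and brd_app_right: "\<And>xs ys zs. brd xs (ys @ zs) = (ide ys \<odot> brd xs zs) \<bullet> (brd xs ys \<odot> ide zs)"
    and brd_app_left: "\<And>xs ys zs. brd (xs @ ys) zs = (brd xs zs \<odot> ide ys) \<bullet> (ide xs \<odot> brd ys zs)"
    and brd_Nil [simp]: "\<And>xs. brd [] xs = ide xs" "\<And>xs. brd xs [] = ide xs"
    and add_assoc: "\<And>f g h. \<lbrakk>dom f = dom g; cod f = cod g; dom g = dom h; cod g = cod h\<rbrakk>
      \<Longrightarrow> (f \<oplus> g) \<oplus> h = f \<oplus> (g \<oplus> h)"
    and add_commute: "\<And>f g. \<lbrakk>dom f = dom g; cod f = cod g\<rbrakk> \<Longrightarrow> f \<oplus> g = g \<oplus> f"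
    and add_zero [simp]: "\<And>f xs ys. \<lbrakk>arr f; dom f = xs; cod f = ys\<rbrakk> \<Longrightarrow> f \<oplus> zero xs ys = f"
    and add_neg [simp]: "\<And>f. f \<oplus> neg f = zero (dom f) (cod f)"
    and comp_add: "\<And>f f' g. \<lbrakk>dom f = dom f'; cod f = cod f'\<rbrakk> \<Longrightarrow> g \<bullet> (f \<oplus> f') = g \<bullet> f \<oplus> g \<bullet> f'"
    and add_comp: "\<And>f g g'. \<lbrakk>dom g = dom g'; cod g = cod g'\<rbrakk> \<Longrightarrow> (g \<oplus> g') \<bullet> f = g \<bullet> f \<oplus> g' \<bullet> f"
    and ten_add: "\<And>f f' g. \<lbrakk>dom f = dom f'; cod f = cod f'\<rbrakk> \<Longrightarrow> g \<odot> (f \<oplus> f') = g \<odot> f \<oplus> g \<odot> f'"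
    and add_ten: "\<And>f g g'. \<lbrakk>dom g = dom g'; cod g = cod g'\<rbrakk> \<Longrightarrow> (g \<oplus> g') \<odot> f = g \<odot> f \<oplus> g' \<odot> f"

text \<open>The mirror image exchanges statements about \<open>\<Lambda> \<otimes> B\<close> with statements about \<open>B \<otimes> \<Lambda>\<close>.\<close>

lemma (in strict_braided) mirror:
  "strict_braided (\<lambda>f. rev (dom f)) (\<lambda>f. rev (cod f)) arr (\<lambda>xs. ide (rev xs)) comp (\<lambda>f g. ten g f)
     (\<lambda>xs ys. zero (rev xs) (rev ys)) add neg (\<lambda>xs ys. brd (rev ys) (rev xs))"
  by unfold_locales
    (auto simp: comp_assoc ten_assoc ten_ide ten_comp brd_nat brd_app_left brd_app_right add_assoc
      comp_add add_comp ten_add add_ten intro: add_commute)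

section \<open>The laws of a strict braided category for strict arrows\<close>

context abelian_braided_category
begin

text \<open>Lets laws without typing conditions be derived from \<open>stricts\<close>, which speaks
  of valid triples. Operations such as \<open>sten\<close> read their arguments through
  \<open>val\<close> and do not notice the replacement.\<close>

definition normal :: "('a, 'b) sarr \<Rightarrow> ('a, 'b) sarr" where
  "normal f = SArr (sdom f) (val f) (scod f)"

lemma normal_simps [simp]: "valid (normal f)" "sdom (normal f) = sdom f" "scod (normal f) = scod f" "val (normal f) = val f"
  by (simp_all add: normal_def)

lemma stricts_normal: "stricts (Li (sdom f)) (Li (scod f)) (val f) (normal f)"
  using stricts_val[of "normal f"] by simp

lemma sten_normal: "sten (normal f) g = sten f g" "sten f (normal g) = sten f g"
  by (simp_all add: sten_def)

lemma scomp_sid: "valid f \<Longrightarrow> sdom f = xs \<Longrightarrow> scomp f (sid xs) = f"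
  and sid_scomp: "valid f \<Longrightarrow> scod f = xs \<Longrightarrow> scomp (sid xs) f = f"
  by (auto intro!: valid_eqI)

text \<open>Naturality of the associator, read with both of its instances replaced by
  identities.\<close>

lemma sten_assoc: "sten (sten f g) h = sten f (sten g h)"
proof -
  let ?n = normal and ?A = "Asc C (nest (scod f)) (nest (scod g)) (nest (scod h))"
    and ?B = "Asc C (nest (sdom f)) (nest (sdom g)) (nest (sdom h))"
  let ?s = "Tn (Tn (Li (sdom f)) (Li (sdom g))) (Li (sdom h))"
    and ?t = "Tn (Li (scod f)) (Tn (Li (scod g)) (Li (scod h)))"
  have "stricts ?s ?t (?A \<cdot> ((val f \<boxtimes> val g) \<boxtimes> val h))
      (scomp (sid (scod f @ scod g @ scod h)) (sten (sten (?n f) (?n g)) (?n h)))"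
    by (rule stricts_Cmp stricts_TenA stricts_normal)+
      (rule stricts_Asc[of "Li _" _ "Li _" _ "Li _", unfolded flat.simps]; simp)
  moreover have "stricts ?s ?t ((val f \<boxtimes> (val g \<boxtimes> val h)) \<cdot> ?B)
      (scomp (sten (?n f) (sten (?n g) (?n h))) (sid (sdom f @ sdom g @ sdom h)))"
    by (rule stricts_Cmp, rule stricts_Asc[of "Li _" _ "Li _" _ "Li _", unfolded flat.simps])
      (simp_all add: stricts_TenA stricts_normal)
  ultimately show ?thesis
    by (simp add: Asc_nat) (drule (1) stricts_fun, simp add: sten_normal scomp_sid sid_scomp)
qed

lemma sbrd_nat: "scomp (sbrd (scod f) (scod g)) (sten f g) = scomp (sten g f) (sbrd (sdom f) (sdom g))"
proof -
  let ?s = "Tn (Li (sdom f)) (Li (sdom g))" and ?t = "Tn (Li (scod g)) (Li (scod f))"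
  have "stricts ?s ?t (Brd C (nest (scod f)) (nest (scod g)) \<cdot> (val f \<boxtimes> val g))
      (scomp (sbrd (scod f) (scod g)) (sten (normal f) (normal g)))"
    by (rule stricts_Cmp stricts_TenA stricts_normal)+
      (rule stricts_Brd[of "Li _" _ "Li _", unfolded flat.simps]; simp)
  moreover have "stricts ?s ?t ((val g \<boxtimes> val f) \<cdot> Brd C (nest (sdom f)) (nest (sdom g)))
      (scomp (sten (normal g) (normal f)) (sbrd (sdom f) (sdom g)))"
    by (rule stricts_Cmp, rule stricts_Brd[of "Li _" _ "Li _", unfolded flat.simps])
      (simp_all add: stricts_TenA stricts_normal)
  ultimately show ?thesis
    by (simp add: Brd_nat) (drule (1) stricts_fun, simp add: sten_normal)
qed

lemmas stricts_rules = stricts_Cmp stricts_TenA stricts_Asc stricts_Brd stricts_Ide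
  stricts_Inv[OF stricts_Asc Asc_iso] stricts_Inv[OF stricts_Lun Lun_iso] stricts_Inv[OF stricts_Run Run_iso]
  stricts_Lun stricts_Run

text \<open>The two hexagons: their associators become identities, and only the braidings
  remain.\<close>

lemma sbrd_append:
  "sbrd xs (ys @ zs) = scomp (sten (sid ys) (sbrd xs zs)) (sten (sbrd xs ys) (sid zs))"
  "sbrd (xs @ ys) zs = scomp (sten (sbrd xs zs) (sid ys)) (sten (sid xs) (sbrd ys zs))"
proof -
  let ?x = "Li xs" and ?y = "Li ys" and ?z = "Li zs" and ?X = "nest xs" and ?Y = "nest ys" and ?Z = "nest zs"
  let ?v = "\<lambda>a b c. flat a @ flat b @ flat c"
  have "stricts (Tn (Tn ?x ?y) ?z) (Tn ?y (Tn ?z ?x)) (Asc C ?Y ?Z ?X \<cdot> Brd C ?X (?Y \<boxdot> ?Z) \<cdot> Asc C ?X ?Y ?Z)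
     (scomp (sid (?v ?y ?z ?x)) (scomp (sbrd (flat ?x) (flat (Tn ?y ?z))) (sid (?v ?x ?y ?z))))"
    by (rule stricts_rules | simp; fail)+
  moreover have "stricts (Tn (Tn ?x ?y) ?z) (Tn ?y (Tn ?z ?x))
     ((Ide C ?Y \<boxtimes> Brd C ?X ?Z) \<cdot> Asc C ?Y ?X ?Z \<cdot> (Brd C ?X ?Y \<boxtimes> Ide C ?Z))
     (scomp (sten (sid (flat ?y)) (sbrd (flat ?x) (flat ?z))) (scomp (sid (?v ?y ?x ?z))
       (sten (sbrd (flat ?x) (flat ?y)) (sid (flat ?z)))))"
    by (rule stricts_rules | simp; fail)+
  ultimately show "sbrd xs (ys @ zs) = scomp (sten (sid ys) (sbrd xs zs)) (sten (sbrd xs ys) (sid zs))"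
    by (simp add: hexagon1) (drule (1) stricts_fun, simp add: scomp_sid sid_scomp)
  have "stricts (Tn ?x (Tn ?y ?z)) (Tn (Tn ?z ?x) ?y)
     (Inv C (Asc C ?Z ?X ?Y) \<cdot> Brd C (?X \<boxdot> ?Y) ?Z \<cdot> Inv C (Asc C ?X ?Y ?Z))
     (scomp (sid (?v ?z ?x ?y)) (scomp (sbrd (flat (Tn ?x ?y)) (flat ?z)) (sid (?v ?x ?y ?z))))"
    by (rule stricts_rules | simp; fail)+
  moreover have "stricts (Tn ?x (Tn ?y ?z)) (Tn (Tn ?z ?x) ?y)
     ((Brd C ?X ?Z \<boxtimes> Ide C ?Y) \<cdot> Inv C (Asc C ?X ?Z ?Y) \<cdot> (Ide C ?X \<boxtimes> Brd C ?Y ?Z))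
     (scomp (sten (sbrd (flat ?x) (flat ?z)) (sid (flat ?y))) (scomp (sid (?v ?x ?z ?y))
       (sten (sid (flat ?x)) (sbrd (flat ?y) (flat ?z)))))"
    by (rule stricts_rules | simp; fail)+
  ultimately show "sbrd (xs @ ys) zs = scomp (sten (sbrd xs zs) (sid ys)) (sten (sid xs) (sbrd ys zs))"
    by (simp add: hexagon2) (drule (1) stricts_fun, simp add: scomp_sid sid_scomp)
qed

lemma sten_sid: "sten (sid xs) (sid ys) = sid (xs @ ys)"
  by (auto intro!: valid_eqI)

lemma sten_Nil: "valid f \<Longrightarrow> sten f (sid []) = f" "valid f \<Longrightarrow> sten (sid []) f = f"
  by (auto intro!: valid_eqI simp: mu_Nil Run_nat Lun_nat simp flip: Cmp_assoc')
    (simp_all add: Cmp_assoc')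

lemma sten_comp:
  assumes "scod f = sdom g" "scod f' = sdom g'"
  shows "scomp (sten g g') (sten f f') = sten (scomp g f) (scomp g' f')"
proof (rule valid_eqI)
  have "Inv C (mu (sdom g) (sdom g')) \<cdot> mu (sdom g) (sdom g') \<cdot> (val f \<boxtimes> val f') \<cdot> Inv C (mu (sdom f) (sdom f'))
      = (val f \<boxtimes> val f') \<cdot> Inv C (mu (sdom f) (sdom f'))"
    using assms by (simp flip: Cmp_assoc')
  then show "val (scomp (sten g g') (sten f f')) = val (sten (scomp g f) (scomp g' f'))"
    using assms by (simp add: Cmp_assoc' interchange_Cmp)
qed (use assms in simp_all)

lemma scomp_assoc: "scomp (scomp h g) f = scomp h (scomp g f)"
  by (cases "scod f = sdom g"; cases "scod g = sdom h") (auto intro!: valid_eqI simp: Cmp_assoc')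

lemma sbrd_iso: "\<lbrakk>scomp f (sbrd xs ys) = scomp g (sbrd xs ys); valid f; valid g; sdom f = ys @ xs;
    sdom g = ys @ xs; scod f = scod g\<rbrakk> \<Longrightarrow> f = g"
  by (rule valid_eqI) (auto dest!: arg_cong[of _ _ val] intro: iso_cancel_right
    [of "mu ys xs \<cdot> Brd C (nest xs) (nest ys) \<cdot> Inv C (mu xs ys)"])

text \<open>By the hexagons, the braiding with the empty word is an idempotent isomorphism.\<close>

lemma sbrd_Nil: "sbrd [] xs = sid xs" "sbrd xs [] = sid xs"
proof -
  show "sbrd [] xs = sid xs"
    by (rule sbrd_iso[of _ "[]" xs]) (use sbrd_append(2)[of "[]" "[]" xs] in \<open>simp_all add: sten_Nil sid_scomp\<close>)
  show "sbrd xs [] = sid xs"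
    by (rule sbrd_iso[of _ xs "[]"]) (use sbrd_append(1)[of xs "[]" "[]"] in \<open>simp_all add: sten_Nil sid_scomp\<close>)
qed

lemma sadd_rules:
  "\<lbrakk>sdom f = sdom g; scod f = scod g; sdom g = sdom h; scod g = scod h\<rbrakk> \<Longrightarrow> sadd (sadd f g) h = sadd f (sadd g h)"
  "\<lbrakk>valid f; sdom f = xs; scod f = ys\<rbrakk> \<Longrightarrow> sadd f (szero xs ys) = f"
  "sadd f (sneg f) = szero (sdom f) (scod f)"
  by (auto intro!: valid_eqI simp: Add_assoc)

lemma sadd_commute: "\<lbrakk>sdom f = sdom g; scod f = scod g\<rbrakk> \<Longrightarrow> sadd f g = sadd g f"
  by (auto intro!: valid_eqI simp: Add_commute)

lemma scomp_sadd: "\<lbrakk>sdom f = sdom f'; scod f = scod f'\<rbrakk> \<Longrightarrow> scomp g (sadd f f') = sadd (scomp g f) (scomp g f')"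
  by (cases "scod f = sdom g") (auto intro!: valid_eqI simp: Cmp_Add')

lemma sadd_scomp: "\<lbrakk>sdom g = sdom g'; scod g = scod g'\<rbrakk> \<Longrightarrow> scomp (sadd g g') f = sadd (scomp g f) (scomp g' f)"
  by (cases "scod f = sdom g") (auto intro!: valid_eqI simp: Add_Cmp')

lemma sten_sadd: "\<lbrakk>sdom f = sdom f'; scod f = scod f'\<rbrakk> \<Longrightarrow> sten g (sadd f f') = sadd (sten g f) (sten g f')"
    "\<lbrakk>sdom f = sdom f'; scod f = scod f'\<rbrakk> \<Longrightarrow> sten (sadd f f') g = sadd (sten f g) (sten f' g)"
  by (auto intro!: valid_eqI simp: TenA_Add_left' TenA_Add_right' Cmp_Add' Add_Cmp')

lemma strictification:
  "strict_braided sdom scod valid sid scomp sten szero sadd sneg sbrd"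
  by unfold_locales
    (simp_all add: scomp_assoc scomp_sid sid_scomp sten_assoc sten_sid sten_Nil sten_comp sbrd_nat sbrd_append(1)
      sbrd_Nil sadd_rules scomp_sadd sadd_scomp sten_sadd, simp_all only: sbrd_append, rule sadd_commute)

end

section \<open>Signs, whiskering and braided products\<close>

context strict_braided
begin

lemma zero_add [simp]: "\<lbrakk>arr f; dom f = xs; cod f = ys\<rbrakk> \<Longrightarrow> zero xs ys \<oplus> f = f"
  by (subst add_commute) simp_all

lemma add_idem_zero: "\<lbrakk>arr f; f \<oplus> f = f\<rbrakk> \<Longrightarrow> f = zero (dom f) (cod f)"
  by (metis add_assoc add_neg add_zero dom_simps(4) cod_simps(4))

lemma comp_zero [simp]: "g \<bullet> zero xs ys = zero xs (cod g)"
  using add_idem_zero[of "g \<bullet> zero xs ys"] comp_add[of "zero xs ys" "zero xs ys" g] by simp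

lemma zero_comp [simp]: "zero xs ys \<bullet> f = zero (dom f) ys"
  using add_idem_zero[of "zero xs ys \<bullet> f"] add_comp[of "zero xs ys" "zero xs ys" f] by simp

lemma ten_zero [simp]: "f \<odot> zero xs ys = zero (dom f @ xs) (cod f @ ys)"
  using add_idem_zero[of "f \<odot> zero xs ys"] ten_add[of "zero xs ys" "zero xs ys" f] by simp

lemma zero_ten [simp]: "zero xs ys \<odot> f = zero (xs @ dom f) (ys @ cod f)"
  using add_idem_zero[of "zero xs ys \<odot> f"] add_ten[of "zero xs ys" "zero xs ys" f] by simp

lemma neg_unique:
  assumes "arr g" "dom f = dom g" "cod f = cod g" "f \<oplus> g = zero (dom f) (cod f)"
  shows "g = neg f"
proof -
  have "g = g \<oplus> (f \<oplus> neg f)" using assms by simp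
  also have "\<dots> = (g \<oplus> f) \<oplus> neg f" by (rule add_assoc[symmetric]) (use assms in simp_all)
  also have "\<dots> = (f \<oplus> g) \<oplus> neg f" using assms(2,3) by (simp add: add_commute)
  finally show ?thesis using assms by simp
qed

lemma neg_neg [simp]: "arr f \<Longrightarrow> neg (neg f) = f"
  using neg_unique[of f "neg f"] add_commute[of "neg f" f] by simp

lemma comp_neg: "g \<bullet> neg f = neg (g \<bullet> f)"
  by (rule neg_unique) (simp_all flip: comp_add)

lemma neg_comp: "neg g \<bullet> f = neg (g \<bullet> f)"
  by (rule neg_unique) (simp_all flip: add_comp)

lemma ten_neg: "g \<odot> neg f = neg (g \<odot> f)"
  by (rule neg_unique) (simp_all flip: ten_add)

lemma neg_ten: "neg g \<odot> f = neg (g \<odot> f)"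
  by (rule neg_unique) (simp_all flip: add_ten)

lemma neg_zero: "neg (zero xs ys) = zero xs ys"
  by (rule neg_unique[symmetric]) simp_all

lemma neg_add:
  assumes "arr f" "arr g" "dom f = dom g" "cod f = cod g"
  shows "neg (f \<oplus> g) = neg f \<oplus> neg g"
proof (rule neg_unique[symmetric])
  have "(f \<oplus> g) \<oplus> (neg f \<oplus> neg g) = (g \<oplus> f) \<oplus> (neg f \<oplus> neg g)"
    using assms by (simp add: add_commute)
  also have "\<dots> = g \<oplus> ((f \<oplus> neg f) \<oplus> neg g)"
    using assms by (simp only: add_assoc dom_simps cod_simps)
  finally show "(f \<oplus> g) \<oplus> (neg f \<oplus> neg g) = zero (dom (f \<oplus> g)) (cod (f \<oplus> g))"
    using assms by simp
qed (use assms in simp_all)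

definition sg :: "nat \<Rightarrow> 's \<Rightarrow> 's" where
  "sg n f = (if even n then f else neg f)"

lemma sg_simps [simp]: "dom (sg n f) = dom f" "cod (sg n f) = cod f" "arr f \<Longrightarrow> arr (sg n f)"
  by (simp_all add: sg_def)

lemma sg_0: "sg 0 f = f" by (simp add: sg_def)

lemma comp_sg: "g \<bullet> sg n f = sg n (g \<bullet> f)"
  and sg_comp: "sg n g \<bullet> f = sg n (g \<bullet> f)"
  and ten_sg: "g \<odot> sg n f = sg n (g \<odot> f)"
  and sg_ten: "sg n g \<odot> f = sg n (g \<odot> f)"
  and sg_zero: "sg n (zero xs ys) = zero xs ys"
  by (simp_all add: sg_def comp_neg neg_comp ten_neg neg_ten neg_zero)

lemma sg_add: "\<lbrakk>arr f; arr g; dom f = dom g; cod f = cod g\<rbrakk> \<Longrightarrow> sg n (f \<oplus> g) = sg n f \<oplus> sg n g"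
  by (simp add: sg_def neg_add)

lemma sg_sg: "arr f \<Longrightarrow> sg k (sg n f) = sg (k + n) f"
  by (simp add: sg_def)

lemma sg_cong: "even k = even n \<Longrightarrow> sg k f = sg n f"
  by (simp add: sg_def)

lemmas sg_rules = comp_sg sg_comp ten_sg sg_ten sg_sg

lemma ide_append: "ide (xs @ ys) = ide xs \<odot> ide ys"
  by (simp add: ten_ide)

lemma ten_ide_ten: "ide xs \<odot> ide ys \<odot> f = ide (xs @ ys) \<odot> f"
  by (simp add: ten_ide flip: ten_assoc)

text \<open>One layer of a string diagram. Long composites are compared by cutting them into layers
  and exchanging neighbours that act on disjoint positions.\<close>

definition whisker :: "'o list \<Rightarrow> 's \<Rightarrow> 'o list \<Rightarrow> 's" where
  "whisker xs f ys = ide xs \<odot> f \<odot> ide ys"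

lemma whisker_simps [simp]: "dom (whisker xs f ys) = xs @ dom f @ ys" "cod (whisker xs f ys) = xs @ cod f @ ys" "arr (whisker xs f ys)"
    "arr f \<Longrightarrow> whisker [] f [] = f" "whisker xs (ide us) ys = ide (xs @ us @ ys)"
    "whisker xs (whisker us f vs) ys = whisker (xs @ us) f (vs @ ys)"
  by (simp_all add: whisker_def ide_append ten_assoc)

lemma whisker_comp: "cod f = dom g \<Longrightarrow> whisker xs (g \<bullet> f) ys = whisker xs g ys \<bullet> whisker xs f ys"
  by (simp add: whisker_def ten_comp)

lemma ten_wh: "\<lbrakk>arr f; arr g\<rbrakk> \<Longrightarrow> f \<odot> g = whisker [] f (cod g) \<bullet> whisker (dom f) g []"
  by (simp add: whisker_def ten_comp)

lemma whisker_exchange: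
  assumes "arr f" "arr g"
  shows "whisker (xs @ cod g @ us) f zs \<bullet> whisker xs g (us @ dom f @ zs)
    = whisker xs g (us @ cod f @ zs) \<bullet> whisker (xs @ dom g @ us) f zs"
  using assms by (simp add: whisker_def ide_append ten_assoc ten_comp)

lemma brd_ten: "\<lbrakk>dom f = us; cod f = xs; dom g = vs; cod g = ys\<rbrakk>
    \<Longrightarrow> brd xs ys \<bullet> (f \<odot> g) = (g \<odot> f) \<bullet> brd us vs"
  using brd_nat[of f g] by simp

lemmas layers = ten_wh whisker_comp comp_assoc

text \<open>Counterpart of \<open>braided_mult\<close>. The factors are words, so a braided product
  can itself be a factor of another one.\<close>

definition bmult :: "'o list \<Rightarrow> 'o list \<Rightarrow> 'o list \<Rightarrow> 'o list \<Rightarrow> 's \<Rightarrow> 's \<Rightarrow> 's" where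
  "bmult X Y X' Y' f g = (f \<odot> g) \<bullet> (ide X \<odot> brd Y X' \<odot> ide Y')"

lemma bmult_simps [simp]: "dom (bmult X Y X' Y' f g) = X @ Y @ X' @ Y'" "cod (bmult X Y X' Y' f g) = cod f @ cod g"
    "arr (bmult X Y X' Y' f g)"
  by (simp_all add: bmult_def)

lemma comp_bmult: "\<lbrakk>dom h = cod f; dom k = cod g\<rbrakk> \<Longrightarrow> (h \<odot> k) \<bullet> bmult X Y X' Y' f g = bmult X Y X' Y' (h \<bullet> f) (k \<bullet> g)"
  by (simp add: bmult_def ten_comp flip: comp_assoc)

text \<open>Naturality of the braiding carries \<open>k\<close> and \<open>h'\<close> through the
  middle crossing.\<close>

lemma bmult_comp:
  assumes "arr h" "arr k'" "dom h = X" "cod h = X1" "dom k = Y" "cod k = Y1"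
    "dom h' = X'" "cod h' = X1'" "dom k' = Y'" "cod k' = Y1'" "dom f = X1 @ X1'" "dom g = Y1 @ Y1'"
  shows "bmult X1 Y1 X1' Y1' f g \<bullet> (h \<odot> k \<odot> h' \<odot> k') = bmult X Y X' Y' (f \<bullet> (h \<odot> h')) (g \<bullet> (k \<odot> k'))"
proof -
  have "(ide X1 \<odot> brd Y1 X1' \<odot> ide Y1') \<bullet> (h \<odot> (k \<odot> h') \<odot> k')
      = (h \<odot> (h' \<odot> k) \<odot> k') \<bullet> (ide X \<odot> brd Y X' \<odot> ide Y')"
    using assms by (simp add: ten_comp brd_ten)
  moreover have "(f \<odot> g) \<bullet> ((h \<odot> h') \<odot> (k \<odot> k')) = (f \<bullet> (h \<odot> h')) \<odot> (g \<bullet> (k \<odot> k'))"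
    using assms by (simp only: ten_comp dom_simps cod_simps)
  ultimately show ?thesis
    unfolding bmult_def by (simp add: ten_assoc comp_assoc) (simp flip: comp_assoc)
qed

text \<open>By the hexagons both sides consist of the crossings of \<open>Y\<close> with
  \<open>X'\<close>, of \<open>Z\<close> with \<open>X'\<close> and of \<open>Z\<close> with
  \<open>Y'\<close>. They differ in the order of the first and the last, which act on disjoint
  positions.\<close>

lemma bmult_bmult_assoc:
  assumes "dom f = X @ X'" "dom g = Y @ Y'" "dom h = Z @ Z'" "arr f" "arr g" "arr h"
  shows "bmult (X @ Y) Z (X' @ Y') Z' (bmult X Y X' Y' f g) h = bmult X (Y @ Z) X' (Y' @ Z') f (bmult Y Z Y' Z' g h)"
proof -
  have e1: "((f \<odot> g) \<bullet> (ide X \<odot> brd Y X' \<odot> ide Y')) \<odot> h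
      = ((f \<odot> g) \<odot> h) \<bullet> ((ide X \<odot> brd Y X' \<odot> ide Y') \<odot> ide (Z @ Z'))"
    and e2: "f \<odot> ((g \<odot> h) \<bullet> (ide Y \<odot> brd Z Y' \<odot> ide Z'))
      = (f \<odot> (g \<odot> h)) \<bullet> (ide (X @ X') \<odot> (ide Y \<odot> brd Z Y' \<odot> ide Z'))"
    using assms by (simp_all add: ten_comp)
  have "bmult (X @ Y) Z (X' @ Y') Z' (bmult X Y X' Y' f g) h = (f \<odot> g \<odot> h)
      \<bullet> whisker X (brd Y X') (Y' @ Z @ Z') \<bullet> whisker (X @ Y) (brd Z (X' @ Y')) Z'"
    unfolding bmult_def whisker_def e1 by (simp add: comp_assoc ten_assoc ide_append)
  also have "\<dots> = (f \<odot> g \<odot> h) \<bullet> (whisker X (brd Y X') (Y' @ Z @ Z') \<bullet> whisker (X @ Y @ X') (brd Z Y') Z')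
      \<bullet> whisker (X @ Y) (brd Z X') (Y' @ Z')"
    by (simp add: brd_app_right layers)
  also have "whisker X (brd Y X') (Y' @ Z @ Z') \<bullet> whisker (X @ Y @ X') (brd Z Y') Z'
      = whisker (X @ X' @ Y) (brd Z Y') Z' \<bullet> whisker X (brd Y X') (Z @ Y' @ Z')"
    using whisker_exchange[of "brd Z Y'" "brd Y X'" X "[]" Z'] by simp
  also have "(f \<odot> g \<odot> h) \<bullet> (\<dots>) \<bullet> whisker (X @ Y) (brd Z X') (Y' @ Z')
      = (f \<odot> g \<odot> h) \<bullet> whisker (X @ X' @ Y) (brd Z Y') Z' \<bullet> whisker X (brd (Y @ Z) X') (Y' @ Z')"
    by (simp add: brd_app_left layers)
  also have "\<dots> = bmult X (Y @ Z) X' (Y' @ Z') f (bmult Y Z Y' Z' g h)"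
    unfolding bmult_def whisker_def e2 by (simp add: comp_assoc ten_assoc ide_append)
  finally show ?thesis .
qed

text \<open>Associativity of a braided tensor product of algebras, with a separate arrow for each
  component so that graded products are covered. Both sides contain the crossings of
  \<open>Y1\<close> with \<open>X2\<close>, of \<open>Y1\<close> with \<open>X3\<close> and of
  \<open>Y2\<close> with \<open>X3\<close>; the first and the last are disjoint and change
  order.\<close>

lemma bmult_assoc:
  assumes f: "f \<bullet> (f12 \<odot> ide X3) = f' \<bullet> (ide X1 \<odot> f23)" and g: "g \<bullet> (g12 \<odot> ide Y3) = g' \<bullet> (ide Y1 \<odot> g23)"
    and "dom f12 = X1 @ X2" "cod f12 = X12" "dom f23 = X2 @ X3" "cod f23 = X23" "dom f = X12 @ X3" "dom f' = X1 @ X23"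
    and "dom g12 = Y1 @ Y2" "cod g12 = Y12" "dom g23 = Y2 @ Y3" "cod g23 = Y23" "dom g = Y12 @ Y3" "dom g' = Y1 @ Y23"
    and "arr f12" "arr f23" "arr g12" "arr g23"
  shows "bmult X12 Y12 X3 Y3 f g \<bullet> (bmult X1 Y1 X2 Y2 f12 g12 \<odot> ide (X3 @ Y3))
    = bmult X1 Y1 X23 Y23 f' g' \<bullet> (ide (X1 @ Y1) \<odot> bmult X2 Y2 X3 Y3 f23 g23)"
proof -
  let ?F = "f \<bullet> (f12 \<odot> ide X3)" and ?G = "g \<bullet> (g12 \<odot> ide Y3)"
  have e1: "((f12 \<odot> g12) \<bullet> (ide X1 \<odot> brd Y1 X2 \<odot> ide Y2)) \<odot> ide (X3 @ Y3)
      = ((f12 \<odot> g12) \<odot> ide (X3 @ Y3)) \<bullet> ((ide X1 \<odot> brd Y1 X2 \<odot> ide Y2) \<odot> ide (X3 @ Y3))"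
    and e2: "ide (X1 @ Y1) \<odot> ((f23 \<odot> g23) \<bullet> (ide X2 \<odot> brd Y2 X3 \<odot> ide Y3))
      = (ide (X1 @ Y1) \<odot> (f23 \<odot> g23)) \<bullet> (ide (X1 @ Y1) \<odot> (ide X2 \<odot> brd Y2 X3 \<odot> ide Y3))"
    using assms(3-) by (simp_all add: ten_comp)
  have "bmult X12 Y12 X3 Y3 f g \<bullet> (bmult X1 Y1 X2 Y2 f12 g12 \<odot> ide (X3 @ Y3))
      = (bmult X12 Y12 X3 Y3 f g \<bullet> (f12 \<odot> g12 \<odot> ide X3 \<odot> ide Y3)) \<bullet> whisker X1 (brd Y1 X2) (Y2 @ X3 @ Y3)"
    unfolding bmult_def[of X1] whisker_def e1 by (simp add: comp_assoc ten_assoc ide_append)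
  also have "\<dots> = (?F \<odot> ?G) \<bullet> whisker (X1 @ X2) (brd (Y1 @ Y2) X3) Y3 \<bullet> whisker X1 (brd Y1 X2) (Y2 @ X3 @ Y3)"
    using assms(3-) by (simp add: bmult_comp) (simp add: bmult_def whisker_def comp_assoc)
  also have "\<dots> = (?F \<odot> ?G) \<bullet> whisker (X1 @ X2) (brd Y1 X3) (Y2 @ Y3)
      \<bullet> whisker (X1 @ X2 @ Y1) (brd Y2 X3) Y3 \<bullet> whisker X1 (brd Y1 X2) (Y2 @ X3 @ Y3)"
    by (simp add: brd_app_left layers)
  also have "whisker (X1 @ X2 @ Y1) (brd Y2 X3) Y3 \<bullet> whisker X1 (brd Y1 X2) (Y2 @ X3 @ Y3)
      = whisker X1 (brd Y1 X2) (X3 @ Y2 @ Y3) \<bullet> whisker (X1 @ Y1 @ X2) (brd Y2 X3) Y3"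
    using whisker_exchange[of "brd Y2 X3" "brd Y1 X2" X1 "[]" Y3] by simp
  also have "(?F \<odot> ?G) \<bullet> whisker (X1 @ X2) (brd Y1 X3) (Y2 @ Y3) \<bullet> \<dots>
      = (?F \<odot> ?G) \<bullet> whisker X1 (brd Y1 (X2 @ X3)) (Y2 @ Y3) \<bullet> whisker (X1 @ Y1 @ X2) (brd Y2 X3) Y3"
    by (simp add: brd_app_right layers)
  also have "\<dots> = (bmult X1 Y1 X23 Y23 f' g' \<bullet> (ide X1 \<odot> ide Y1 \<odot> f23 \<odot> g23)) \<bullet> whisker (X1 @ Y1 @ X2) (brd Y2 X3) Y3"
    unfolding f g using assms(3-) by (simp add: bmult_comp) (simp add: bmult_def whisker_def comp_assoc)
  also have "\<dots> = bmult X1 Y1 X23 Y23 f' g' \<bullet> (ide (X1 @ Y1) \<odot> bmult X2 Y2 X3 Y3 f23 g23)"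
    unfolding bmult_def[of X2] whisker_def e2 by (simp add: comp_assoc ten_assoc ide_append)
  finally show ?thesis .
qed

end

section \<open>Jointly epic families\<close>

context strict_braided
begin

text \<open>The words \<open>us\<close> and \<open>vs\<close> build stability under tensoring into
  the notion, which is what lets tensor products of such families be cancelled.\<close>

definition jointly_epic :: "'s set \<Rightarrow> 'o list \<Rightarrow> bool" where
  "jointly_epic F xs \<longleftrightarrow> (\<forall>e\<in>F. arr e \<and> cod e = xs) \<and>
     (\<forall>f g us vs. arr f \<longrightarrow> arr g \<longrightarrow> dom f = us @ xs @ vs \<longrightarrow> dom g = us @ xs @ vs \<longrightarrow> cod f = cod g \<longrightarrow>
       (\<forall>e\<in>F. f \<bullet> whisker us e vs = g \<bullet> whisker us e vs) \<longrightarrow> f = g)"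

lemma jointly_epic_whD: "\<lbrakk>jointly_epic F xs; arr f; arr g; dom f = us @ xs @ vs; dom g = us @ xs @ vs; cod f = cod g;
    \<And>e. e \<in> F \<Longrightarrow> f \<bullet> whisker us e vs = g \<bullet> whisker us e vs\<rbrakk> \<Longrightarrow> f = g"
  unfolding jointly_epic_def by blast

lemma jointly_epicD: "\<lbrakk>jointly_epic F xs; arr f; arr g; dom f = xs; dom g = xs; cod f = cod g;
    \<And>e. e \<in> F \<Longrightarrow> f \<bullet> e = g \<bullet> e\<rbrakk> \<Longrightarrow> f = g"
  by (rule jointly_epic_whD[of F xs f g "[]" "[]"]) (auto simp: jointly_epic_def)

text \<open>\<open>e \<odot> e'\<close> is a layer with \<open>e'\<close> followed by a layer with
  \<open>e\<close>, so the two families are cancelled one after the other.\<close>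

lemma jointly_epic_ten:
  assumes "jointly_epic F xs" "jointly_epic G ys" shows "jointly_epic {e \<odot> e' |e e'. e \<in> F \<and> e' \<in> G} (xs @ ys)"
  unfolding jointly_epic_def
proof (intro conjI allI impI)
  fix f g us vs
  assume a: "arr f" "arr g" "dom f = us @ (xs @ ys) @ vs" "dom g = us @ (xs @ ys) @ vs" "cod f = cod g"
    and b: "\<forall>e\<in>{e \<odot> e' |e e'. e \<in> F \<and> e' \<in> G}. f \<bullet> whisker us e vs = g \<bullet> whisker us e vs"
  show "f = g"
  proof (rule jointly_epic_whD[OF assms(1), of _ _ us "ys @ vs"])
    fix e assume e: "e \<in> F"
    show "f \<bullet> whisker us e (ys @ vs) = g \<bullet> whisker us e (ys @ vs)"
    proof (rule jointly_epic_whD[OF assms(2), of _ _ "us @ dom e" vs])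
      fix e' assume e': "e' \<in> G"
      have "whisker us (e \<odot> e') vs = whisker us e (ys @ vs) \<bullet> whisker (us @ dom e) e' vs"
        using e e' assms by (simp add: jointly_epic_def ten_wh whisker_comp)
      then show "(f \<bullet> whisker us e (ys @ vs)) \<bullet> whisker (us @ dom e) e' vs = (g \<bullet> whisker us e (ys @ vs)) \<bullet> whisker (us @ dom e) e' vs"
        using b e e' by (auto simp: comp_assoc) metis
    qed (use a in simp_all)
  qed (use a in simp_all)
qed (use assms in \<open>auto simp: jointly_epic_def\<close>)

lemma bmult_add_left: "\<lbrakk>dom f = dom f'; cod f = cod f'\<rbrakk>
    \<Longrightarrow> bmult X Y X' Y' (f \<oplus> f') g = bmult X Y X' Y' f g \<oplus> bmult X Y X' Y' f' g"
  by (simp add: bmult_def add_ten add_comp)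

lemma bmult_add_right: "\<lbrakk>dom g = dom g'; cod g = cod g'\<rbrakk>
    \<Longrightarrow> bmult X Y X' Y' f (g \<oplus> g') = bmult X Y X' Y' f g \<oplus> bmult X Y X' Y' f g'"
  by (simp add: bmult_def ten_add add_comp)

lemma bmult_sg: "bmult X Y X' Y' (sg n f) g = sg n (bmult X Y X' Y' f g)"
  by (simp add: bmult_def sg_rules)

lemma bmult_Nil: "\<lbrakk>arr f; arr g; dom f = X @ X'; dom g = Y'\<rbrakk> \<Longrightarrow> bmult X [] X' Y' f g = f \<odot> g"
  "\<lbrakk>arr f; arr g; dom f = X; dom g = Y @ Y'\<rbrakk> \<Longrightarrow> bmult X Y [] Y' f g = f \<odot> g"
  by (simp_all add: bmult_def ten_ide)

end

section \<open>The braided differential calculus in a strict category\<close>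

text \<open>
  \<open>a n : V^n \<rightarrow> B\<close> and \<open>q n : V^n \<rightarrow> L n\<close> are the quotient maps, \<open>\<pi>\<close> is the projection \<open>\<varpi> : B \<rightarrow> V\<close>
  followed by the identification of \<open>V\<close> with \<open>L 1\<close>, and \<open>\<epsilon>\<close> is the counit of \<open>B\<close>.
\<close>

locale braided_data = strict_braided dom cod arr ide comp ten zero add neg brd
  for dom :: "'s \<Rightarrow> 'o list" and cod and arr and ide and comp (infixr "\<bullet>" 70) and ten (infixr "\<odot>" 75)
    and zero and add (infixl "\<oplus>" 65) and neg and brd +
  fixes V B :: 'o and L :: "nat \<Rightarrow> 'o" and m \<Delta> \<epsilon> \<pi> :: 's and a q :: "nat \<Rightarrow> 's" and w :: "nat \<Rightarrow> nat \<Rightarrow> 's"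
  assumes data_typing [simp]:
      "arr m" "dom m = [B, B]" "cod m = [B]" "arr \<Delta>" "dom \<Delta> = [B]" "cod \<Delta> = [B, B]"
      "arr \<epsilon>" "dom \<epsilon> = [B]" "cod \<epsilon> = []" "arr \<pi>" "dom \<pi> = [B]" "cod \<pi> = [L 1]"
      "\<And>n. arr (a n)" "\<And>n. dom (a n) = replicate n V" "\<And>n. cod (a n) = [B]"
      "\<And>n. arr (q n)" "\<And>n. dom (q n) = replicate n V" "\<And>n. cod (q n) = [L n]"
      "\<And>k n. arr (w k n)" "\<And>k n. dom (w k n) = [L k, L n]" "\<And>k n. cod (w k n) = [L (k + n)]"
    and jointly_epic_a: "jointly_epic (range a) [B]" and jointly_epic_q: "\<And>n. jointly_epic {q n} [L n]"
    and m_a: "\<And>k n. m \<bullet> (a k \<odot> a n) = a (k + n)"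
    and w_q: "\<And>k n. w k n \<bullet> (q k \<odot> q n) = q (k + n)"
    and \<epsilon>_a: "\<And>n. \<epsilon> \<bullet> a n = (if n = 0 then ide [] else zero (replicate n V) [])"
    and \<pi>_a: "\<And>n. \<pi> \<bullet> a n = (if n = 1 then q 1 else zero (replicate n V) [L 1])"
    and \<Delta>_m: "\<Delta> \<bullet> m = (m \<odot> m) \<bullet> (ide [B] \<odot> brd [B] [B] \<odot> ide [B]) \<bullet> (\<Delta> \<odot> \<Delta>)"
    and \<Delta>_a: "\<Delta> \<bullet> a 0 = a 0 \<odot> a 0" "\<Delta> \<bullet> a 1 = a 1 \<odot> a 0 \<oplus> a 0 \<odot> a 1"
    and q_brd: "q 2 \<bullet> (ide [V, V] \<oplus> brd [V] [V]) = zero [V, V] [L 2]"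

text \<open>Reversal sends the braiding of two letters to a braiding again, not to its inverse, so
  the axioms keep their form. The indices of \<open>w\<close> are exchanged, and so are the two
  summands of \<open>\<Delta>\<close> on \<open>V\<close>.\<close>

lemma (in braided_data) mirror_data:
  "braided_data (\<lambda>f. rev (dom f)) (\<lambda>f. rev (cod f)) arr (\<lambda>xs. ide (rev xs)) comp (\<lambda>f g. ten g f)
     (\<lambda>xs ys. zero (rev xs) (rev ys)) add neg (\<lambda>xs ys. brd (rev ys) (rev xs))
     V B L m \<Delta> \<epsilon> \<pi> a q (\<lambda>k n. w n k)"
proof -
  interpret M: strict_braided "\<lambda>f. rev (dom f)" "\<lambda>f. rev (cod f)" arr "\<lambda>xs. ide (rev xs)" comp "\<lambda>f g. ten g f"
    "\<lambda>xs ys. zero (rev xs) (rev ys)" add neg "\<lambda>xs ys. brd (rev ys) (rev xs)"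
    by (rule mirror)
  have whisker: "M.whisker xs f ys = whisker (rev ys) f (rev xs)" for xs f ys
    by (simp add: M.whisker_def whisker_def ten_assoc)
  have jointly_epic: "M.jointly_epic F xs" if "jointly_epic F (rev xs)" for F xs
    unfolding M.jointly_epic_def whisker
  proof (intro conjI allI impI)
    fix f g us vs
    assume h: "arr f" "arr g" "rev (dom f) = us @ xs @ vs" "rev (dom g) = us @ xs @ vs" "rev (cod f) = rev (cod g)"
      "\<forall>e\<in>F. f \<bullet> whisker (rev vs) e (rev us) = g \<bullet> whisker (rev vs) e (rev us)"
    have "dom f = rev vs @ rev xs @ rev us" "dom g = rev vs @ rev xs @ rev us"
      using h(3,4)[THEN arg_cong[of _ _ rev]] by simp_all
    with h show "f = g" by (intro jointly_epic_whD[OF that, of f g "rev vs" "rev us"]) auto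
  qed (use that in \<open>auto simp: jointly_epic_def\<close>)
  have "\<Delta> \<bullet> a 1 = a 0 \<odot> a 1 \<oplus> a 1 \<odot> a 0"
    unfolding \<Delta>_a by (rule add_commute) simp_all
  then show ?thesis
    by unfold_locales
      (simp_all add: jointly_epic jointly_epic_a jointly_epic_q m_a w_q \<epsilon>_a \<pi>_a \<Delta>_m \<Delta>_a(1) q_brd ten_assoc add.commute)
qed

section \<open>The bialgebra structure of B and the product of \<Lambda>\<close>

context braided_data
begin

lemma \<Delta>_a_1: "\<Delta> \<bullet> a (Suc 0) = a (Suc 0) \<odot> a 0 \<oplus> a 0 \<odot> a (Suc 0)"
  using \<Delta>_a(2) by simp

lemma a_Suc: "a (Suc n) = m \<bullet> (a n \<odot> a 1)"
  by (simp add: m_a)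

text \<open>Inherited from concatenation of tensor powers: on
  \<open>V^k \<otimes> V^l \<otimes> V^n\<close> both sides are \<open>a (k + l + n)\<close>. The
  unit laws and the laws of \<open>w\<close> arise in the same way.\<close>

lemma m_assoc: "m \<bullet> (m \<odot> ide [B]) = m \<bullet> (ide [B] \<odot> m)"
proof (rule jointly_epicD[OF jointly_epic_ten[OF jointly_epic_ten[OF jointly_epic_a jointly_epic_a] jointly_epic_a]])
  fix e assume "e \<in> {e \<odot> e' |e e'. e \<in> {e \<odot> e' |e e'. e \<in> range a \<and> e' \<in> range a} \<and> e' \<in> range a}"
  then obtain k l n where e: "e = (a k \<odot> a l) \<odot> a n" by auto
  have "(m \<odot> ide [B]) \<bullet> ((a k \<odot> a l) \<odot> a n) = a (k + l) \<odot> a n" by (simp add: ten_comp m_a)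
  moreover have "(ide [B] \<odot> m) \<bullet> (a k \<odot> (a l \<odot> a n)) = a k \<odot> a (l + n)" by (simp add: ten_comp m_a)
  ultimately show "(m \<bullet> (m \<odot> ide [B])) \<bullet> e = (m \<bullet> (ide [B] \<odot> m)) \<bullet> e"
    unfolding e by (simp add: comp_assoc ten_assoc m_a add.assoc)
qed simp_all

lemma m_unit: "m \<bullet> (a 0 \<odot> ide [B]) = ide [B]" "m \<bullet> (ide [B] \<odot> a 0) = ide [B]"
proof -
  have "(a 0 \<odot> ide [B]) \<bullet> a n = a 0 \<odot> a n" "(ide [B] \<odot> a 0) \<bullet> a n = a n \<odot> a 0" for n
    using ten_comp[of "ide []" "a 0" "a n" "ide [B]"] ten_comp[of "a n" "ide [B]" "ide []" "a 0"] by simp_all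
  then show "m \<bullet> (a 0 \<odot> ide [B]) = ide [B]" "m \<bullet> (ide [B] \<odot> a 0) = ide [B]"
    by - (rule jointly_epicD[OF jointly_epic_a]; auto simp: comp_assoc m_a)+
qed

lemma w_assoc: "w (k + l) n \<bullet> (w k l \<odot> ide [L n]) = w k (l + n) \<bullet> (ide [L k] \<odot> w l n)"
proof (rule jointly_epicD[OF jointly_epic_ten[OF jointly_epic_ten[OF jointly_epic_q[of k] jointly_epic_q[of l]] jointly_epic_q[of n]]])
  fix e assume "e \<in> {e \<odot> e' |e e'. e \<in> {e \<odot> e' |e e'. e \<in> {q k} \<and> e' \<in> {q l}} \<and> e' \<in> {q n}}"
  then have e: "e = (q k \<odot> q l) \<odot> q n" by auto
  have "(w k l \<odot> ide [L n]) \<bullet> ((q k \<odot> q l) \<odot> q n) = q (k + l) \<odot> q n" by (simp add: ten_comp w_q)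
  moreover have "(ide [L k] \<odot> w l n) \<bullet> (q k \<odot> (q l \<odot> q n)) = q k \<odot> q (l + n)" by (simp add: ten_comp w_q)
  ultimately show "(w (k + l) n \<bullet> (w k l \<odot> ide [L n])) \<bullet> e = (w k (l + n) \<bullet> (ide [L k] \<odot> w l n)) \<bullet> e"
    unfolding e by (simp add: comp_assoc ten_assoc w_q add.assoc)
qed (simp_all add: add.assoc)

lemma w_unit: "w 0 n \<bullet> (q 0 \<odot> ide [L n]) = ide [L n]" "w n 0 \<bullet> (ide [L n] \<odot> q 0) = ide [L n]"
proof -
  have "(q 0 \<odot> ide [L n]) \<bullet> q n = q 0 \<odot> q n" "(ide [L n] \<odot> q 0) \<bullet> q n = q n \<odot> q 0"
    using ten_comp[of "ide []" "q 0" "q n" "ide [L n]"] ten_comp[of "q n" "ide [L n]" "ide []" "q 0"] by simp_all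
  then show "w 0 n \<bullet> (q 0 \<odot> ide [L n]) = ide [L n]" "w n 0 \<bullet> (ide [L n] \<odot> q 0) = ide [L n]"
    by - (rule jointly_epicD[OF jointly_epic_q[of n]]; auto simp: comp_assoc w_q)+
qed

lemma \<epsilon>_m: "\<epsilon> \<bullet> m = \<epsilon> \<odot> \<epsilon>"
  by (rule jointly_epicD[OF jointly_epic_ten[OF jointly_epic_a jointly_epic_a]])
    (auto simp: comp_assoc m_a \<epsilon>_a ten_comp ten_ide replicate_add)

text \<open>On \<open>V^k \<otimes> V^n\<close> only total degree 1 contributes, and
  \<open>k + n = 1\<close> leaves the two cases \<open>k = 1, n = 0\<close> and
  \<open>k = 0, n = 1\<close>.\<close>

lemma \<pi>_m: "\<pi> \<bullet> m = \<pi> \<odot> \<epsilon> \<oplus> \<epsilon> \<odot> \<pi>"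
  by (rule jointly_epicD[OF jointly_epic_ten[OF jointly_epic_a jointly_epic_a]])
    (auto simp: comp_assoc m_a \<epsilon>_a \<pi>_a add_comp ten_comp replicate_add add_is_1)

text \<open>\<open>B\<close> is generated by \<open>V\<close>: induction peels off the last letter
  of \<open>V^n\<close> by \<open>a_Suc\<close>, and the target product \<open>M\<close> enters
  through the equations for \<open>f\<close> and \<open>g\<close>.\<close>

lemma algebra_map_unique:
  assumes "arr f" "arr g" "dom f = [B]" "dom g = [B]" "cod f = cod g"
    and f: "f \<bullet> m = M \<bullet> (f \<odot> f)" and g: "g \<bullet> m = M \<bullet> (g \<odot> g)"
    and 0: "f \<bullet> a 0 = g \<bullet> a 0" and 1: "f \<bullet> a 1 = g \<bullet> a 1"
  shows "f = g"
proof (rule jointly_epicD[OF jointly_epic_a])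
  have "f \<bullet> a n = g \<bullet> a n" for n
  proof (induction n)
    case (Suc n)
    have "f \<bullet> a (Suc n) = M \<bullet> ((f \<bullet> a n) \<odot> (f \<bullet> a 1))"
      using f assms(1-5) unfolding a_Suc comp_assoc[symmetric] by (simp add: comp_assoc ten_comp)
    also have "\<dots> = M \<bullet> ((g \<bullet> a n) \<odot> (g \<bullet> a 1))" by (simp only: Suc 1)
    also have "\<dots> = g \<bullet> a (Suc n)"
      using g assms(1-5) unfolding a_Suc comp_assoc[symmetric] by (simp add: comp_assoc ten_comp)
    finally show ?case .
  qed (rule 0)
  then show "f \<bullet> e = g \<bullet> e" if "e \<in> range a" for e using that by auto
qed (use assms in simp_all)

lemma \<Delta>_m_bmult: "\<Delta> \<bullet> m = bmult [B] [B] [B] [B] m m \<bullet> (\<Delta> \<odot> \<Delta>)"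
  by (simp add: \<Delta>_m bmult_def comp_assoc)

text \<open>\<open>\<Delta>\<close> is an algebra map, and \<open>h \<odot> k\<close> respects
  braided products by naturality of the braiding. Hence the composite is an algebra map too, which
  makes \<open>algebra_map_unique\<close> applicable to the counit laws and to
  coassociativity.\<close>

lemma convolution_m:
  assumes "dom h = [B]" "dom k = [B]" "arr h" "arr k" "h \<bullet> m = f \<bullet> (h \<odot> h)" "k \<bullet> m = g \<bullet> (k \<odot> k)"
    "dom f = cod h @ cod h" "dom g = cod k @ cod k"
  shows "((h \<odot> k) \<bullet> \<Delta>) \<bullet> m
    = bmult (cod h) (cod k) (cod h) (cod k) f g \<bullet> (((h \<odot> k) \<bullet> \<Delta>) \<odot> ((h \<odot> k) \<bullet> \<Delta>))"
proof -
  have "((h \<odot> k) \<bullet> \<Delta>) \<bullet> m = ((h \<odot> k) \<bullet> bmult [B] [B] [B] [B] m m) \<bullet> (\<Delta> \<odot> \<Delta>)"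
    by (simp add: comp_assoc \<Delta>_m_bmult)
  also have "\<dots> = bmult [B] [B] [B] [B] (f \<bullet> (h \<odot> h)) (g \<bullet> (k \<odot> k)) \<bullet> (\<Delta> \<odot> \<Delta>)"
    using assms by (simp add: comp_bmult)
  also have "\<dots> = bmult (cod h) (cod k) (cod h) (cod k) f g \<bullet> ((h \<odot> k) \<odot> (h \<odot> k)) \<bullet> (\<Delta> \<odot> \<Delta>)"
    using assms by (subst bmult_comp[symmetric]) (auto simp: comp_assoc ten_assoc)
  finally show ?thesis using assms by (simp add: ten_comp)
qed

text \<open>The trivial algebra is the empty word with product \<open>ide []\<close>, and by
  \<open>bmult_Nil\<close> a braided product with it is the other factor. Hence both sides are
  algebra maps from \<open>B\<close> to \<open>B\<close>, compared on 1 and on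
  \<open>V\<close>.\<close>

lemma counit: "(\<epsilon> \<odot> ide [B]) \<bullet> \<Delta> = ide [B]" "(ide [B] \<odot> \<epsilon>) \<bullet> \<Delta> = ide [B]"
proof -
  have [simp]: "\<epsilon> \<bullet> a 0 = ide []" "\<epsilon> \<bullet> a (Suc 0) = zero [V] []" using \<epsilon>_a[of 0] \<epsilon>_a[of 1] by simp_all
  show "(\<epsilon> \<odot> ide [B]) \<bullet> \<Delta> = ide [B]"
  proof (rule algebra_map_unique[of _ _ m])
    show "((\<epsilon> \<odot> ide [B]) \<bullet> \<Delta>) \<bullet> m = m \<bullet> (((\<epsilon> \<odot> ide [B]) \<bullet> \<Delta>) \<odot> ((\<epsilon> \<odot> ide [B]) \<bullet> \<Delta>))"
      using convolution_m[of \<epsilon> "ide [B]" "ide []" m] by (simp add: \<epsilon>_m bmult_Nil ten_ide)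
  qed (simp_all add: comp_assoc \<Delta>_a(1) \<Delta>_a_1 ten_comp comp_add ten_ide)
  show "(ide [B] \<odot> \<epsilon>) \<bullet> \<Delta> = ide [B]"
  proof (rule algebra_map_unique[of _ _ m])
    show "((ide [B] \<odot> \<epsilon>) \<bullet> \<Delta>) \<bullet> m = m \<bullet> (((ide [B] \<odot> \<epsilon>) \<bullet> \<Delta>) \<odot> ((ide [B] \<odot> \<epsilon>) \<bullet> \<Delta>))"
      using convolution_m[of "ide [B]" \<epsilon> m "ide []"] by (simp add: \<epsilon>_m bmult_Nil ten_ide)
  qed (simp_all add: comp_assoc \<Delta>_a(1) \<Delta>_a_1 ten_comp comp_add ten_ide)
qed

text \<open>Both sides are algebra maps into \<open>B \<otimes> B \<otimes> B\<close>, for the two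
  bracketings of its product; \<open>bmult_bmult_assoc\<close> identifies these.\<close>

lemma coassoc: "(\<Delta> \<odot> ide [B]) \<bullet> \<Delta> = (ide [B] \<odot> \<Delta>) \<bullet> \<Delta>"
proof (rule algebra_map_unique)
  let ?b = "bmult [B] [B] [B] [B] m m"
  show "((\<Delta> \<odot> ide [B]) \<bullet> \<Delta>) \<bullet> m
      = bmult [B, B] [B] [B, B] [B] ?b m \<bullet> (((\<Delta> \<odot> ide [B]) \<bullet> \<Delta>) \<odot> ((\<Delta> \<odot> ide [B]) \<bullet> \<Delta>))"
    using convolution_m[of \<Delta> "ide [B]" ?b m] by (simp add: \<Delta>_m_bmult ten_ide)
  have "bmult [B, B] [B] [B, B] [B] ?b m = bmult [B] [B, B] [B] [B, B] m ?b"
    using bmult_bmult_assoc[of m "[B]" "[B]" m "[B]" "[B]" m "[B]" "[B]"] by simp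
  then show "((ide [B] \<odot> \<Delta>) \<bullet> \<Delta>) \<bullet> m
      = bmult [B, B] [B] [B, B] [B] ?b m \<bullet> (((ide [B] \<odot> \<Delta>) \<bullet> \<Delta>) \<odot> ((ide [B] \<odot> \<Delta>) \<bullet> \<Delta>))"
    using convolution_m[of "ide [B]" \<Delta> m ?b] by (simp add: \<Delta>_m_bmult ten_ide)
qed (simp_all add: comp_assoc \<Delta>_a(1) \<Delta>_a_1 ten_comp comp_add ten_assoc add_ten ten_add add_assoc)

end

section \<open>The derivation on B and anticommutation in \<Lambda>\<close>

context braided_data
begin

definition del :: 's where "del = (\<pi> \<odot> ide [B]) \<bullet> \<Delta>"

lemma del_simps [simp]: "arr del" "dom del = [B]" "cod del = [L (Suc 0), B]"
  by (simp_all add: del_def)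

text \<open>\<open>\<pi>_m\<close> splits \<open>\<varpi>\<close> of the product of the two first
  legs. In each term \<open>\<epsilon>\<close> removes one first leg by the counit law: that of the
  right factor, leaving \<open>del b\<close> times \<open>c\<close>, or that of the left factor,
  leaving \<open>b\<close> to cross the letter of \<open>del c\<close>.\<close>

lemma del_m: "del \<bullet> m = (ide [L (Suc 0)] \<odot> m) \<bullet> (del \<odot> ide [B])
    \<oplus> bmult [] [B] [L (Suc 0)] [B] (ide [L (Suc 0)]) m \<bullet> (ide [B] \<odot> del)"
proof -
  let ?l = "ide [L (Suc 0)]"
  have "bmult [B] [B] [B] [B] (\<pi> \<odot> \<epsilon>) m = bmult [L (Suc 0)] [B] [] [B] ?l m \<bullet> (\<pi> \<odot> ide [B] \<odot> \<epsilon> \<odot> ide [B])"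
    "bmult [B] [B] [B] [B] (\<epsilon> \<odot> \<pi>) m = bmult [] [B] [L (Suc 0)] [B] ?l m \<bullet> (\<epsilon> \<odot> ide [B] \<odot> \<pi> \<odot> ide [B])"
    by (simp_all add: bmult_comp ten_ide)
  moreover have "(\<pi> \<odot> ide [B] \<odot> \<epsilon> \<odot> ide [B]) \<bullet> (\<Delta> \<odot> \<Delta>) = del \<odot> ide [B]"
    "(\<epsilon> \<odot> ide [B] \<odot> \<pi> \<odot> ide [B]) \<bullet> (\<Delta> \<odot> \<Delta>) = ide [B] \<odot> del"
    unfolding ten_assoc[symmetric, of \<pi> "ide [B]"] ten_assoc[symmetric, of \<epsilon> "ide [B]" "_ \<odot> _"]
    by (simp_all add: ten_comp counit del_def)
  moreover have "del \<bullet> m = bmult [B] [B] [B] [B] (\<pi> \<odot> \<epsilon> \<oplus> \<epsilon> \<odot> \<pi>) m \<bullet> (\<Delta> \<odot> \<Delta>)"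
    using comp_bmult[of \<pi> m "ide [B]" m] by (simp add: del_def comp_assoc \<Delta>_m_bmult \<pi>_m flip: comp_assoc[of "_ \<odot> _"])
  ultimately show ?thesis
    by (simp add: bmult_add_left add_comp comp_assoc bmult_Nil)
qed

text \<open>\<open>q_brd\<close> carried from \<open>V\<close> to \<open>L 1\<close>: the braiding
  is natural and \<open>q 1 \<odot> q 1\<close> is epic.\<close>

lemma w_1_1: "w (Suc 0) (Suc 0) \<bullet> brd [L (Suc 0)] [L (Suc 0)] = neg (w (Suc 0) (Suc 0))"
proof (rule neg_unique)
  let ?w = "w (Suc 0) (Suc 0)" and ?b = "brd [L (Suc 0)] [L (Suc 0)]" and ?q = "q (Suc 0)"
  show "?w \<oplus> ?w \<bullet> ?b = zero (dom ?w) (cod ?w)"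
  proof (rule jointly_epicD[OF jointly_epic_ten[OF jointly_epic_q[of "Suc 0"] jointly_epic_q[of "Suc 0"]]])
    have "(?w \<bullet> ?b) \<bullet> (?q \<odot> ?q) = (?w \<bullet> (?q \<odot> ?q)) \<bullet> brd [V] [V]" by (simp add: comp_assoc brd_ten)
    moreover have "?w \<bullet> (?q \<odot> ?q) = q 2" by (simp add: w_q numeral_2_eq_2)
    ultimately have "(?w \<oplus> ?w \<bullet> ?b) \<bullet> (?q \<odot> ?q) = q 2 \<bullet> (ide [V, V] \<oplus> brd [V] [V])"
      by (simp add: add_comp comp_add numeral_2_eq_2)
    then show "(?w \<oplus> ?w \<bullet> ?b) \<bullet> e = zero (dom ?w) (cod ?w) \<bullet> e" if "e \<in> {e \<odot> e' |e e'. e \<in> {?q} \<and> e' \<in> {?q}}" for e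
      using that q_brd by (auto simp: numeral_2_eq_2)
  qed simp_all
qed simp_all

text \<open>
  On a product \<open>b v\<close> with \<open>v\<close> in \<open>V\<close>, the map \<open>(\<varpi> \<otimes> \<varpi>) \<Delta>\<close> takes the value \<open>(id + \<Psi>)(\<varpi> b \<otimes> v)\<close>.
\<close>

lemma w_\<pi>_\<pi>: "w (Suc 0) (Suc 0) \<bullet> (\<pi> \<odot> \<pi>) \<bullet> \<Delta> = zero [B] [L (Suc (Suc 0))]"
proof -
  let ?l = "ide [L (Suc 0)]" and ?b = "brd [L (Suc 0)] [L (Suc 0)]"
  have \<pi>0: "\<pi> \<bullet> a 0 = zero [] [L (Suc 0)]" and \<pi>1: "\<pi> \<bullet> a (Suc 0) = q (Suc 0)" using \<pi>_a[of 0] \<pi>_a[of 1] by simp_all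
  have \<epsilon>0: "\<epsilon> \<bullet> a 0 = ide []" and \<epsilon>1: "\<epsilon> \<bullet> a (Suc 0) = zero [V] []" using \<epsilon>_a[of 0] \<epsilon>_a[of 1] by simp_all
  have d: "(\<pi> \<odot> \<pi>) \<bullet> \<Delta> = (?l \<odot> \<pi>) \<bullet> del" by (simp add: del_def ten_comp flip: comp_assoc)
  have del1: "del \<bullet> a (Suc 0) = q (Suc 0) \<odot> a 0"
    using \<Delta>_a(2) by (simp add: del_def comp_assoc comp_add ten_comp \<pi>0 \<pi>1)
  \<comment> \<open>The counit law for the second leg of \<open>\<Delta>\<close>.\<close>
  have \<epsilon>del: "(?l \<odot> \<epsilon>) \<bullet> del = \<pi>"
    using ten_comp[of "ide [B]" \<pi> \<epsilon> "ide []"] ten_comp[of \<pi> ?l "ide [B]" \<epsilon>] counit(2)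
    by (simp add: del_def flip: comp_assoc) (metis One_nat_def comp_assoc comp_ide data_typing(10,11))
  have "(w (Suc 0) (Suc 0) \<bullet> (\<pi> \<odot> \<pi>) \<bullet> \<Delta>) \<bullet> a n = zero [B] [L (Suc (Suc 0))] \<bullet> a n" for n
  proof (cases n)
    case 0
    then show ?thesis by (simp add: comp_assoc \<Delta>_a ten_comp \<pi>0)
  next
    case (Suc k)
    let ?x = "(\<pi> \<bullet> a k) \<odot> q (Suc 0)"
    \<comment> \<open>The term \<open>(del b) v\<close>. In \<open>\<varpi>(b'' v)\<close>, with
      \<open>b''\<close> the second leg of \<open>b\<close>, the summand with
      \<open>\<epsilon>(v)\<close> vanishes, and \<open>\<epsilon>(b'')\<close> collapses
      \<open>del b\<close> to \<open>\<varpi>(b)\<close>.\<close>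
    have 1: "((?l \<odot> \<pi>) \<bullet> (?l \<odot> m) \<bullet> (del \<odot> ide [B])) \<bullet> (a k \<odot> a (Suc 0)) = ?x"
    proof -
      have "((?l \<odot> \<pi>) \<bullet> (?l \<odot> m) \<bullet> (del \<odot> ide [B])) \<bullet> (a k \<odot> a (Suc 0))
          = (?l \<odot> (\<pi> \<odot> \<epsilon> \<oplus> \<epsilon> \<odot> \<pi>)) \<bullet> ((del \<bullet> a k) \<odot> a (Suc 0))"
        by (simp add: comp_assoc ten_comp) (simp add: ten_comp \<pi>_m flip: comp_assoc)
      also have "\<dots> = ((?l \<odot> \<pi>) \<odot> \<epsilon> \<oplus> (?l \<odot> \<epsilon>) \<odot> \<pi>) \<bullet> ((del \<bullet> a k) \<odot> a (Suc 0))"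
        by (simp add: ten_add ten_assoc)
      also have "\<dots> = ((?l \<odot> \<epsilon>) \<bullet> del \<bullet> a k) \<odot> q (Suc 0)"
        using ten_comp[of "del \<bullet> a k" "?l \<odot> \<pi>" "a (Suc 0)" \<epsilon>] ten_comp[of "del \<bullet> a k" "?l \<odot> \<epsilon>" "a (Suc 0)" \<pi>]
        by (simp add: add_comp \<pi>1 \<epsilon>1)
      also have "\<dots> = ?x" by (simp add: \<epsilon>del flip: comp_assoc)
      finally show ?thesis .
    qed
    \<comment> \<open>The term \<open>b (del v)\<close> with \<open>del v = v \<otimes> 1\<close>.
      Here \<open>b\<close> crosses \<open>v\<close>, and \<open>\<varpi>(b 1) = \<varpi>(b)\<close>
      remains; naturality moves \<open>\<varpi>\<close> in front of the braiding.\<close>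
    have 2: "((?l \<odot> \<pi>) \<bullet> bmult [] [B] [L (Suc 0)] [B] ?l m \<bullet> (ide [B] \<odot> del)) \<bullet> (a k \<odot> a (Suc 0)) = ?b \<bullet> ?x"
    proof -
      have "((?l \<odot> \<pi>) \<bullet> bmult [] [B] [L (Suc 0)] [B] ?l m \<bullet> (ide [B] \<odot> del)) \<bullet> (a k \<odot> a (Suc 0))
          = bmult [] [B] [L (Suc 0)] [B] ?l (\<pi> \<odot> \<epsilon> \<oplus> \<epsilon> \<odot> \<pi>) \<bullet> (a k \<odot> (q (Suc 0) \<odot> a 0))"
        by (simp add: comp_assoc ten_comp del1) (simp add: comp_bmult \<pi>_m flip: comp_assoc)
      also have "\<dots> = (?l \<odot> (\<pi> \<odot> \<epsilon> \<oplus> \<epsilon> \<odot> \<pi>)) \<bullet> ((brd [B] [L (Suc 0)] \<bullet> (a k \<odot> q (Suc 0))) \<odot> a 0)"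
        by (simp add: bmult_def comp_assoc ten_comp flip: ten_assoc)
      also have "\<dots> = (?l \<odot> (\<pi> \<odot> \<epsilon> \<oplus> \<epsilon> \<odot> \<pi>)) \<bullet> ((q (Suc 0) \<odot> a k) \<odot> a 0) \<bullet> brd (replicate k V) [V]"
        using ten_comp[of "brd (replicate k V) [V]" "q (Suc 0) \<odot> a k" "ide []" "a 0"] by (simp add: brd_ten)
      also have "\<dots> = (q (Suc 0) \<odot> (\<pi> \<bullet> a k)) \<bullet> brd (replicate k V) [V]"
        by (simp add: ten_assoc ten_comp add_comp \<pi>0 \<epsilon>0 flip: comp_assoc)
      also have "\<dots> = ?b \<bullet> ?x" by (simp add: brd_ten)
      finally show ?thesis .
    qed
    have "((\<pi> \<odot> \<pi>) \<bullet> \<Delta>) \<bullet> a n = ((?l \<odot> \<pi>) \<bullet> del \<bullet> m) \<bullet> (a k \<odot> a (Suc 0))"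
      using a_Suc[of k] by (simp add: Suc d comp_assoc)
    also have "\<dots> = ?x \<oplus> ?b \<bullet> ?x"
      unfolding del_m by (subst comp_add, simp, simp, subst add_comp, simp, simp, subst 1, subst 2, rule refl)
    finally have "((\<pi> \<odot> \<pi>) \<bullet> \<Delta>) \<bullet> a n = ?x \<oplus> ?b \<bullet> ?x" .
    moreover have "w (Suc 0) (Suc 0) \<bullet> (?x \<oplus> ?b \<bullet> ?x) = zero (V # replicate k V) [L (Suc (Suc 0))]"
      using w_1_1 by (simp add: comp_add neg_comp replicate_append_same flip: comp_assoc)
    ultimately show ?thesis by (simp add: comp_assoc Suc)
  qed
  then show ?thesis by - (rule jointly_epicD[OF jointly_epic_a]; auto)
qed

text \<open>The letter passes \<open>\<Lambda>^n\<close> by induction and one further letter by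
  \<open>w_1_1\<close>, which adds one sign; the hexagon joins the two crossings into one.\<close>

lemma w_1_left: "w (Suc 0) n = sg n (w n (Suc 0) \<bullet> brd [L (Suc 0)] [L n])"
proof (induction n)
  case 0
  let ?l = "ide [L (Suc 0)]"
  show ?case
  proof (rule jointly_epic_whD[OF jointly_epic_q[of 0], of _ _ "[L (Suc 0)]" "[]"])
    fix e assume "e \<in> {q 0}"
    moreover have "whisker [L (Suc 0)] (q 0) [] = ?l \<odot> q 0" by (simp add: whisker_def)
    moreover have "brd [L (Suc 0)] [L 0] \<bullet> (?l \<odot> q 0) = q 0 \<odot> ?l" by (simp add: brd_ten)
    ultimately show "w (Suc 0) 0 \<bullet> whisker [L (Suc 0)] e [] = sg 0 (w 0 (Suc 0) \<bullet> brd [L (Suc 0)] [L 0]) \<bullet> whisker [L (Suc 0)] e []"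
      by (simp add: sg_0 comp_assoc w_unit)
  qed simp_all
next
  case (Suc n)
  let ?l = "ide [L (Suc 0)]" and ?b = "\<lambda>n. brd [L (Suc 0)] [L n]" and ?w = "w (Suc 0) (Suc 0)"
  have "?w = neg (?w \<bullet> ?b (Suc 0))" by (simp add: w_1_1)
  then have w11: "?w = sg 1 (?w \<bullet> ?b (Suc 0))" by (simp add: sg_def)
  have "w (Suc 0) (Suc n) \<bullet> (?l \<odot> w n (Suc 0)) = w (Suc n) (Suc 0) \<bullet> (w (Suc 0) n \<odot> ?l)"
    using w_assoc[of "Suc 0" n "Suc 0"] by simp
  also have "\<dots> = sg n (w (Suc n) (Suc 0) \<bullet> (w n (Suc 0) \<odot> ?l) \<bullet> (?b n \<odot> ?l))"
    by (subst Suc) (simp add: sg_rules ten_comp)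
  also have "\<dots> = sg n (w n (Suc (Suc 0)) \<bullet> (ide [L n] \<odot> ?w) \<bullet> (?b n \<odot> ?l))"
    using w_assoc[of n "Suc 0" "Suc 0"] by (simp flip: comp_assoc)
  also have "\<dots> = sg (Suc n) (w n (Suc (Suc 0)) \<bullet> (ide [L n] \<odot> ?w) \<bullet> (ide [L n] \<odot> ?b (Suc 0)) \<bullet> (?b n \<odot> ?l))"
    by (subst w11) (simp add: sg_rules ten_comp flip: comp_assoc)
  also have "\<dots> = sg (Suc n) (w (Suc n) (Suc 0) \<bullet> (w n (Suc 0) \<odot> ?l) \<bullet> brd [L (Suc 0)] [L n, L (Suc 0)])"
    using w_assoc[of n "Suc 0" "Suc 0"] brd_app_right[of "[L (Suc 0)]" "[L n]" "[L (Suc 0)]"] by (simp flip: comp_assoc)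
  also have "\<dots> = sg (Suc n) (w (Suc n) (Suc 0) \<bullet> ?b (Suc n)) \<bullet> (?l \<odot> w n (Suc 0))"
    by (simp add: brd_ten sg_rules comp_assoc)
  finally have *: "w (Suc 0) (Suc n) \<bullet> (?l \<odot> w n (Suc 0)) = sg (Suc n) (w (Suc n) (Suc 0) \<bullet> ?b (Suc n)) \<bullet> (?l \<odot> w n (Suc 0))" .
  show ?case
  \<comment> \<open>\<open>q (Suc n)\<close> factors through \<open>w n 1\<close>, so the equation
    composed with \<open>w n 1\<close>, which is \<open>*\<close>, suffices.\<close>
  proof (rule jointly_epic_whD[OF jointly_epic_q[of "Suc n"], of _ _ "[L (Suc 0)]" "[]"])
    fix e assume "e \<in> {q (Suc n)}"
    then have "whisker [L (Suc 0)] e [] = (?l \<odot> w n (Suc 0)) \<bullet> (?l \<odot> (q n \<odot> q (Suc 0)))"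
      using w_q[of n "Suc 0"] by (simp add: whisker_def ten_comp)
    then show "w (Suc 0) (Suc n) \<bullet> whisker [L (Suc 0)] e [] = sg (Suc n) (w (Suc n) (Suc 0) \<bullet> ?b (Suc n)) \<bullet> whisker [L (Suc 0)] e []"
      using * by (simp flip: comp_assoc)
  qed simp_all
qed

end

section \<open>Leibniz rules before signs\<close>

context braided_data
begin

text \<open>
  \<open>mE\<close>, \<open>dE\<close> and \<open>mF\<close>, \<open>dF\<close> are the products and differentials of \<open>\<Lambda> \<otimes> B\<close> and \<open>B \<otimes> \<Lambda>\<close>, \<open>M0\<close> is the product
  of \<open>\<Lambda> \<otimes> B \<otimes> \<Lambda>\<close>. All signs are left out until \<open>MO\<close>, \<open>DO\<close> and \<open>DO'\<close>.
\<close>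

definition mE :: "nat \<Rightarrow> nat \<Rightarrow> 's" where
  "mE p r = bmult [L p] [B] [L r] [B] (w p r) m"

definition dE :: "nat \<Rightarrow> 's" where
  "dE p = (w p (Suc 0) \<odot> ide [B]) \<bullet> (ide [L p] \<odot> del)"

lemma E_simps [simp]: "arr (mE p r)" "dom (mE p r) = [L p, B, L r, B]" "cod (mE p r) = [L (p + r), B]"
    "arr (dE p)" "dom (dE p) = [L p, B]" "cod (dE p) = [L (Suc p), B]"
  by (simp_all add: mE_def dE_def)

text \<open>
  The first term of \<open>del_m\<close> needs \<open>v \<and> \<eta> = (-1)^r \<and>\<Psi>(v \<otimes> \<eta>)\<close> to move \<open>\<varpi>\<close> of the left factor past \<open>\<eta>\<close>;
  the second one is natural in the braiding.
\<close>

lemma leibniz_E: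
  "dE (p + r) \<bullet> mE p r = sg r (mE (Suc p) r \<bullet> (dE p \<odot> ide [L r, B])) \<oplus> mE p (Suc r) \<bullet> (ide [L p, B] \<odot> dE r)"
proof -
  let ?l = "ide [L (Suc 0)]" and ?W = "w (p + r) (Suc 0)"
  let ?r1 = "(?l \<odot> m) \<bullet> (del \<odot> ide [B])" and ?r2 = "bmult [] [B] [L (Suc 0)] [B] ?l m \<bullet> (ide [B] \<odot> del)"
  have split: "dE (p + r) \<bullet> mE p r = (?W \<odot> ide [B]) \<bullet> bmult [L p] [B] [L r] [B] (w p r) ?r1
      \<oplus> (?W \<odot> ide [B]) \<bullet> bmult [L p] [B] [L r] [B] (w p r) ?r2"
    by (simp add: dE_def mE_def comp_assoc comp_bmult del_m bmult_add_right comp_add)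
  \<comment> \<open>The letter coming from the left factor has crossed \<open>L r\<close> and is
    multiplied on its right. Moving it back next to \<open>L p\<close> costs (-1)^r.\<close>
  have "?W \<bullet> bmult [L p] [L (Suc 0)] [L r] [] (w p r) ?l = sg r (w (Suc p) r \<bullet> (w p (Suc 0) \<odot> ide [L r]))"
  proof -
    have "?W \<bullet> bmult [L p] [L (Suc 0)] [L r] [] (w p r) ?l
        = (?W \<bullet> (w p r \<odot> ?l)) \<bullet> (ide [L p] \<odot> brd [L (Suc 0)] [L r])"
      by (simp add: bmult_def comp_assoc)
    also have "\<dots> = w p (Suc r) \<bullet> (ide [L p] \<odot> (w r (Suc 0) \<bullet> brd [L (Suc 0)] [L r]))"
      using w_assoc[of p r "Suc 0"] by (simp add: comp_assoc ten_comp)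
    also have "w r (Suc 0) \<bullet> brd [L (Suc 0)] [L r] = sg r (w (Suc 0) r)"
      using w_1_left[of r] by (simp add: sg_rules sg_def)
    also have "w p (Suc r) \<bullet> (ide [L p] \<odot> \<dots>) = sg r (w (Suc p) r \<bullet> (w p (Suc 0) \<odot> ide [L r]))"
      using w_assoc[of p "Suc 0" r] by (simp add: sg_rules)
    finally show ?thesis .
  qed
  \<comment> \<open>Regrouping the letter with \<open>L p\<close> lets \<open>del\<close> act first
    and confines the crossing of \<open>L 1\<close> with \<open>L r\<close> to the exterior
    factor.\<close>
  moreover have "bmult [L p] [B] [L r] [B] (w p r) ?r1
      = bmult [L p, L (Suc 0)] [B] [L r] [B] (bmult [L p] [L (Suc 0)] [L r] [] (w p r) ?l) m
          \<bullet> (ide [L p] \<odot> del \<odot> ide [L r] \<odot> ide [B])"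
    using bmult_comp[of "ide [L p]" "ide [B]" "[L p]" "[L p]" del "[B]" "[L (Suc 0), B]" "ide [L r]" "[L r]" "[L r]" "[B]" "[B]" "w p r" "?l \<odot> m"]
      bmult_bmult_assoc[of "w p r" "[L p]" "[L r]" ?l "[L (Suc 0)]" "[]" m "[B]" "[B]"]
    by (simp add: bmult_Nil ten_ide)
  \<comment> \<open>The identities kept in \<open>m \<bullet> (ide [B] \<odot> ide [B])\<close> give
    the shape that \<open>bmult_comp\<close> needs when it is read from right to left.\<close>
  ultimately have "(?W \<odot> ide [B]) \<bullet> bmult [L p] [B] [L r] [B] (w p r) ?r1
      = sg r (bmult [L p, L (Suc 0)] [B] [L r] [B] (w (Suc p) r \<bullet> (w p (Suc 0) \<odot> ide [L r])) (m \<bullet> (ide [B] \<odot> ide [B])))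
          \<bullet> (ide [L p] \<odot> del \<odot> ide [L r] \<odot> ide [B])"
    by (simp add: comp_bmult bmult_sg ten_ide flip: comp_assoc)
  also have "\<dots> = sg r (mE (Suc p) r \<bullet> (w p (Suc 0) \<odot> ide [B] \<odot> ide [L r] \<odot> ide [B])
      \<bullet> (ide [L p] \<odot> del \<odot> ide [L r] \<odot> ide [B]))"
    by (subst bmult_comp[symmetric, of _ _ _ "[L (Suc p)]" _ _ "[B]" _ _ "[L r]" _ "[B]"])
      (simp_all add: mE_def sg_rules comp_assoc)
  also have "\<dots> = sg r (mE (Suc p) r \<bullet> (dE p \<odot> ide [L r, B]))"
    using ten_comp[of "ide [L p] \<odot> del" "w p (Suc 0) \<odot> ide [B]" "ide [L r, B]" "ide [L r, B]"]
    by (simp add: dE_def ten_ide ten_assoc)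
  finally have 1: "(?W \<odot> ide [B]) \<bullet> bmult [L p] [B] [L r] [B] (w p r) ?r1 = \<dots>" .
  \<comment> \<open>The letter coming from the right factor already stands next to
    \<open>L r\<close>, so associativity of \<open>w\<close> is enough and no sign appears.\<close>
  have "bmult [L p] [B] [L r] [B] (w p r) ?r2
      = bmult [L p] [B] [L r, L (Suc 0)] [B] (w p r \<odot> ?l) m \<bullet> (ide [L p] \<odot> ide [B] \<odot> ide [L r] \<odot> del)"
    using bmult_comp[of "ide [L p]" del "[L p]" "[L p]" "ide [B]" "[B]" "[B]" "ide [L r]" "[L r]" "[L r]" "[B]" "[L (Suc 0), B]" "w p r" "bmult [] [B] [L (Suc 0)] [B] ?l m"]
      bmult_bmult_assoc[of "w p r" "[L p]" "[L r]" ?l "[]" "[L (Suc 0)]" m "[B]" "[B]"]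
    by (simp add: bmult_Nil ten_ide)
  then have "(?W \<odot> ide [B]) \<bullet> bmult [L p] [B] [L r] [B] (w p r) ?r2
      = bmult [L p] [B] [L r, L (Suc 0)] [B] (w p (Suc r) \<bullet> (ide [L p] \<odot> w r (Suc 0))) (m \<bullet> (ide [B] \<odot> ide [B]))
          \<bullet> (ide [L p] \<odot> ide [B] \<odot> ide [L r] \<odot> del)"
    using w_assoc[of p r "Suc 0"] by (simp add: comp_bmult ten_ide flip: comp_assoc)
  also have "\<dots> = mE p (Suc r) \<bullet> (ide [L p] \<odot> ide [B] \<odot> w r (Suc 0) \<odot> ide [B])
      \<bullet> (ide [L p] \<odot> ide [B] \<odot> ide [L r] \<odot> del)"
    by (subst bmult_comp[symmetric, of _ _ _ "[L p]" _ _ "[B]" _ _ "[L (Suc r)]" _ "[B]"])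
      (simp_all add: mE_def comp_assoc)
  also have "\<dots> = mE p (Suc r) \<bullet> (ide [L p, B] \<odot> dE r)"
    using ten_comp[of "ide [L p, B]" "ide [L p, B]" "ide [L r] \<odot> del" "w r (Suc 0) \<odot> ide [B]"]
    by (simp add: dE_def) (simp add: ten_assoc flip: ten_ide[of "[L p]" "[B]", simplified])
  finally show ?thesis unfolding split 1 by simp
qed

text \<open>Associativity of \<open>w\<close> lets the two new letters be multiplied with each other
  first; coassociativity then gathers them into
  \<open>\<and> (\<varpi> \<otimes> \<varpi>) \<Delta>\<close>, which is zero.\<close>

lemma dE_dE: "dE (Suc p) \<bullet> dE p = zero [L p, B] [L (Suc (Suc p)), B]"
proof -
  let ?l = "ide [L (Suc 0)]" and ?w = "w (Suc 0) (Suc 0)"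
  have s: "(w p (Suc (Suc 0)) \<odot> ide [B]) \<bullet> ((ide [L p] \<odot> ?w) \<odot> ide [B])
      = (w p (Suc (Suc 0)) \<bullet> (ide [L p] \<odot> ?w)) \<odot> ide [B]"
    by (simp add: ten_comp)
  have "(?w \<odot> ide [B]) \<bullet> (?l \<odot> del) \<bullet> del = (?w \<odot> ide [B]) \<bullet> ((\<pi> \<odot> \<pi>) \<odot> ide [B]) \<bullet> (ide [B] \<odot> \<Delta>) \<bullet> \<Delta>"
    by (simp add: del_def ten_comp ten_assoc flip: comp_assoc)
  also have "\<dots> = ((?w \<bullet> (\<pi> \<odot> \<pi>) \<bullet> \<Delta>) \<odot> ide [B]) \<bullet> \<Delta>"
    unfolding coassoc[symmetric] by (simp add: ten_comp flip: comp_assoc)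
  finally have *: "(?w \<odot> ide [B]) \<bullet> (?l \<odot> del) \<bullet> del = zero [B] [L (Suc (Suc 0)), B]"
    by (simp add: w_\<pi>_\<pi>)
  have "dE (Suc p) \<bullet> dE p
      = (w (Suc p) (Suc 0) \<odot> ide [B]) \<bullet> (w p (Suc 0) \<odot> del) \<bullet> (ide [L p] \<odot> del)"
    by (simp add: dE_def comp_assoc ten_comp flip: comp_assoc[of _ "_ \<odot> ide _"] comp_assoc[of "ide _ \<odot> _" "_ \<odot> ide _"])
  also have "w p (Suc 0) \<odot> del = (w p (Suc 0) \<odot> ?l \<odot> ide [B]) \<bullet> (ide [L p] \<odot> ?l \<odot> del)"
    using ten_comp[of "ide [L p, L (Suc 0)]" "w p (Suc 0)" del "ide [L (Suc 0), B]"] by (simp add: ten_ide flip: ten_assoc)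
  also have "(w (Suc p) (Suc 0) \<odot> ide [B]) \<bullet> (\<dots>) \<bullet> (ide [L p] \<odot> del)
     = ((w (Suc p) (Suc 0) \<bullet> (w p (Suc 0) \<odot> ?l)) \<odot> ide [B]) \<bullet> (ide [L p] \<odot> ((?l \<odot> del) \<bullet> del))"
    by (simp add: comp_assoc ten_comp) (simp add: ten_comp flip: comp_assoc ten_assoc)
  also have "w (Suc p) (Suc 0) \<bullet> (w p (Suc 0) \<odot> ?l) = w p (Suc (Suc 0)) \<bullet> (ide [L p] \<odot> ?w)"
    using w_assoc[of p "Suc 0" "Suc 0"] by simp
  also have "(\<dots> \<odot> ide [B]) \<bullet> (ide [L p] \<odot> ((?l \<odot> del) \<bullet> del))
      = (w p (Suc (Suc 0)) \<odot> ide [B]) \<bullet> (ide [L p] \<odot> ((?w \<odot> ide [B]) \<bullet> (?l \<odot> del) \<bullet> del))"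
    unfolding s[symmetric] comp_assoc ten_assoc by (simp add: ten_comp)
  finally show ?thesis unfolding * by simp
qed

definition mF :: "nat \<Rightarrow> nat \<Rightarrow> 's" where
  "mF p r = bmult [B] [L p] [B] [L r] m (w p r)"

definition dF :: "nat \<Rightarrow> 's" where
  "dF p = (ide [B] \<odot> w (Suc 0) p) \<bullet> (((ide [B] \<odot> \<pi>) \<bullet> \<Delta>) \<odot> ide [L p])"

lemma F_simps [simp]: "arr (mF p r)" "dom (mF p r) = [B, L p, B, L r]" "cod (mF p r) = [B, L (p + r)]"
    "arr (dF p)" "dom (dF p) = [B, L p]" "cod (dF p) = [B, L (Suc p)]"
  by (simp_all add: mF_def dF_def)

text \<open>Reversal exchanges the two arguments of a product along with the tensor factors; hence
  \<open>mF r p\<close> and not \<open>mF p r\<close>.\<close>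

lemma mirror_E:
  "braided_data.mE (\<lambda>xs. ide (rev xs)) comp (\<lambda>f g. ten g f) (\<lambda>xs ys. brd (rev ys) (rev xs)) B L m (\<lambda>k n. w n k) p r = mF r p"
  "braided_data.dE (\<lambda>xs. ide (rev xs)) comp (\<lambda>f g. ten g f) B L \<Delta> \<pi> (\<lambda>k n. w n k) p = dF p"
  by (simp_all add: braided_data.mE_def[OF mirror_data] braided_data.dE_def[OF mirror_data] braided_data.del_def[OF mirror_data]
    mF_def dF_def strict_braided.bmult_def[OF mirror] bmult_def ten_assoc)

text \<open>Mirror image of \<open>leibniz_E\<close>. The two terms trade places, so the sign now
  sits on the term that differentiates the right factor.\<close>

lemma leibniz_F:
  "dF (p + r) \<bullet> mF p r = mF (Suc p) r \<bullet> (dF p \<odot> ide [B, L r]) \<oplus> sg p (mF p (Suc r) \<bullet> (ide [B, L p] \<odot> dF r))"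
proof -
  have "dF (r + p) \<bullet> mF p r = sg p (mF p (Suc r) \<bullet> (ide [B, L p] \<odot> dF r)) \<oplus> mF (Suc p) r \<bullet> (dF p \<odot> ide [B, L r])"
    using braided_data.leibniz_E[OF mirror_data, of r p]
    by (simp add: mirror_E strict_braided.sg_def[OF mirror] sg_def)
  also have "\<dots> = mF (Suc p) r \<bullet> (dF p \<odot> ide [B, L r]) \<oplus> sg p (mF p (Suc r) \<bullet> (ide [B, L p] \<odot> dF r))"
    by (rule add_commute) simp_all
  finally show ?thesis by (simp add: add.commute)
qed

lemma dF_dF: "dF (Suc p) \<bullet> dF p = zero [B, L p] [B, L (Suc (Suc p))]"
  using braided_data.dE_dE[OF mirror_data, of p] by (simp add: mirror_E)

text \<open>One operator takes the left leg of \<open>\<Delta>\<close> and the other the right leg,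
  and the products in \<open>\<Lambda>\<close> act at opposite ends. Without signs the operators
  therefore commute.\<close>

lemma dE_dF: "(dE p \<odot> ide [L (Suc r)]) \<bullet> (ide [L p] \<odot> dF r) = (ide [L (Suc p)] \<odot> dF r) \<bullet> (dE p \<odot> ide [L r])"
proof -
  let ?l = "ide [L (Suc 0)]" and ?p = "ide [L p]" and ?r = "ide [L r]" and ?b = "ide [B]"
  let ?d = "(?b \<odot> \<pi>) \<bullet> \<Delta>"
  have [simp]: "arr ?d" "dom ?d = [B]" "cod ?d = [B, L (Suc 0)]" by simp_all
  have e: "ten (dE p) (ide xs) = (w p (Suc 0) \<odot> ?b \<odot> ide xs) \<bullet> (?p \<odot> del \<odot> ide xs)"
    "ide xs \<odot> dF r = (ide xs \<odot> ?b \<odot> w (Suc 0) r) \<bullet> (ide xs \<odot> ?d \<odot> ?r)" for xs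
    using ten_comp[of "?p \<odot> del" "w p (Suc 0) \<odot> ?b" "ide xs" "ide xs"]
      ten_comp[of "ide xs" "ide xs" "?d \<odot> ?r" "?b \<odot> w (Suc 0) r"]
    by (simp_all add: dE_def dF_def ten_assoc)
  \<comment> \<open>Both sides are \<open>\<pi> \<odot> ide [B] \<odot> \<pi>\<close> after the
    twofold coproduct.\<close>
  have c: "(del \<odot> ?l) \<bullet> ?d = (?l \<odot> ?d) \<bullet> del"
  proof -
    have "(del \<odot> ?l) \<bullet> ?d = (\<pi> \<odot> ?b \<odot> \<pi>) \<bullet> (\<Delta> \<odot> ?b) \<bullet> \<Delta>"
      using ten_comp[of \<Delta> "\<pi> \<odot> ?b" ?b \<pi>] by (simp add: del_def ten_comp ten_assoc flip: comp_assoc)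
    also have "\<dots> = (?l \<odot> ?d) \<bullet> del"
      unfolding coassoc by (simp add: del_def ten_comp flip: comp_assoc)
    finally show ?thesis .
  qed
  have "(dE p \<odot> ide [L (Suc r)]) \<bullet> (?p \<odot> dF r)
      = (w p (Suc 0) \<odot> ?b \<odot> w (Suc 0) r) \<bullet> (?p \<odot> ((del \<odot> ?l) \<bullet> ?d) \<odot> ?r)"
  proof -
    have "(?p \<odot> del \<odot> ide [L (Suc r)]) \<bullet> (?p \<odot> ?b \<odot> w (Suc 0) r) = ?p \<odot> del \<odot> w (Suc 0) r"
      by (simp add: ten_comp)
    also have "\<dots> = (?p \<odot> ?l \<odot> ?b \<odot> w (Suc 0) r) \<bullet> (?p \<odot> (del \<odot> ?l) \<odot> ?r)"
      using ten_comp[of del "?l \<odot> ?b" "?l \<odot> ?r" "w (Suc 0) r"] ten_comp[of ?p ?p "del \<odot> (?l \<odot> ?r)" "(?l \<odot> ?b) \<odot> w (Suc 0) r"]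
      by (simp add: ten_assoc ten_ide ten_ide_ten)
    finally have "(?p \<odot> del \<odot> ide [L (Suc r)]) \<bullet> (?p \<odot> ?b \<odot> w (Suc 0) r)
      = (?p \<odot> ?l \<odot> ?b \<odot> w (Suc 0) r) \<bullet> (?p \<odot> (del \<odot> ?l) \<odot> ?r)" .
    moreover have "(w p (Suc 0) \<odot> ?b \<odot> ide [L (Suc r)]) \<bullet> (?p \<odot> ?l \<odot> ?b \<odot> w (Suc 0) r) = w p (Suc 0) \<odot> ?b \<odot> w (Suc 0) r"
      using ten_comp[of "?p \<odot> ?l" "w p (Suc 0)" "?b \<odot> w (Suc 0) r" "?b \<odot> ide [L (Suc r)]"]
      by (simp add: ten_assoc ten_ide ten_ide_ten)
    moreover have "(?p \<odot> (del \<odot> ?l) \<odot> ?r) \<bullet> (?p \<odot> ?d \<odot> ?r) = ?p \<odot> ((del \<odot> ?l) \<bullet> ?d) \<odot> ?r"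
      by (subst ten_comp, simp, simp, subst ten_comp) simp_all
    ultimately show ?thesis unfolding e by (metis comp_assoc)
  qed
  moreover have "(ide [L (Suc p)] \<odot> dF r) \<bullet> (dE p \<odot> ?r)
      = (w p (Suc 0) \<odot> ?b \<odot> w (Suc 0) r) \<bullet> (?p \<odot> ((?l \<odot> ?d) \<bullet> del) \<odot> ?r)"
  proof -
    have "(ide [L (Suc p)] \<odot> ?d \<odot> ?r) \<bullet> (w p (Suc 0) \<odot> ?b \<odot> ?r) = w p (Suc 0) \<odot> ?d \<odot> ?r"
      by (simp add: ten_comp)
    also have "\<dots> = (w p (Suc 0) \<odot> ?b \<odot> ?l \<odot> ?r) \<bullet> (?p \<odot> (?l \<odot> ?d) \<odot> ?r)"
      using ten_comp[of "?p \<odot> ?l" "w p (Suc 0)" "?d \<odot> ?r" "(?b \<odot> ?l) \<odot> ?r"]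
      by (simp add: ten_assoc ten_ide ten_ide_ten)
    finally have "(ide [L (Suc p)] \<odot> ?d \<odot> ?r) \<bullet> (w p (Suc 0) \<odot> ?b \<odot> ?r)
      = (w p (Suc 0) \<odot> ?b \<odot> ?l \<odot> ?r) \<bullet> (?p \<odot> (?l \<odot> ?d) \<odot> ?r)" .
    moreover have "(ide [L (Suc p)] \<odot> ?b \<odot> w (Suc 0) r) \<bullet> (w p (Suc 0) \<odot> ?b \<odot> ?l \<odot> ?r) = w p (Suc 0) \<odot> ?b \<odot> w (Suc 0) r"
      by (simp add: ten_comp ten_ide)
    moreover have "(?p \<odot> (?l \<odot> ?d) \<odot> ?r) \<bullet> (?p \<odot> del \<odot> ?r) = ?p \<odot> ((?l \<odot> ?d) \<bullet> del) \<odot> ?r"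
      by (subst ten_comp, simp, simp, subst ten_comp) simp_all
    ultimately show ?thesis unfolding e by (metis comp_assoc)
  qed
  ultimately show ?thesis unfolding c by simp
qed

definition M0 :: "nat \<Rightarrow> nat \<Rightarrow> nat \<Rightarrow> nat \<Rightarrow> 's" where
  "M0 p r p' r' = bmult [L p, B] [L r] [L p', B] [L r'] (mE p p') (w r r')"

lemma M0_simps [simp]: "arr (M0 p r p' r')" "dom (M0 p r p' r') = [L p, B, L r, L p', B, L r']"
    "cod (M0 p r p' r') = [L (p + p'), B, L (r + r')]"
  by (simp_all add: M0_def)

text \<open>In this bracketing \<open>dF\<close> acts on a single factor of a braided product, as
  \<open>dE\<close> does in the defining one.\<close>

lemma M0_alt: "M0 p r p' r' = bmult [L p] [B, L r] [L p'] [B, L r'] (w p p') (mF r r')"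
  using bmult_bmult_assoc[of "w p p'" "[L p]" "[L p']" m "[B]" "[B]" "w r r'" "[L r]" "[L r']"]
  by (simp add: M0_def mE_def mF_def)

text \<open>\<open>bmult_assoc\<close> twice: for \<open>\<Lambda> \<otimes> B\<close>, and then for
  that algebra with the right factor \<open>\<Lambda>\<close>.\<close>

lemma M0_assoc:
  "M0 (p + p') (r + r') p'' r'' \<bullet> (M0 p r p' r' \<odot> ide [L p'', B, L r''])
    = M0 p r (p' + p'') (r' + r'') \<bullet> (ide [L p, B, L r] \<odot> M0 p' r' p'' r'')"
proof -
  have E: "mE (p + p') p'' \<bullet> (mE p p' \<odot> ide [L p'', B]) = mE p (p' + p'') \<bullet> (ide [L p, B] \<odot> mE p' p'')"
    using bmult_assoc[OF w_assoc[of p p' p''] m_assoc, of "[L p']" _ _ "[B]"]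
    by (simp add: mE_def)
  show ?thesis
    using bmult_assoc[OF _ w_assoc[of r r' r''], of "mE (p + p') p''" "mE p p'" "[L p'', B]" "mE p (p' + p'')" "[L p, B]" "mE p' p''"
      "[L p', B]" "[L (p + p'), B]" "[L (p' + p''), B]" "[L r']" "[L (r + r')]" "[L (r' + r'')]"] E
    by (simp add: M0_def)
qed

lemma M0_unit:
  "M0 0 0 p r \<bullet> (((q 0 \<odot> a 0) \<odot> q 0) \<odot> ide [L p, B, L r]) = ide [L p, B, L r]"
  "M0 p r 0 0 \<bullet> (ide [L p, B, L r] \<odot> ((q 0 \<odot> a 0) \<odot> q 0)) = ide [L p, B, L r]"
proof -
  have E: "mE 0 p \<bullet> ((q 0 \<odot> a 0) \<odot> ide [L p, B]) = ide [L p, B]" "mE p 0 \<bullet> (ide [L p, B] \<odot> (q 0 \<odot> a 0)) = ide [L p, B]"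
    using bmult_comp[of "q 0" "ide [B]" "[]" "[L 0]" "a 0" "[]" "[B]" "ide [L p]" "[L p]" "[L p]" "[B]" "[B]" "w 0 p" m]
      bmult_comp[of "ide [L p]" "a 0" "[L p]" "[L p]" "ide [B]" "[B]" "[B]" "q 0" "[]" "[L 0]" "[]" "[B]" "w p 0" m]
    by (simp_all add: mE_def w_unit m_unit bmult_Nil ten_assoc ten_ide ten_ide_ten)
  show "M0 0 0 p r \<bullet> (((q 0 \<odot> a 0) \<odot> q 0) \<odot> ide [L p, B, L r]) = ide [L p, B, L r]"
    using bmult_comp[of "q 0 \<odot> a 0" "ide [L r]" "[]" "[L 0, B]" "q 0" "[]" "[L 0]" "ide [L p, B]" "[L p, B]" "[L p, B]" "[L r]" "[L r]" "mE 0 p" "w 0 r"] E(1)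
    by (simp add: M0_def w_unit bmult_Nil ten_assoc ten_ide ten_ide_ten)
  show "M0 p r 0 0 \<bullet> (ide [L p, B, L r] \<odot> ((q 0 \<odot> a 0) \<odot> q 0)) = ide [L p, B, L r]"
    using bmult_comp[of "ide [L p, B]" "q 0" "[L p, B]" "[L p, B]" "ide [L r]" "[L r]" "[L r]" "q 0 \<odot> a 0" "[]" "[L 0, B]" "[]" "[L 0]" "mE p 0" "w r 0"] E(2)
    by (simp add: M0_def w_unit bmult_Nil ten_assoc ten_ide ten_ide_ten)
qed

lemma dE_M0: "(dE (p + p') \<odot> ide [L (r + r')]) \<bullet> M0 p r p' r'
  = sg p' (M0 (Suc p) r p' r' \<bullet> ((dE p \<odot> ide [L r]) \<odot> ide [L p', B, L r']))
    \<oplus> M0 p r (Suc p') r' \<bullet> (ide [L p, B, L r] \<odot> (dE p' \<odot> ide [L r']))"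
  using bmult_comp[of "dE p" "ide [L r']" "[L p, B]" "[L (Suc p), B]" "ide [L r]" "[L r]" "[L r]" "ide [L p', B]" "[L p', B]" "[L p', B]" "[L r']" "[L r']" "mE (Suc p) p'" "w r r'"]
    bmult_comp[of "ide [L p, B]" "ide [L r']" "[L p, B]" "[L p, B]" "ide [L r]" "[L r]" "[L r]" "dE p'" "[L p', B]" "[L (Suc p'), B]" "[L r']" "[L r']" "mE p (Suc p')" "w r r'"]
  by (simp add: M0_def comp_bmult leibniz_E bmult_add_left bmult_sg ten_assoc ten_ide ten_ide_ten)

lemma dF_M0: "(ide [L (p + p')] \<odot> dF (r + r')) \<bullet> M0 p r p' r'
  = M0 p (Suc r) p' r' \<bullet> ((ide [L p] \<odot> dF r) \<odot> ide [L p', B, L r'])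
    \<oplus> sg r (M0 p r p' (Suc r') \<bullet> (ide [L p, B, L r] \<odot> (ide [L p'] \<odot> dF r')))"
proof -
  have bmult_sg': "bmult X Y X' Y' f (sg n g) = sg n (bmult X Y X' Y' f g)" for X Y X' Y' f g n
    by (simp add: bmult_def sg_rules)
  show ?thesis
    using bmult_comp[of "ide [L p]" "ide [B, L r']" "[L p]" "[L p]" "dF r" "[B, L r]" "[B, L (Suc r)]" "ide [L p']" "[L p']" "[L p']" "[B, L r']" "[B, L r']" "w p p'" "mF (Suc r) r'"]
      bmult_comp[of "ide [L p]" "dF r'" "[L p]" "[L p]" "ide [B, L r]" "[B, L r]" "[B, L r]" "ide [L p']" "[L p']" "[L p']" "[B, L r']" "[B, L (Suc r')]" "w p p'" "mF r (Suc r')"]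
    by (simp add: M0_alt comp_bmult leibniz_F bmult_add_right bmult_sg' ten_assoc ten_ide ten_ide_ten)
qed

end

section \<open>Signs of the product and of the two differentials\<close>

context braided_data
begin

definition MO :: "nat \<Rightarrow> nat \<Rightarrow> nat \<Rightarrow> nat \<Rightarrow> 's" where
  "MO p r p' r' = sg (r * p') (M0 p r p' r')"

definition DO :: "nat \<Rightarrow> nat \<Rightarrow> 's" where
  "DO p r = sg p (dE p) \<odot> ide [L r]"

definition DO' :: "nat \<Rightarrow> nat \<Rightarrow> 's" where
  "DO' p r = sg p (ide [L p] \<odot> dF r)"

lemma MO_simps [simp]: "arr (MO p r p' r')" "dom (MO p r p' r') = [L p, B, L r, L p', B, L r']"
    "cod (MO p r p' r') = [L (p + p'), B, L (r + r')]"
  by (simp_all add: MO_def)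

text \<open>The exponent \<open>r * p'\<close> is additive in both degrees, so both sides carry the
  same sign.\<close>

lemma MO_assoc:
  "MO (p + p') (r + r') p'' r'' \<bullet> (MO p r p' r' \<odot> ide [L p'', B, L r''])
    = MO p r (p' + p'') (r' + r'') \<bullet> (ide [L p, B, L r] \<odot> MO p' r' p'' r'')"
  using sg_cong[of "(r + r') * p'' + r * p'" "r * (p' + p'') + r' * p''"]
  by (simp add: MO_def sg_rules M0_assoc algebra_simps)

lemma MO_unit:
  "MO 0 0 p r \<bullet> (((q 0 \<odot> a 0) \<odot> q 0) \<odot> ide [L p, B, L r]) = ide [L p, B, L r]"
  "MO p r 0 0 \<bullet> (ide [L p, B, L r] \<odot> ((q 0 \<odot> a 0) \<odot> q 0)) = ide [L p, B, L r]"
  by (simp_all add: MO_def sg_0 M0_unit)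

text \<open>In the second term the \<open>r\<close> of the total degree cancels against the growth
  of the crossing exponent from \<open>r * p'\<close> to \<open>r * Suc p'\<close>. In the first
  term the sign \<open>p'\<close> of \<open>dE_M0\<close> turns \<open>p + p'\<close> into
  \<open>p\<close>.\<close>

lemma DO_MO:
  "DO (p + p') (r + r') \<bullet> MO p r p' r' = MO (Suc p) r p' r' \<bullet> (DO p r \<odot> ide [L p', B, L r'])
    \<oplus> sg (p + r) (MO p r (Suc p') r' \<bullet> (ide [L p, B, L r] \<odot> DO p' r'))"
  by (simp add: MO_def DO_def sg_rules dE_M0 sg_add)
    (intro arg_cong2[of _ _ _ _ add] sg_cong; auto)

text \<open>The sign (-1)^(p + p') on the left supplies the \<open>p'\<close> by which the crossing
  exponent grows in the first term, from \<open>r * p'\<close> to \<open>Suc r * p'\<close>, and the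
  sign of \<open>DO' p' r'\<close> in the second.\<close>

lemma DO'_MO:
  "DO' (p + p') (r + r') \<bullet> MO p r p' r' = MO p (Suc r) p' r' \<bullet> (DO' p r \<odot> ide [L p', B, L r'])
    \<oplus> sg (p + r) (MO p r p' (Suc r') \<bullet> (ide [L p, B, L r] \<odot> DO' p' r'))"
  by (simp add: MO_def DO'_def sg_rules dF_M0 sg_add)
    (intro arg_cong2[of _ _ _ _ add] sg_cong; auto)

lemma DO_DO: "DO (Suc p) r \<bullet> DO p r = zero [L p, B, L r] [L (Suc (Suc p)), B, L r]"
  by (simp add: DO_def ten_comp sg_rules dE_dE sg_zero)

lemma DO'_DO': "DO' p (Suc r) \<bullet> DO' p r = zero [L p, B, L r] [L p, B, L (Suc (Suc r))]"
  by (simp add: DO'_def ten_comp sg_rules dF_dF sg_zero)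

text \<open>The unsigned operators commute. Both carry (-1)^p, and only \<open>DO\<close> raises
  \<open>p\<close>, so exactly one of the two composites is negated.\<close>

lemma DO_DO': "DO p (Suc r) \<bullet> DO' p r \<oplus> DO' (Suc p) r \<bullet> DO p r = zero [L p, B, L r] [L (Suc p), B, L (Suc r)]"
  by (simp add: DO_def DO'_def sg_rules dE_dF) (simp add: sg_def)

end

section \<open>Strictifying the data\<close>

primrec power_tree :: "'o \<Rightarrow> nat \<Rightarrow> 'o tree" where
  "power_tree V 0 = Ut"
| "power_tree V (Suc n) = Tn (power_tree V n) (Lf V)"

lemma flat_power_tree [simp]: "flat (power_tree V n) = replicate n V"
  by (induction n) (simp_all add: replicate_append_same)

context abelian_braided_category
begin

sublocale S: strict_braided sdom scod valid sid scomp sten szero sadd sneg sbrd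
  by (rule strictification)

lemma tobj_power_tree [simp]: "V \<in> Ob C \<Longrightarrow> tobj (power_tree V n) = tpow C V n"
  by (induction n) simp_all

lemma tpow_Ob [simp]: "V \<in> Ob C \<Longrightarrow> tpow C V n \<in> Ob C"
  using tobj_Ob[of "power_tree V n"] by simp

lemma stricts_Cmp': "\<lbrakk>stricts s t f \<phi>; stricts t u g \<psi>; scomp \<psi> \<phi> = \<chi>\<rbrakk> \<Longrightarrow> stricts s u (g \<cdot> f) \<chi>"
  using stricts_Cmp by blast

lemma stricts_D: "stricts s t f \<phi> \<Longrightarrow> f \<in> Arr C" "stricts s t f \<phi> \<Longrightarrow> Dom C f = tobj s" "stricts s t f \<phi> \<Longrightarrow> Cod C f = tobj t"
    "stricts s t f \<phi> \<Longrightarrow> valid \<phi>" "stricts s t f \<phi> \<Longrightarrow> sdom \<phi> = flat s" "stricts s t f \<phi> \<Longrightarrow> scod \<phi> = flat t"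
  by (auto simp: stricts_def)

text \<open>Concatenation of tensor powers becomes an identity, which is why \<open>m_a\<close> and
  \<open>w_q\<close> need no arrow of their own for it.\<close>

lemma stricts_tpow_mult:
  assumes [simp]: "V \<in> Ob C"
  shows "stricts (Tn (power_tree V k) (power_tree V n)) (power_tree V (k + n)) (tpow_mult C V k n) (sid (replicate (k + n) V))"
proof (induction n)
  case 0
  then show ?case using stricts_Run[of "power_tree V k"] by simp
next
  case (Suc n)
  have r: "replicate k V @ replicate n V @ [V] = V # replicate (k + n) V" "replicate (k + n) V @ [V] = V # replicate (k + n) V"
    by (simp_all add: replicate_append_same replicate_app_Cons_same replicate_add)
  have *: "stricts (Tn (Tn (power_tree V k) (power_tree V n)) (Lf V)) (power_tree V (k + Suc n))
      (tpow_mult C V k n \<boxtimes> Ide C V) (sten (sid (replicate (k + n) V)) (sid [V]))"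
    using stricts_TenA[OF Suc stricts_Ide[of "Lf V" V]] by simp
  show ?case
    unfolding tpow_mult.simps power_tree.simps(2)[of V n]
    by (rule stricts_Cmp'[OF stricts_Inv[OF stricts_Asc Asc_iso] *])
      (simp_all add: S.ten_ide r)
qed

lemma stricts_middle_braid:
  assumes [simp]: "tobj x = X" "tobj y = Y" "tobj x' = X'" "tobj y' = Y'"
  shows "stricts (Tn (Tn x y) (Tn x' y')) (Tn (Tn x x') (Tn y y')) (middle_braid C X Y X' Y')
    (sten (sid (flat x)) (sten (sbrd (flat y) (flat x')) (sid (flat y'))))"
proof -
  have [simp]: "X \<in> Ob C" "Y \<in> Ob C" "X' \<in> Ob C" "Y' \<in> Ob C" using tobj_Ob assms by metis+
  let ?b = "sbrd (flat y) (flat x')" and ?v = "\<lambda>a b c. flat a @ flat b @ flat c"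
  have "stricts (Tn (Tn x y) (Tn x' y')) (Tn (Tn x x') (Tn y y')) (middle_braid C X Y X' Y')
    (scomp (sid (?v x x' (Tn y y'))) (scomp (sten (sid (flat x)) (scomp (sid (?v x' y y')) (scomp (sten ?b (sid (flat y'))) (sid (?v y x' y')))))
      (sid (?v x y (Tn x' y')))))"
    unfolding middle_braid_def by (rule stricts_rules | simp; fail)+
  then show ?thesis by simp
qed

lemma stricts_braided_mult:
  assumes "stricts (Tn x x') s f \<phi>" "stricts (Tn y y') t g \<psi>" "tobj x = X" "tobj y = Y" "tobj x' = X'" "tobj y' = Y'"
  shows "stricts (Tn (Tn x y) (Tn x' y')) (Tn s t) (braided_mult C X Y X' Y' f g)
    (S.bmult (flat x) (flat y) (flat x') (flat y') \<phi> \<psi>)"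
  unfolding braided_mult_def S.bmult_def
  by (rule stricts_Cmp stricts_middle_braid stricts_TenA assms)+

lemma stricts_signed: "stricts s t f \<phi> \<Longrightarrow> stricts s t (signed C n f) (S.sg n \<phi>)"
  by (simp add: signed_eq S.sg_def stricts_Neg)

section \<open>Epimorphic families stable under tensoring\<close>

definition stably_epic :: "'a \<Rightarrow> 'b set \<Rightarrow> bool" where
  "stably_epic X F \<longleftrightarrow> (\<forall>U W g h. U \<in> Ob C \<longrightarrow> W \<in> Ob C \<longrightarrow> g \<in> Arr C \<longrightarrow> h \<in> Arr C \<longrightarrow>
     Dom C g = U \<boxdot> X \<boxdot> W \<longrightarrow> Dom C h = U \<boxdot> X \<boxdot> W \<longrightarrow> Cod C g = Cod C h \<longrightarrow>
     (\<forall>e\<in>F. g \<cdot> ((Ide C U \<boxtimes> e) \<boxtimes> Ide C W) = h \<cdot> ((Ide C U \<boxtimes> e) \<boxtimes> Ide C W)) \<longrightarrow> g = h)"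

text \<open>Composing with \<open>can\<close> turns a strict arrow out of
  \<open>us @ flat t @ vs\<close> into an arrow out of a threefold tensor product, to which
  \<open>stably_epic\<close> applies.\<close>

lemma jointly_epic_strict:
  assumes epic: "stably_epic (tobj t) {e n |n. P n}" and e: "\<And>n. P n \<Longrightarrow> stricts (s n) t (e n) (\<phi> n)"
  shows "S.jointly_epic {\<phi> n |n. P n} (flat t)"
  unfolding S.jointly_epic_def
proof (intro conjI allI impI)
  show "\<forall>e\<in>{\<phi> n |n. P n}. valid e \<and> scod e = flat t"
    using stricts_D(4,6)[OF e] by blast
next
  fix f g us vs
  assume a: "valid f" "valid g" "sdom f = us @ flat t @ vs" "sdom g = us @ flat t @ vs" "scod f = scod g"
    and eq: "\<forall>e\<in>{\<phi> n |n. P n}. scomp f (S.whisker us e vs) = scomp g (S.whisker us e vs)"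
  let ?t = "Tn (Tn (Li us) t) (Li vs)"
  have f: "stricts ?t (Li (scod f)) (val f \<cdot> can ?t) f" and g: "stricts ?t (Li (scod f)) (val g \<cdot> can ?t) g"
    using a by (simp_all add: stricts_def)
  have "val f \<cdot> can ?t = val g \<cdot> can ?t"
  proof (rule epic[unfolded stably_epic_def, rule_format, of "nest us" "nest vs"])
    fix x assume "x \<in> {e n |n. P n}"
    then obtain n where n: "x = e n" "P n" by auto
    have "stricts (Tn (Tn (Li us) (s n)) (Li vs)) ?t ((Ide C (nest us) \<boxtimes> x) \<boxtimes> Ide C (nest vs)) (S.whisker us (\<phi> n) vs)"
      using stricts_TenA[OF stricts_TenA[OF stricts_Ide[of "Li us"] e[OF n(2)]] stricts_Ide[of "Li vs"]]
      unfolding S.whisker_def n(1) by (simp add: S.ten_assoc)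
    note w = this
    have "scomp f (S.whisker us (\<phi> n) vs) = scomp g (S.whisker us (\<phi> n) vs)" using eq n(2) by blast
    with stricts_Cmp[OF w g] have "stricts (Tn (Tn (Li us) (s n)) (Li vs)) (Li (scod f))
        ((val g \<cdot> can ?t) \<cdot> ((Ide C (nest us) \<boxtimes> x) \<boxtimes> Ide C (nest vs))) (scomp f (S.whisker us (\<phi> n) vs))" by metis
    with stricts_Cmp[OF w f]
    show "(val f \<cdot> can ?t) \<cdot> ((Ide C (nest us) \<boxtimes> x) \<boxtimes> Ide C (nest vs))
        = (val g \<cdot> can ?t) \<cdot> ((Ide C (nest us) \<boxtimes> x) \<boxtimes> Ide C (nest vs))"
      by (rule stricts_inj)
  qed (simp_all add: stricts_D(1-3)[OF f] stricts_D(1-3)[OF g] del: can.simps)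
  with f have "stricts ?t (Li (scod f)) (val g \<cdot> can ?t) f" by metis
  then show "f = g" using g by (rule stricts_fun)
qed

lemma quotient_ex1:
  "\<lbrakk>is_quotient C X S Q q; f \<in> Hom C X W; \<And>s. s \<in> S \<Longrightarrow> f \<cdot> s = Zro C (Dom C s) W\<rbrakk>
    \<Longrightarrow> \<exists>!g. g \<in> Hom C Q W \<and> g \<cdot> q = f"
  unfolding is_quotient_def by (elim conjE allE[of _ W] allE[of _ f], erule mp) simp

lemma quotient_epic:
  assumes q: "is_quotient C X S Q q" and h: "g \<in> Arr C" "h \<in> Arr C" "Dom C g = Q" "Dom C h = Q" "Cod C g = Cod C h"
    and eq: "g \<cdot> q = h \<cdot> q"
  shows "g = h"
proof -
  have t: "q \<in> Arr C" "Dom C q = X" "Cod C q = Q" using q by (auto simp: is_quotient_def Hom_def)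
  have "(g \<cdot> q) \<cdot> s = Zro C (Dom C s) (Cod C g)" if "s \<in> S" for s
  proof -
    have "s \<in> Arr C" "Cod C s = X" "q \<cdot> s = Zro C (Dom C s) Q"
      using q that by (auto simp: is_quotient_def Hom_def)
    then show ?thesis using t h(1,3) by (simp add: Cmp_assoc')
  qed
  moreover have "g \<cdot> q \<in> Hom C X (Cod C g)" using t h(1,3) by (simp add: Hom_def)
  ultimately have ex: "\<exists>!k. k \<in> Hom C Q (Cod C g) \<and> k \<cdot> q = g \<cdot> q"
    by (intro quotient_ex1[OF q])
  have "g \<in> Hom C Q (Cod C g) \<and> g \<cdot> q = g \<cdot> q" "h \<in> Hom C Q (Cod C g) \<and> h \<cdot> q = g \<cdot> q"
    using h eq by (simp_all add: Hom_def)
  then show ?thesis using the1_equality[OF ex, of g] the1_equality[OF ex, of h] by simp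
qed

text \<open>The quotient is by a family, whereas tensoring is known to preserve cokernels of single
  arrows. As an epic arrow of an abelian category, \<open>q\<close> is the cokernel of some arrow
  \<open>f\<close>, and that description survives tensoring on both sides.\<close>

lemma quotient_stably_epic:
  assumes "is_quotient C X S Q q" shows "stably_epic Q {q}"
  unfolding stably_epic_def
proof (intro allI impI)
  fix U W g h
  assume h: "U \<in> Ob C" "W \<in> Ob C" "g \<in> Arr C" "h \<in> Arr C" "Dom C g = U \<boxdot> Q \<boxdot> W" "Dom C h = U \<boxdot> Q \<boxdot> W" "Cod C g = Cod C h"
    "\<forall>e\<in>{q}. g \<cdot> ((Ide C U \<boxtimes> e) \<boxtimes> Ide C W) = h \<cdot> ((Ide C U \<boxtimes> e) \<boxtimes> Ide C W)"
  have t: "q \<in> Arr C" "Cod C q = Q" using assms by (auto simp: is_quotient_def Hom_def)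
  have "epi_arrow C q"
    unfolding epi_arrow_def
  proof (intro conjI allI impI)
    fix W g h assume "g \<in> Hom C (Cod C q) W \<and> h \<in> Hom C (Cod C q) W \<and> g \<cdot> q = h \<cdot> q"
    then show "g = h" using t by (intro quotient_epic[OF assms, of g h]) (auto simp: Hom_def)
  qed (rule t)
  then obtain f where "is_cokernel C f q" using epi_is_cokernel by blast
  then have "is_cokernel C ((Ide C U \<boxtimes> f) \<boxtimes> Ide C W) ((Ide C U \<boxtimes> q) \<boxtimes> Ide C W)"
    by (intro TenA_cokernel_left TenA_cokernel_right h)
  then show "g = h"
    unfolding is_cokernel_def by (rule quotient_epic) (use h t in simp_all)
qed

lemma coproduct_ex1:
  "\<lbrakk>is_coproduct C X T i; Y \<in> Ob C; \<And>n. f n \<in> Hom C (X n) Y\<rbrakk>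
    \<Longrightarrow> \<exists>!g. g \<in> Hom C T Y \<and> (\<forall>n. g \<cdot> i n = f n)"
  unfolding is_coproduct_def by blast

lemma coproduct_unique:
  assumes c: "is_coproduct C X T i" and g: "g \<in> Hom C T Y" and h: "h \<in> Hom C T Y" and eq: "\<And>n. g \<cdot> i n = h \<cdot> i n"
  shows "g = h"
proof -
  have "\<exists>!k. k \<in> Hom C T Y \<and> (\<forall>n. k \<cdot> i n = h \<cdot> i n)"
    using c h by (intro coproduct_ex1) (auto simp: is_coproduct_def Hom_def)
  with g h eq show ?thesis by blast
qed

lemma coproduct_stably_epic:
  assumes "is_coproduct C X T i" shows "stably_epic T (range i)"
  unfolding stably_epic_def
proof (intro allI impI)
  fix U W g h
  assume h: "U \<in> Ob C" "W \<in> Ob C" "g \<in> Arr C" "h \<in> Arr C" "Dom C g = U \<boxdot> T \<boxdot> W" "Dom C h = U \<boxdot> T \<boxdot> W" "Cod C g = Cod C h"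
    "\<forall>e\<in>range i. g \<cdot> ((Ide C U \<boxtimes> e) \<boxtimes> Ide C W) = h \<cdot> ((Ide C U \<boxtimes> e) \<boxtimes> Ide C W)"
  let ?i = "\<lambda>n. (Ide C U \<boxtimes> i n) \<boxtimes> Ide C W"
  have "is_coproduct C (\<lambda>n. U \<boxdot> X n \<boxdot> W) (U \<boxdot> T \<boxdot> W) ?i"
    by (intro TenA_coproduct_left TenA_coproduct_right assms h)
  then show "g = h"
    by (rule coproduct_unique) (use h in \<open>auto simp: Hom_def\<close>)
qed

text \<open>Meant for the inclusions \<open>V^n \<rightarrow> TV\<close> followed by the quotient
  arrow \<open>TV \<rightarrow> B\<close>.\<close>

lemma stably_epic_Cmp:
  assumes e: "stably_epic X F" and q: "stably_epic Y {q}" and "q \<in> Arr C" "Dom C q = X" "Cod C q = Y"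
    and F: "\<And>e. e \<in> F \<Longrightarrow> e \<in> Arr C \<and> Cod C e = X"
  shows "stably_epic Y ((\<lambda>e. q \<cdot> e) ` F)"
  unfolding stably_epic_def
proof (intro allI impI)
  fix U W g h
  assume h: "U \<in> Ob C" "W \<in> Ob C" "g \<in> Arr C" "h \<in> Arr C" "Dom C g = U \<boxdot> Y \<boxdot> W" "Dom C h = U \<boxdot> Y \<boxdot> W" "Cod C g = Cod C h"
    and eq: "\<forall>e\<in>(\<lambda>e. q \<cdot> e) ` F. g \<cdot> ((Ide C U \<boxtimes> e) \<boxtimes> Ide C W) = h \<cdot> ((Ide C U \<boxtimes> e) \<boxtimes> Ide C W)"
  let ?q = "(Ide C U \<boxtimes> q) \<boxtimes> Ide C W"
  have "g \<cdot> ?q = h \<cdot> ?q"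
  proof (rule e[unfolded stably_epic_def, rule_format, of U W])
    fix x assume x: "x \<in> F"
    have "((Ide C U \<boxtimes> (q \<cdot> x)) \<boxtimes> Ide C W) = ?q \<cdot> ((Ide C U \<boxtimes> x) \<boxtimes> Ide C W)"
      using F[OF x] assms h by (simp add: interchange)
    then show "(g \<cdot> ?q) \<cdot> ((Ide C U \<boxtimes> x) \<boxtimes> Ide C W) = (h \<cdot> ?q) \<cdot> ((Ide C U \<boxtimes> x) \<boxtimes> Ide C W)"
      using eq x F[OF x] assms h by (auto simp: Cmp_assoc')
  qed (use assms h in simp_all)
  then show "g = h"
    using q h unfolding stably_epic_def by blast
qed

end

lemma (in abelian_braided_category) stricts_eq: "\<lbrakk>f = g; stricts s t f \<phi>; stricts s t g \<psi>\<rbrakk> \<Longrightarrow> \<phi> = \<psi>"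
  using stricts_fun by blast

text \<open>The sum has one term, whose reduced word is empty. The counit of \<open>B\<close>
  depends on this, since the identity has zero kernel.\<close>

lemma (in abelian_braided_category) braided_fact_0: "V \<in> Ob C \<Longrightarrow> braided_fact C V 0 = Ide C (Uni C)"
proof -
  interpret G: comm_group "hom_group C (Uni C) (Uni C)" by (simp add: hom_comm_group)
  have "reduced_word 0 id w \<longleftrightarrow> w = []" for w by (auto simp: reduced_word_def)
  then have "braid_perm C V 0 id = Ide C (Uni C)" by (simp add: braid_perm_def)
  moreover have "{\<sigma>. \<sigma> permutes {..<0::nat}} = {id}" by (auto simp: permutes_empty)
  ultimately show ?thesis
    by (simp add: braided_fact_def carrier_hom_group)
qed

section \<open>The given data and their strict counterparts\<close>

locale double_complex_data = abelian_braided_category C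
  for C :: "('o, 'a, 'z) braided_cat_scheme" (structure) +
  fixes V T B :: 'o and i :: "nat \<Rightarrow> 'a" and mT \<pi> mB \<Delta> \<omega> :: 'a
    and L :: "nat \<Rightarrow> 'o" and q :: "nat \<Rightarrow> 'a" and w :: "nat \<Rightarrow> nat \<Rightarrow> 'a"
  assumes V_Ob [simp]: "V \<in> Ob C" and TV: "tensor_algebra C V T i mT" and BV: "B_plus C V T i mT B \<pi> mB"
    and cop: "B_coproduct C V i B \<pi> mB \<Delta>" and pr: "B_proj1 C V i B \<pi> \<omega>" and ext: "exterior_algebra C V L q w"
begin

lemma typing [simp]:
  "i n \<in> Arr C" "Dom C (i n) = tpow C V n" "Cod C (i n) = T" "mT \<in> Arr C" "Dom C mT = T \<boxdot> T" "Cod C mT = T"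
  "\<pi> \<in> Arr C" "Dom C \<pi> = T" "Cod C \<pi> = B" "mB \<in> Arr C" "Dom C mB = B \<boxdot> B" "Cod C mB = B"
  "\<Delta> \<in> Arr C" "Dom C \<Delta> = B" "Cod C \<Delta> = B \<boxdot> B" "\<omega> \<in> Arr C" "Dom C \<omega> = B" "Cod C \<omega> = V"
  "q n \<in> Arr C" "Dom C (q n) = tpow C V n" "Cod C (q n) = L n"
  "w k n \<in> Arr C" "Dom C (w k n) = L k \<boxdot> L n" "Cod C (w k n) = L (k + n)"
  using TV BV cop pr ext
  by (auto simp: tensor_algebra_def is_coproduct_def B_plus_def is_quotient_def B_coproduct_def B_proj1_def
    exterior_algebra_def Hom_def)

lemma objects [simp]: "T \<in> Ob C" "B \<in> Ob C" "L n \<in> Ob C"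
  using Cod_Ob[OF typing(1)] Cod_Ob[OF typing(7)] Cod_Ob[OF typing(19)] by simp_all

text \<open>The projection of \<open>TV\<close> to degree zero kills the relations: for positive
  \<open>n\<close> it vanishes on \<open>V^n\<close>, and for \<open>n = 0\<close> the kernel
  divided out is zero.\<close>

lemma ex_counit:
  "\<exists>\<epsilon>. \<epsilon> \<in> Arr C \<and> Dom C \<epsilon> = B \<and> Cod C \<epsilon> = Uni C \<and>
    (\<forall>n. \<epsilon> \<cdot> \<pi> \<cdot> i n = (if n = 0 then Ide C (Uni C) else Zro C (tpow C V n) (Uni C)))"
proof -
  let ?e = "\<lambda>n. if n = 0 then Ide C (Uni C) else Zro C (tpow C V n) (Uni C)"
  have "is_coproduct C (tpow C V) T i" using TV by (simp add: tensor_algebra_def)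
  then have "\<exists>!g. g \<in> Hom C T (Uni C) \<and> (\<forall>n. g \<cdot> i n = ?e n)"
    by (rule coproduct_ex1) (auto simp: Hom_def)
  then obtain g where g: "g \<in> Hom C T (Uni C)" "\<And>n. g \<cdot> i n = ?e n" by auto
  let ?S = "{i n \<cdot> k | n k. is_kernel C (braided_fact C V n) k}"
  have quot: "is_quotient C T ?S B \<pi>" using BV by (simp add: B_plus_def)
  have "\<exists>!h. h \<in> Hom C B (Uni C) \<and> h \<cdot> \<pi> = g"
  proof (rule quotient_ex1[OF quot g(1)])
    fix s assume "s \<in> ?S"
    then obtain n k where s: "s = i n \<cdot> k" and k: "is_kernel C (braided_fact C V n) k" by blast
    have "i n \<cdot> k \<in> Hom C (Dom C (i n \<cdot> k)) T"
      using quot s \<open>s \<in> ?S\<close> unfolding is_quotient_def by blast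
    have ka: "k \<in> Arr C" "Cod C k = Dom C (braided_fact C V n)" using k by (auto simp: is_kernel_def)
    have kc: "Cod C k = tpow C V n"
    \<comment> \<open>\<open>is_kernel\<close> ties the codomain of \<open>k\<close> to the domain
      of the braided factorial, so the latter first has to be typed as an endomorphism of
      \<open>V^n\<close>.\<close>
    proof -
      interpret G: comm_group "hom_group C (tpow C V n) (tpow C V n)" by (simp add: hom_comm_group)
      have gen: "braid_gen C V l j \<in> Hom C (tpow C V l) (tpow C V l)" for l j
      proof (induction l arbitrary: j)
        case (Suc l)
        then show ?case by (cases l) (auto simp: Hom_def)
      qed (auto simp: Hom_def)
      have "braid_word C V n u \<in> Hom C (tpow C V n) (tpow C V n)" for u
        by (induction u) (use gen[of n] in \<open>auto simp: Hom_def\<close>)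
      then have "braided_fact C V n \<in> carrier (hom_group C (tpow C V n) (tpow C V n))"
        unfolding braided_fact_def by (intro G.finprod_closed) (auto simp: hom_group_def braid_perm_def)
      then show ?thesis using ka by (simp add: carrier_hom_group)
    qed
    have "g \<cdot> s = (g \<cdot> i n) \<cdot> k" using g(1) ka kc by (simp add: s Cmp_assoc' Hom_def)
    also have "\<dots> = Zro C (Dom C k) (Uni C)"
    proof (cases n)
      \<comment> \<open>The braided factorial is the identity here, so the kernel equation says that
        \<open>k\<close> itself is zero.\<close>
      case 0
      have "k = Zro C (Dom C k) (Uni C)"
        using k ka kc braided_fact_0[OF V_Ob] by (simp add: 0 is_kernel_def)
      then show ?thesis using ka kc g(2)[of 0] by (simp add: 0)
    qed (use ka kc g(2)[of n] in simp)
    finally show "g \<cdot> s = Zro C (Dom C s) (Uni C)" using ka kc by (simp add: s)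
  qed
  then obtain h where "h \<in> Hom C B (Uni C)" "h \<cdot> \<pi> = g" by auto
  then show ?thesis using g by (intro exI[of _ h]) (auto simp: Hom_def simp flip: Cmp_assoc')
qed

definition \<epsilon> :: 'a where
  "\<epsilon> = (SOME \<epsilon>. \<epsilon> \<in> Arr C \<and> Dom C \<epsilon> = B \<and> Cod C \<epsilon> = Uni C \<and>
    (\<forall>n. \<epsilon> \<cdot> \<pi> \<cdot> i n = (if n = 0 then Ide C (Uni C) else Zro C (tpow C V n) (Uni C))))"

lemma \<epsilon> [simp]: "\<epsilon> \<in> Arr C" "Dom C \<epsilon> = B" "Cod C \<epsilon> = Uni C"
  and \<epsilon>_i: "\<epsilon> \<cdot> \<pi> \<cdot> i n = (if n = 0 then Ide C (Uni C) else Zro C (tpow C V n) (Uni C))"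
  using someI_ex[OF ex_counit] unfolding \<epsilon>_def[symmetric] by auto

definition "s_m = strict (Tn (Lf B) (Lf B)) (Lf B) mB"
definition "s_\<Delta> = strict (Lf B) (Tn (Lf B) (Lf B)) \<Delta>"
definition "s_\<epsilon> = strict (Lf B) Ut \<epsilon>"
definition "s_\<pi> = strict (Lf B) (Lf (L 1)) (L_incl C V q \<cdot> \<omega>)"
definition "s_a n = strict (power_tree V n) (Lf B) (\<pi> \<cdot> i n)"
definition "s_q n = strict (power_tree V n) (Lf (L n)) (q n)"
definition "s_w k n = strict (Tn (Lf (L k)) (Lf (L n))) (Lf (L (k + n))) (w k n)"

lemma L_incl [simp]: "L_incl C V q \<in> Arr C" "Dom C (L_incl C V q) = V" "Cod C (L_incl C V q) = L 1"
  by (simp_all add: L_incl_def)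

lemma st_m: "stricts (Tn (Lf B) (Lf B)) (Lf B) mB s_m"
  and st_\<Delta>: "stricts (Lf B) (Tn (Lf B) (Lf B)) \<Delta> s_\<Delta>"
  and st_\<epsilon>: "stricts (Lf B) Ut \<epsilon> s_\<epsilon>"
  and st_\<pi>: "stricts (Lf B) (Lf (L 1)) (L_incl C V q \<cdot> \<omega>) s_\<pi>"
  and st_a: "stricts (power_tree V n) (Lf B) (\<pi> \<cdot> i n) (s_a n)"
  and st_q: "stricts (power_tree V n) (Lf (L n)) (q n) (s_q n)"
  and st_w: "stricts (Tn (Lf (L k)) (Lf (L n))) (Lf (L (k + n))) (w k n) (s_w k n)"
  by (simp_all add: s_m_def s_\<Delta>_def s_\<epsilon>_def s_\<pi>_def s_a_def s_q_def s_w_def stricts_strict)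

lemma s_typing [simp]:
  "valid s_m" "sdom s_m = [B, B]" "scod s_m = [B]" "valid s_\<Delta>" "sdom s_\<Delta> = [B]" "scod s_\<Delta> = [B, B]"
  "valid s_\<epsilon>" "sdom s_\<epsilon> = [B]" "scod s_\<epsilon> = []" "valid s_\<pi>" "sdom s_\<pi> = [B]" "scod s_\<pi> = [L (Suc 0)]"
  "valid (s_a n)" "sdom (s_a n) = replicate n V" "scod (s_a n) = [B]"
  "valid (s_q n)" "sdom (s_q n) = replicate n V" "scod (s_q n) = [L n]"
  "valid (s_w k n)" "sdom (s_w k n) = [L k, L n]" "scod (s_w k n) = [L (k + n)]"
  using stricts_D(4-6)[OF st_m] stricts_D(4-6)[OF st_\<Delta>] stricts_D(4-6)[OF st_\<epsilon>] stricts_D(4-6)[OF st_\<pi>]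
    stricts_D(4-6)[OF st_a] stricts_D(4-6)[OF st_q] stricts_D(4-6)[OF st_w] by simp_all

lemma st_B_unit: "stricts Ut (Lf B) (B_unit C i \<pi>) (s_a 0)"
  using st_a[of 0] by (simp add: B_unit_def)

lemma st_Inv_Lun: "tobj t = X \<Longrightarrow> stricts t (Tn Ut t) (Inv C (Lun C X)) (sid (flat t))"
  and st_Inv_Run: "tobj t = X \<Longrightarrow> stricts t (Tn t Ut) (Inv C (Run C X)) (sid (flat t))"
  using stricts_Inv[OF stricts_Lun] stricts_Inv[OF stricts_Run] tobj_Ob[of t] by auto

lemma st_B_incl: "stricts (Lf V) (Lf B) (B_incl C V i \<pi>) (s_a 1)"
proof -
  have a: "stricts (Tn Ut (Lf V)) (Lf B) (\<pi> \<cdot> i 1) (s_a 1)" using st_a[of 1] by simp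
  have "stricts (Lf V) (Lf B) ((\<pi> \<cdot> i 1) \<cdot> Inv C (Lun C V)) (s_a 1)"
    by (rule stricts_Cmp'[OF st_Inv_Lun a]) simp_all
  then show ?thesis by (simp add: B_incl_def Cmp_assoc')
qed

lemma s_m_a: "scomp s_m (sten (s_a k) (s_a n)) = s_a (k + n)"
proof (rule stricts_eq)
  have "mT \<cdot> (i k \<boxtimes> i n) = i (k + n) \<cdot> tpow_mult C V k n" "mB \<cdot> (\<pi> \<boxtimes> \<pi>) = \<pi> \<cdot> mT"
    using TV BV by (simp_all add: tensor_algebra_def B_plus_def)
  moreover note stricts_D(1-3)[OF stricts_tpow_mult[OF V_Ob, of k n], simp]
  ultimately have "(mB \<cdot> (\<pi> \<boxtimes> \<pi>)) \<cdot> (i k \<boxtimes> i n) = (\<pi> \<cdot> i (k + n)) \<cdot> tpow_mult C V k n"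
    by (simp add: Cmp_assoc')
  then show "mB \<cdot> ((\<pi> \<cdot> i k) \<boxtimes> (\<pi> \<cdot> i n)) = (\<pi> \<cdot> i (k + n)) \<cdot> tpow_mult C V k n"
    by (simp add: Cmp_assoc' interchange)
  show "stricts (Tn (power_tree V k) (power_tree V n)) (Lf B) (mB \<cdot> ((\<pi> \<cdot> i k) \<boxtimes> (\<pi> \<cdot> i n))) (scomp s_m (sten (s_a k) (s_a n)))"
    by (rule stricts_Cmp stricts_TenA st_m st_a)+
  show "stricts (Tn (power_tree V k) (power_tree V n)) (Lf B) ((\<pi> \<cdot> i (k + n)) \<cdot> tpow_mult C V k n) (s_a (k + n))"
    by (rule stricts_Cmp'[OF stricts_tpow_mult st_a]) simp_all
qed

lemma s_w_q: "scomp (s_w k n) (sten (s_q k) (s_q n)) = s_q (k + n)"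
proof (rule stricts_eq)
  show "w k n \<cdot> (q k \<boxtimes> q n) = q (k + n) \<cdot> tpow_mult C V k n" using ext by (simp add: exterior_algebra_def)
  show "stricts (Tn (power_tree V k) (power_tree V n)) (Lf (L (k + n))) (w k n \<cdot> (q k \<boxtimes> q n)) (scomp (s_w k n) (sten (s_q k) (s_q n)))"
    by (rule stricts_Cmp stricts_TenA st_w st_q)+
  show "stricts (Tn (power_tree V k) (power_tree V n)) (Lf (L (k + n))) (q (k + n) \<cdot> tpow_mult C V k n) (s_q (k + n))"
    by (rule stricts_Cmp'[OF stricts_tpow_mult st_q]) simp_all
qed

lemma s_jointly_epic_a: "S.jointly_epic (range s_a) [B]"
proof -
  have "is_coproduct C (tpow C V) T i" "is_quotient C T {i n \<cdot> k | n k. is_kernel C (braided_fact C V n) k} B \<pi>"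
    using TV BV by (simp_all add: tensor_algebra_def B_plus_def)
  then have "stably_epic B ((\<lambda>e. \<pi> \<cdot> e) ` range i)"
    by (intro stably_epic_Cmp[OF coproduct_stably_epic quotient_stably_epic]) auto
  moreover have "(\<lambda>e. \<pi> \<cdot> e) ` range i = {\<pi> \<cdot> i n |n. True}" "{s_a n |n. True} = range s_a" by auto
  ultimately show ?thesis
    using jointly_epic_strict[of "Lf B" "\<lambda>n. \<pi> \<cdot> i n" "\<lambda>_. True" "power_tree V" s_a] st_a by simp
qed

lemma s_jointly_epic_q: "S.jointly_epic {s_q n} [L n]"
proof -
  have "is_quotient C (tpow C V n) (wedge_ideal C V n) (L n) (q n)" using ext by (simp add: exterior_algebra_def)
  from quotient_stably_epic[OF this] show ?thesis
    using jointly_epic_strict[of "Lf (L n)" q "\<lambda>k. k = n" "power_tree V" s_q] st_q by simp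
qed

lemma s_\<epsilon>_a: "scomp s_\<epsilon> (s_a n) = (if n = 0 then sid [] else szero (replicate n V) [])"
proof (rule stricts_eq)
  show "stricts (power_tree V n) Ut (\<epsilon> \<cdot> \<pi> \<cdot> i n) (scomp s_\<epsilon> (s_a n))" by (rule stricts_Cmp st_\<epsilon> st_a)+
  show "stricts (power_tree V n) Ut (if n = 0 then Ide C (Uni C) else Zro C (tpow C V n) (Uni C))
      (if n = 0 then sid [] else szero (replicate n V) [])"
    using stricts_Ide[of Ut] stricts_Zro[of "power_tree V n" _ Ut] by simp
qed (rule \<epsilon>_i)

lemma s_\<pi>_a: "scomp s_\<pi> (s_a n) = (if n = 1 then s_q 1 else szero (replicate n V) [L 1])"
proof (rule stricts_eq)
  have "(L_incl C V q \<cdot> \<omega>) \<cdot> \<pi> \<cdot> i n = L_incl C V q \<cdot> (\<omega> \<cdot> \<pi> \<cdot> i n)" by (simp add: Cmp_assoc')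
  also have "\<omega> \<cdot> \<pi> \<cdot> i n = (if n = 1 then Lun C V else Zro C (tpow C V n) V)"
    using pr by (simp add: B_proj1_def)
  also have "L_incl C V q \<cdot> \<dots> = (if n = 1 then q 1 else Zro C (tpow C V n) (L 1))"
    by (simp add: L_incl_def Cmp_assoc')
  finally show "(L_incl C V q \<cdot> \<omega>) \<cdot> \<pi> \<cdot> i n = \<dots>" .
  show "stricts (power_tree V n) (Lf (L 1)) ((L_incl C V q \<cdot> \<omega>) \<cdot> \<pi> \<cdot> i n) (scomp s_\<pi> (s_a n))"
    by (rule stricts_Cmp[OF st_a st_\<pi>])
  show "stricts (power_tree V n) (Lf (L 1)) (if n = 1 then q 1 else Zro C (tpow C V n) (L 1))
      (if n = 1 then s_q 1 else szero (replicate n V) [L 1])"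
    using st_q[of 1] stricts_Zro[of "power_tree V n" _ "Lf (L 1)"] by simp
qed

lemma s_\<Delta>_m: "scomp s_\<Delta> s_m
  = scomp (sten s_m s_m) (scomp (sten (sid [B]) (sten (sbrd [B] [B]) (sid [B]))) (sten s_\<Delta> s_\<Delta>))"
proof -
  have "scomp s_\<Delta> s_m = scomp (S.bmult [B] [B] [B] [B] s_m s_m) (sten s_\<Delta> s_\<Delta>)"
  proof (rule stricts_eq)
    show "\<Delta> \<cdot> mB = braided_mult C B B B B mB mB \<cdot> (\<Delta> \<boxtimes> \<Delta>)" using cop by (simp add: B_coproduct_def)
    show "stricts (Tn (Lf B) (Lf B)) (Tn (Lf B) (Lf B)) (\<Delta> \<cdot> mB) (scomp s_\<Delta> s_m)"
      by (rule stricts_Cmp[OF st_m st_\<Delta>])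
    show "stricts (Tn (Lf B) (Lf B)) (Tn (Lf B) (Lf B)) (braided_mult C B B B B mB mB \<cdot> (\<Delta> \<boxtimes> \<Delta>))
        (scomp (S.bmult [B] [B] [B] [B] s_m s_m) (sten s_\<Delta> s_\<Delta>))"
      using stricts_Cmp[OF stricts_TenA[OF st_\<Delta> st_\<Delta>] stricts_braided_mult[OF st_m st_m]] by simp
  qed
  then show ?thesis by (simp add: S.bmult_def scomp_assoc)
qed

lemma s_\<Delta>_a:
  "scomp s_\<Delta> (s_a 0) = sten (s_a 0) (s_a 0)"
  "scomp s_\<Delta> (s_a 1) = sadd (sten (s_a 1) (s_a 0)) (sten (s_a 0) (s_a 1))"
proof -
  let ?u = "B_unit C i \<pi>" and ?v = "B_incl C V i \<pi>"
  have "scomp s_\<Delta> (s_a 0) = scomp (sten (s_a 0) (s_a 0)) (sid [])"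
  proof (rule stricts_eq)
    show "\<Delta> \<cdot> ?u = (?u \<boxtimes> ?u) \<cdot> Inv C (Lun C (Uni C))" using cop by (simp add: B_coproduct_def)
    show "stricts Ut (Tn (Lf B) (Lf B)) (\<Delta> \<cdot> ?u) (scomp s_\<Delta> (s_a 0))" by (rule stricts_Cmp[OF st_B_unit st_\<Delta>])
    show "stricts Ut (Tn (Lf B) (Lf B)) ((?u \<boxtimes> ?u) \<cdot> Inv C (Lun C (Uni C))) (scomp (sten (s_a 0) (s_a 0)) (sid []))"
      using stricts_Cmp[OF st_Inv_Lun[of Ut] stricts_TenA[OF st_B_unit st_B_unit]] by simp
  qed
  then show "scomp s_\<Delta> (s_a 0) = sten (s_a 0) (s_a 0)" by simp
  have "scomp s_\<Delta> (s_a 1) = sadd (scomp (sten (s_a 1) (s_a 0)) (sid [V])) (scomp (sten (s_a 0) (s_a 1)) (sid [V]))"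
  proof (rule stricts_eq)
    show "\<Delta> \<cdot> ?v = (?v \<boxtimes> ?u) \<cdot> Inv C (Run C V) \<boxplus> (?u \<boxtimes> ?v) \<cdot> Inv C (Lun C V)" using cop by (simp add: B_coproduct_def)
    show "stricts (Lf V) (Tn (Lf B) (Lf B)) (\<Delta> \<cdot> ?v) (scomp s_\<Delta> (s_a 1))" by (rule stricts_Cmp[OF st_B_incl st_\<Delta>])
    show "stricts (Lf V) (Tn (Lf B) (Lf B)) ((?v \<boxtimes> ?u) \<cdot> Inv C (Run C V) \<boxplus> (?u \<boxtimes> ?v) \<cdot> Inv C (Lun C V))
        (sadd (scomp (sten (s_a 1) (s_a 0)) (sid [V])) (scomp (sten (s_a 0) (s_a 1)) (sid [V])))"
      using stricts_Add[OF stricts_Cmp[OF st_Inv_Run[of "Lf V" V] stricts_TenA[OF st_B_incl st_B_unit]]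
        stricts_Cmp[OF st_Inv_Lun[of "Lf V" V] stricts_TenA[OF st_B_unit st_B_incl]]] by simp
  qed
  then show "scomp s_\<Delta> (s_a 1) = sadd (sten (s_a 1) (s_a 0)) (sten (s_a 0) (s_a 1))" by simp
qed

lemma s_q_brd: "scomp (s_q 2) (sadd (sid [V, V]) (sbrd [V] [V])) = szero [V, V] [L 2]"
proof (rule stricts_eq)
  let ?t = "Tn (Lf V) (Lf V)"
  \<comment> \<open>The generator of the ideal with \<open>a = b = 0\<close>, the relation itself up
    to canonical isomorphisms; the term \<open>0 + 2\<close> matches the form in
    \<open>wedge_ideal\<close>.\<close>
  let ?r = "tpow_mult C V (0 + 2) 0 \<cdot> ((tpow_mult C V 0 2 \<cdot> (Ide C (tpow C V 0) \<boxtimes> wedge_rel C V)) \<boxtimes> Ide C (tpow C V 0))"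
  have "?r \<in> wedge_ideal C V 2" unfolding wedge_ideal_def by force
  then show "q 2 \<cdot> ?r = Zro C (Dom C ?r) (L 2)" using ext unfolding exterior_algebra_def is_quotient_def by blast
  have "stricts ?t (power_tree V 2) (wedge_rel C V) (scomp (sten (sid [V]) (sid [V])) (sadd (sid [V, V]) (sbrd [V] [V])))"
    unfolding wedge_rel_def
    using stricts_Cmp[OF stricts_Add[OF stricts_Ide[of ?t] stricts_Brd[of "Lf V" _ "Lf V"]]
      stricts_TenA[OF st_Inv_Lun[of "Lf V"] stricts_Ide[of "Lf V"]]] by (simp add: numeral_2_eq_2)
  then have wr: "stricts ?t (power_tree V 2) (wedge_rel C V) (sadd (sid [V, V]) (sbrd [V] [V]))"
    by (simp add: S.ten_ide)
  have "stricts (Tn Ut (power_tree V 2)) (power_tree V 2) (tpow_mult C V 0 2) (sid [V, V])"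
    "stricts (Tn (power_tree V 2) Ut) (power_tree V 2) (tpow_mult C V (0 + 2) 0) (sid [V, V])"
    using stricts_tpow_mult[OF V_Ob, of 0 2] stricts_tpow_mult[OF V_Ob, of 2 0] by (simp_all add: numeral_2_eq_2)
  note tm = this
  have x: "stricts (Tn Ut ?t) (power_tree V 2) (tpow_mult C V 0 2 \<cdot> (Ide C (tpow C V 0) \<boxtimes> wedge_rel C V)) (sadd (sid [V, V]) (sbrd [V] [V]))"
    by (rule stricts_Cmp'[OF stricts_TenA[OF stricts_Ide[of Ut] wr] tm(1)]) simp_all
  have r: "stricts (Tn (Tn Ut ?t) Ut) (power_tree V 2) ?r (sadd (sid [V, V]) (sbrd [V] [V]))"
    by (rule stricts_Cmp'[OF stricts_TenA[OF x stricts_Ide[of Ut]] tm(2)]) simp_all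
  from stricts_Cmp[OF r st_q]
  show "stricts (Tn (Tn Ut ?t) Ut) (Lf (L 2)) (q 2 \<cdot> ?r) (scomp (s_q 2) (sadd (sid [V, V]) (sbrd [V] [V])))" .
  show "stricts (Tn (Tn Ut ?t) Ut) (Lf (L 2)) (Zro C (Dom C ?r) (L 2)) (szero [V, V] [L 2])"
    using stricts_Zro[of "Tn (Tn Ut ?t) Ut" _ "Lf (L 2)"] unfolding stricts_D(2)[OF r] by simp
qed

sublocale D: braided_data sdom scod valid sid scomp sten szero sadd sneg sbrd V B L s_m s_\<Delta> s_\<epsilon> s_\<pi> s_a s_q s_w
  by unfold_locales
    (simp_all add: s_m_a s_w_q s_jointly_epic_a s_jointly_epic_q s_\<epsilon>_a s_\<pi>_a[simplified] s_\<Delta>_m s_\<Delta>_a[simplified] s_q_brd)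

section \<open>Return to the double complex in the given category\<close>

abbreviation Om_tree :: "nat \<Rightarrow> nat \<Rightarrow> 'o tree" where
  "Om_tree p r \<equiv> Tn (Tn (Lf (L p)) (Lf B)) (Lf (L r))"

lemma st_Omega_mult: "stricts (Tn (Om_tree p r) (Om_tree p' r')) (Om_tree (p + p') (r + r')) (Omega_mult C B mB L w p r p' r') (D.MO p r p' r')"
  unfolding Omega_mult_def D.MO_def D.M0_def D.mE_def
  using stricts_signed[OF stricts_braided_mult[OF stricts_braided_mult[OF st_w st_m] st_w]] by simp

lemma st_Omega_unit: "stricts Ut (Om_tree 0 0) (Omega_unit C i \<pi> q) (sten (sten (s_q 0) (s_a 0)) (s_q 0))"
proof -
  have q0: "stricts Ut (Lf (L 0)) (q 0) (s_q 0)" using st_q[of 0] by simp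
  have I: "stricts Ut (Tn Ut Ut) (Inv C (Lun C (Uni C))) (sid [])" using st_Inv_Lun[of Ut] by simp
  show ?thesis
    unfolding Omega_unit_def
    by (rule stricts_Cmp'[OF I stricts_TenA[OF stricts_Cmp[OF I stricts_TenA[OF q0 st_B_unit]] q0]]) simp
qed

lemma st_Ide: "X \<in> Ob C \<Longrightarrow> stricts (Lf X) (Lf X) (Ide C X) (sid [X])"
  using stricts_Ide[of "Lf X"] by simp

lemma st_Asc: "\<lbrakk>X \<in> Ob C; Y \<in> Ob C; Z \<in> Ob C\<rbrakk>
    \<Longrightarrow> stricts (Tn (Tn (Lf X) (Lf Y)) (Lf Z)) (Tn (Lf X) (Tn (Lf Y) (Lf Z))) (Asc C X Y Z) (sid [X, Y, Z])"
  using stricts_Asc[of "Lf X" X "Lf Y" Y "Lf Z" Z] by simp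

lemmas st_rules = stricts_signed stricts_Cmp stricts_TenA st_Asc stricts_Inv[OF st_Asc Asc_iso] st_Ide objects

lemma st_Omega_del: "stricts (Om_tree p r) (Om_tree (Suc p) r) (Omega_del C B \<Delta> \<omega> L w (L_incl C V q) p r) (D.DO p r)"
proof -
  let ?j = "L_incl C V q"
  have w: "stricts (Tn (Lf (L p)) (Lf (L 1))) (Lf (L (Suc p))) (w p 1) (s_w p 1)" using st_w[of p 1] by simp
  have "stricts (Tn (Lf (L p)) (Lf B)) (Tn (Lf (L (Suc p))) (Lf B)) (del_left C B \<Delta> \<omega> L w ?j p)
      (S.sg p (scomp (sten (s_w p 1) (sid [B])) (scomp (sid [L p, L 1, B])
        (scomp (sten (sid [L p]) (sten s_\<pi> (sid [B]))) (sten (sid [L p]) s_\<Delta>)))))"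
    unfolding del_left_def
    by (rule st_rules st_\<Delta> st_\<pi> w)+
  then have "stricts (Tn (Lf (L p)) (Lf B)) (Tn (Lf (L (Suc p))) (Lf B)) (del_left C B \<Delta> \<omega> L w ?j p) (S.sg p (D.dE p))"
    by (simp add: D.dE_def D.del_def S.ten_comp)
  from stricts_TenA[OF this stricts_Ide[of "Lf (L r)"]] show ?thesis
    by (simp add: Omega_del_def D.DO_def)
qed

lemma st_Omega_delbar: "stricts (Om_tree p r) (Om_tree p (Suc r)) (Omega_delbar C B \<Delta> \<omega> L w (L_incl C V q) p r) (D.DO' p r)"
proof -
  let ?j = "L_incl C V q"
  have w: "stricts (Tn (Lf (L 1)) (Lf (L r))) (Lf (L (Suc r))) (w 1 r) (s_w 1 r)" using st_w[of 1 r] by simp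
  have "stricts (Tn (Lf B) (Lf (L r))) (Tn (Lf B) (Lf (L (Suc r)))) (delbar_right C B \<Delta> \<omega> L w ?j r)
      (scomp (sten (sid [B]) (s_w 1 r)) (scomp (sid [B, L 1, L r])
        (scomp (sten (sten (sid [B]) s_\<pi>) (sid [L r])) (sten s_\<Delta> (sid [L r])))))"
    unfolding delbar_right_def
    by (rule st_rules st_\<Delta> st_\<pi> w)+
  then have F: "stricts (Tn (Lf B) (Lf (L r))) (Tn (Lf B) (Lf (L (Suc r)))) (delbar_right C B \<Delta> \<omega> L w ?j r) (D.dF r)"
    by (simp add: D.dF_def S.ten_comp)
  have "stricts (Om_tree p r) (Om_tree p (Suc r)) (Omega_delbar C B \<Delta> \<omega> L w ?j p r)
      (S.sg p (scomp (sid [L p, B, L (Suc r)]) (scomp (sten (sid [L p]) (D.dF r)) (sid [L p, B, L r]))))"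
    unfolding Omega_delbar_def
    unfolding Suc_eq_plus1[symmetric] by (rule st_rules F)+
  then show ?thesis by (simp add: D.DO'_def)
qed

lemma stricts_zero: "stricts (Om_tree p r) (Om_tree p' r') (Zro C (Omega C B L p r) (Omega C B L p' r'))
    (szero [L p, B, L r] [L p', B, L r'])"
  using stricts_Zro[of "Om_tree p r" _ "Om_tree p' r'"] by (simp add: Omega_def)

lemma stricts_Omega_Ide: "stricts (Om_tree p r) (Om_tree p r) (Ide C (Omega C B L p r)) (sid [L p, B, L r])"
  using stricts_Ide[of "Om_tree p r"] by (simp add: Omega_def)

lemma Omega_bigraded_algebra: "bigraded_algebra C (Omega C B L) (Omega_mult C B mB L w) (Omega_unit C i \<pi> q)"
  unfolding bigraded_algebra_def
proof (intro conjI allI)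
  let ?O = "Omega C B L" and ?M = "Omega_mult C B mB L w" and ?e = "Omega_unit C i \<pi> q"
  fix p r p' r' p'' r''
  have tobj: "tobj (Om_tree p r) = ?O p r" for p r by (simp add: Omega_def)
  show "?O p r \<in> Ob C" by (simp add: Omega_def)
  show "?M p r p' r' \<in> Hom C (?O p r \<boxdot> ?O p' r') (?O (p + p') (r + r'))"
    using stricts_D(1-3)[OF st_Omega_mult[of p r p' r']] by (simp add: Hom_def Omega_def)
  show "?e \<in> Hom C (Uni C) (?O 0 0)"
    using stricts_D(1-3)[OF st_Omega_unit] by (simp add: Hom_def Omega_def)
  show "?M (p + p') (r + r') p'' r'' \<cdot> (?M p r p' r' \<boxtimes> Ide C (?O p'' r''))
      = ?M p r (p' + p'') (r' + r'') \<cdot> (Ide C (?O p r) \<boxtimes> ?M p' r' p'' r'') \<cdot> Asc C (?O p r) (?O p' r') (?O p'' r'')"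
  proof (rule stricts_inj)
    show "stricts (Tn (Tn (Om_tree p r) (Om_tree p' r')) (Om_tree p'' r'')) (Om_tree (p + p' + p'') (r + r' + r''))
        (?M (p + p') (r + r') p'' r'' \<cdot> (?M p r p' r' \<boxtimes> Ide C (?O p'' r'')))
        (scomp (D.MO (p + p') (r + r') p'' r'') (sten (D.MO p r p' r') (sid [L p'', B, L r''])))"
      by (rule stricts_Cmp stricts_TenA st_Omega_mult stricts_Omega_Ide)+
    have "stricts (Tn (Tn (Om_tree p r) (Om_tree p' r')) (Om_tree p'' r'')) (Om_tree (p + (p' + p'')) (r + (r' + r'')))
        (?M p r (p' + p'') (r' + r'') \<cdot> (Ide C (?O p r) \<boxtimes> ?M p' r' p'' r'') \<cdot> Asc C (?O p r) (?O p' r') (?O p'' r''))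
        (scomp (D.MO p r (p' + p'') (r' + r'')) (scomp (sten (sid [L p, B, L r]) (D.MO p' r' p'' r''))
          (sid (flat (Om_tree p r) @ flat (Om_tree p' r') @ flat (Om_tree p'' r'')))))"
      by (rule stricts_Cmp stricts_TenA st_Omega_mult stricts_Omega_Ide stricts_Asc tobj)+
    \<comment> \<open>The degrees of the two sides agree only up to associativity of addition, and
      both are now assigned one strict arrow.\<close>
    then show "stricts (Tn (Tn (Om_tree p r) (Om_tree p' r')) (Om_tree p'' r'')) (Om_tree (p + p' + p'') (r + r' + r''))
        (?M p r (p' + p'') (r' + r'') \<cdot> (Ide C (?O p r) \<boxtimes> ?M p' r' p'' r'') \<cdot> Asc C (?O p r) (?O p' r') (?O p'' r''))
        (scomp (D.MO (p + p') (r + r') p'' r'') (sten (D.MO p r p' r') (sid [L p'', B, L r''])))"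
      unfolding D.MO_assoc by (simp add: add.assoc)
  qed
  show "?M 0 0 p r \<cdot> (?e \<boxtimes> Ide C (?O p r)) = Lun C (?O p r)"
  proof (rule stricts_inj)
    show "stricts (Tn Ut (Om_tree p r)) (Om_tree p r) (?M 0 0 p r \<cdot> (?e \<boxtimes> Ide C (?O p r))) (sid [L p, B, L r])"
      by (rule stricts_Cmp'[OF stricts_TenA[OF st_Omega_unit stricts_Omega_Ide[of p r]] st_Omega_mult[of 0 0 p r, simplified]])
        (rule D.MO_unit)
    show "stricts (Tn Ut (Om_tree p r)) (Om_tree p r) (Lun C (?O p r)) (sid [L p, B, L r])"
      using stricts_Lun[OF tobj[of p r]] by simp
  qed
  show "?M p r 0 0 \<cdot> (Ide C (?O p r) \<boxtimes> ?e) = Run C (?O p r)"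
  proof (rule stricts_inj)
    show "stricts (Tn (Om_tree p r) Ut) (Om_tree p r) (?M p r 0 0 \<cdot> (Ide C (?O p r) \<boxtimes> ?e)) (sid [L p, B, L r])"
      by (rule stricts_Cmp'[OF stricts_TenA[OF stricts_Omega_Ide[of p r] st_Omega_unit] st_Omega_mult[of p r 0 0, simplified]])
        (rule D.MO_unit)
    show "stricts (Tn (Om_tree p r) Ut) (Om_tree p r) (Run C (?O p r)) (sid [L p, B, L r])"
      using stricts_Run[OF tobj[of p r]] by simp
  qed
qed

lemma Omega_double_complex:
  "double_complex C (Omega C B L) (Omega_mult C B mB L w) (Omega_unit C i \<pi> q)
    (Omega_del C B \<Delta> \<omega> L w (L_incl C V q)) (Omega_delbar C B \<Delta> \<omega> L w (L_incl C V q))"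
  unfolding double_complex_def graded_derivation_def
proof (intro conjI allI)
  let ?O = "Omega C B L" and ?M = "Omega_mult C B mB L w" and ?d = "Omega_del C B \<Delta> \<omega> L w (L_incl C V q)"
    and ?d' = "Omega_delbar C B \<Delta> \<omega> L w (L_incl C V q)"
  fix p r p' r'
  show "bigraded_algebra C ?O ?M (Omega_unit C i \<pi> q)" by (rule Omega_bigraded_algebra)
  show "?d p r \<in> Hom C (?O p r) (?O (p + 1) (r + 0))" "?d' p r \<in> Hom C (?O p r) (?O (p + 0) (r + 1))"
    using stricts_D(1-3)[OF st_Omega_del[of p r]] stricts_D(1-3)[OF st_Omega_delbar[of p r]]
    by (simp_all add: Hom_def Omega_def)
  show "?d (p + p') (r + r') \<cdot> ?M p r p' r' = ?M (p + 1) (r + 0) p' r' \<cdot> (?d p r \<boxtimes> Ide C (?O p' r'))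
      \<boxplus> signed C (p + r) (?M p r (p' + 1) (r' + 0) \<cdot> (Ide C (?O p r) \<boxtimes> ?d p' r'))"
  \<comment> \<open>Both sides are assigned the strict arrow of the left side;
    \<open>D.DO_MO\<close> rewrites it into the form that the right side produces.\<close>
  proof (rule stricts_inj)
    let ?s = "Tn (Om_tree p r) (Om_tree p' r')" and ?t = "Om_tree (Suc (p + p')) (r + r')"
    show "stricts ?s ?t (?d (p + p') (r + r') \<cdot> ?M p r p' r') (scomp (D.DO (p + p') (r + r')) (D.MO p r p' r'))"
      by (rule stricts_Cmp st_Omega_mult st_Omega_del)+
    have "stricts ?s ?t (?M (Suc p) r p' r' \<cdot> (?d p r \<boxtimes> Ide C (?O p' r')))
        (scomp (D.MO (Suc p) r p' r') (sten (D.DO p r) (sid [L p', B, L r'])))"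
      using stricts_Cmp[OF stricts_TenA[OF st_Omega_del stricts_Omega_Ide] st_Omega_mult] by simp
    moreover have "stricts ?s ?t (?M p r (Suc p') r' \<cdot> (Ide C (?O p r) \<boxtimes> ?d p' r'))
        (scomp (D.MO p r (Suc p') r') (sten (sid [L p, B, L r]) (D.DO p' r')))"
      using stricts_Cmp[OF stricts_TenA[OF stricts_Omega_Ide st_Omega_del] st_Omega_mult[of _ _ "Suc p'"]] by simp
    ultimately show "stricts ?s ?t (?M (p + 1) (r + 0) p' r' \<cdot> (?d p r \<boxtimes> Ide C (?O p' r'))
        \<boxplus> signed C (p + r) (?M p r (p' + 1) (r' + 0) \<cdot> (Ide C (?O p r) \<boxtimes> ?d p' r')))
      (scomp (D.DO (p + p') (r + r')) (D.MO p r p' r'))"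
      unfolding D.DO_MO by (simp add: stricts_Add stricts_signed)
  qed
  show "?d' (p + p') (r + r') \<cdot> ?M p r p' r' = ?M (p + 0) (r + 1) p' r' \<cdot> (?d' p r \<boxtimes> Ide C (?O p' r'))
      \<boxplus> signed C (p + r) (?M p r (p' + 0) (r' + 1) \<cdot> (Ide C (?O p r) \<boxtimes> ?d' p' r'))"
  proof (rule stricts_inj)
    let ?s = "Tn (Om_tree p r) (Om_tree p' r')" and ?t = "Om_tree (p + p') (Suc (r + r'))"
    show "stricts ?s ?t (?d' (p + p') (r + r') \<cdot> ?M p r p' r') (scomp (D.DO' (p + p') (r + r')) (D.MO p r p' r'))"
      by (rule stricts_Cmp st_Omega_mult st_Omega_delbar)+
    have "stricts ?s ?t (?M p (Suc r) p' r' \<cdot> (?d' p r \<boxtimes> Ide C (?O p' r')))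
        (scomp (D.MO p (Suc r) p' r') (sten (D.DO' p r) (sid [L p', B, L r'])))"
      using stricts_Cmp[OF stricts_TenA[OF st_Omega_delbar stricts_Omega_Ide] st_Omega_mult] by simp
    moreover have "stricts ?s ?t (?M p r p' (Suc r') \<cdot> (Ide C (?O p r) \<boxtimes> ?d' p' r'))
        (scomp (D.MO p r p' (Suc r')) (sten (sid [L p, B, L r]) (D.DO' p' r')))"
      using stricts_Cmp[OF stricts_TenA[OF stricts_Omega_Ide st_Omega_delbar] st_Omega_mult[of _ _ _ "Suc r'"]] by simp
    ultimately show "stricts ?s ?t (?M (p + 0) (r + 1) p' r' \<cdot> (?d' p r \<boxtimes> Ide C (?O p' r'))
        \<boxplus> signed C (p + r) (?M p r (p' + 0) (r' + 1) \<cdot> (Ide C (?O p r) \<boxtimes> ?d' p' r')))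
      (scomp (D.DO' (p + p') (r + r')) (D.MO p r p' r'))"
      unfolding D.DO'_MO by (simp add: stricts_Add stricts_signed)
  qed
  have "?d (Suc p) r \<cdot> ?d p r = Zro C (?O p r) (?O (Suc (Suc p)) r)"
    by (rule stricts_inj[OF stricts_Cmp'[OF st_Omega_del st_Omega_del D.DO_DO] stricts_zero])
  then show "?d (p + 1) r \<cdot> ?d p r = Zro C (?O p r) (?O (p + 2) r)" by simp
  have "?d' p (Suc r) \<cdot> ?d' p r = Zro C (?O p r) (?O p (Suc (Suc r)))"
    by (rule stricts_inj[OF stricts_Cmp'[OF st_Omega_delbar st_Omega_delbar D.DO'_DO'] stricts_zero])
  then show "?d' p (r + 1) \<cdot> ?d' p r = Zro C (?O p r) (?O p (r + 2))" by simp
  have "?d p (Suc r) \<cdot> ?d' p r \<boxplus> ?d' (Suc p) r \<cdot> ?d p r = Zro C (?O p r) (?O (Suc p) (Suc r))"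
    by (rule stricts_inj[OF _ stricts_zero])
      (use stricts_Add[OF stricts_Cmp[OF st_Omega_delbar st_Omega_del] stricts_Cmp[OF st_Omega_del st_Omega_delbar], of p r]
       in \<open>simp add: D.DO_DO'\<close>)
  then show "?d p (r + 1) \<cdot> ?d' p r \<boxplus> ?d' (p + 1) r \<cdot> ?d p r = Zro C (?O p r) (?O (p + 1) (r + 1))" by simp
qed

end


theorem proposition3p1:
  fixes C :: "('o, 'a, 'z) braided_cat_scheme"
    and V T B :: 'o and i :: "nat \<Rightarrow> 'a" and mT \<pi> mB \<Delta> \<omega> :: 'a
    and L :: "nat \<Rightarrow> 'o" and q :: "nat \<Rightarrow> 'a" and w :: "nat \<Rightarrow> nat \<Rightarrow> 'a"
  assumes "abelian_braided_category C"
    and "V \<in> Ob C"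
    and "tensor_algebra C V T i mT"
    and "B_plus C V T i mT B \<pi> mB"
    and "B_coproduct C V i B \<pi> mB \<Delta>"
    and "B_proj1 C V i B \<pi> \<omega>"
    and "exterior_algebra C V L q w"
  shows "double_complex C (Omega C B L) (Omega_mult C B mB L w) (Omega_unit C i \<pi> q)
           (Omega_del C B \<Delta> \<omega> L w (L_incl C V q)) (Omega_delbar C B \<Delta> \<omega> L w (L_incl C V q))"
proof -
  interpret abelian_braided_category C by fact
  interpret double_complex_data C V T B i mT \<pi> mB \<Delta> \<omega> L q w
    by unfold_locales fact+
  show ?thesis by (rule Omega_double_complex)
qed

end
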